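(* Let $N\in\mathbb{N}$, $p>1$, $a>0$, and let $G\in C^1(\mathbb{R})$ satisfy $G(0)=0$ and $G(s)\ge a|s|^p$ for all $s\in\mathbb{R}$. Let $f,g\in C_c^\infty(\mathbb{R}^N)$ with $\int_{\mathbb{R}^N}g(x)\,dx>0$, and put $r_0=\sup\{|x|\;;\;x\in\operatorname{supp}(f,g)\}$. Assume $\Gamma_S(N,p)\ge0$ (that is, $1<p\le p_S(N)$, with $p<\infty$). Then there exist constants $\varepsilon_0>0$ and $C>0$, independent of $\varepsilon$, such that the following holds for every $\varepsilon\in(0,\varepsilon_0]$: if $u$ is a weak solution in $(0,T)$ of $$\partial_t^2u-\Delta u=G(u)\ \text{ in }\mathbb{R}^N\times(0,T),\qquad u(0)=\varepsilon f,\quad\partial_tu(0)=\varepsilon g,$$ satisfying $\operatorname{supp}u\subset\{(x,t)\in\mathbb{R}^N\times[0,T]\;;\;|x|\le r_0+t\}$, then $$T\le\begin{cases}C\varepsilon^{-\frac{p-1}{2}}&\text{if }N=1,\ 1<p<\infty,\\ C\varepsilon^{-\frac{p-1}{3-p}}&\text{if }N=2,\ 1<p\le2,\\ C\varepsilon^{-\Gamma_S(2,p)^{-1}}&\text{if }N=2,\ 2<p<p_S(2),\\ C\varepsilon^{-\Gamma_S(N,p)^{-1}}&\text{if }N\ge3,\ 1<p<p_S(N),\\ \exp(C\varepsilon^{-p(p-1)})&\text{if }N\ge2,\ p=p_S(N).\end{cases}$$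
   Context: Set $\gamma_S(N,p)=2+(N+1)p-(N-1)p^2$, $p_S(N)=\sup\{p>1\;;\;\gamma_S(N,p)>0\}$ (so $p_S(1)=\infty$), and $$\Gamma_S(N,p)=\Big(1+\frac1p\Big)(p-1)^{-1}-\frac{N-1}{2}=\frac{\gamma_S(N,p)}{2p(p-1)}.$$ Weak solution in $(0,T)$: a function $u\in C([0,T);H^1(\mathbb{R}^N))\cap C^1([0,T);L^2(\mathbb{R}^N))$ with $G(u)\in L^1(0,T;L^1(\mathbb{R}^N))$, $u(0)=\varepsilon f$, $\partial_tu(0)=\varepsilon g$, such that for every $\Psi\in C_c^\infty(\mathbb{R}^N\times[0,T))$, $$\varepsilon\int_{\mathbb{R}^N}g(x)\Psi(x,0)\,dx+\int_0^T\!\!\int_{\mathbb{R}^N}G(u)\Psi\,dx\,dt=\int_0^T\!\!\int_{\mathbb{R}^N}\big(-\partial_tu\,\partial_t\Psi+\nabla u\cdot\nabla\Psi\big)\,dx\,dt.$$ *)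

theory Defs
  imports "HOL-Analysis.Analysis"
begin

section \<open>The Strauss exponent\<close>

definition gamma_S :: "nat \<Rightarrow> real \<Rightarrow> real" where
  "gamma_S N p = 2 + (real N + 1) * p - (real N - 1) * p\<^sup>2"

text \<open>The supremum is taken in the extended reals, so that \<open>p_S 1 = \<infinity>\<close>.\<close>

definition p_S :: "nat \<Rightarrow> ereal" where
  "p_S N = (SUP p \<in> {p::real. 1 < p \<and> 0 < gamma_S N p}. ereal p)"

definition Gamma_S :: "nat \<Rightarrow> real \<Rightarrow> real" where
  "Gamma_S N p = (1 + 1 / p) * inverse (p - 1) - (real N - 1) / 2"

lemma Gamma_S_eq:
  assumes "1 < p"
  shows "Gamma_S N p = gamma_S N p / (2 * p * (p - 1))"
  using assms by (simp add: Gamma_S_def gamma_S_def field_simps power2_eq_square)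

lemma p_S_1: "p_S 1 = \<infinity>"
proof -
  have "ereal b \<le> p_S 1" for b
  proof -
    have "ereal b \<le> ereal (max 2 b)" by simp
    also have "\<dots> \<le> p_S 1"
      unfolding p_S_def by (rule SUP_upper) (auto simp: gamma_S_def intro: add_pos_pos)
    finally show ?thesis .
  qed
  then show ?thesis by (rule ereal_top)
qed

lemma Gamma_S_nonneg_iff:
  assumes p: "1 < p" and N: "1 \<le> N"
  shows "0 \<le> Gamma_S N p \<longleftrightarrow> ereal p \<le> p_S N"
proof -
  define h where "h q = 2 / q + (real N + 1) - (real N - 1) * q" for q :: real
  have gh: "gamma_S N q = q * h q" if "1 < q" for q
    using that by (simp add: gamma_S_def h_def field_simps power2_eq_square)
  have pos: "0 < gamma_S N q \<longleftrightarrow> 0 < h q" if "1 < q" for q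
    using that by (simp add: gh zero_less_mult_iff)
  have dec: "h r < h q" if "1 < q" "q < r" for q r
  proof -
    have "2 / r < 2 / q" using that by (simp add: field_simps)
    moreover have "(real N - 1) * q \<le> (real N - 1) * r"
      using that N by (intro mult_left_mono) auto
    ultimately show ?thesis by (simp add: h_def)
  qed
  have iff: "0 \<le> Gamma_S N p \<longleftrightarrow> 0 \<le> h p"
    using p by (simp add: Gamma_S_eq gh zero_le_divide_iff zero_le_mult_iff)
  show ?thesis
  proof
    assume "0 \<le> Gamma_S N p"
    then have hp: "0 \<le> h p" by (simp add: iff)
    have "ereal q \<le> p_S N" if "1 < q" "q < p" for q
      unfolding p_S_def using dec[OF that] hp that by (intro SUP_upper) (auto simp: pos)
    show "ereal p \<le> p_S N"
    proof (rule ccontr)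
      assume "\<not> ?thesis"
      then have "max 1 (p_S N) < ereal p" using p by simp
      then obtain q where "max 1 (p_S N) < ereal q" "ereal q < ereal p"
        using ereal_dense2 by blast
      with \<open>\<And>q. \<lbrakk>1 < q; q < p\<rbrakk> \<Longrightarrow> ereal q \<le> p_S N\<close>[of q] show False by (auto dest: leD)
    qed
  next
    assume le: "ereal p \<le> p_S N"
    show "0 \<le> Gamma_S N p"
    proof (rule ccontr)
      assume "\<not> ?thesis"
      then have hp: "h p < 0" by (simp add: iff)
      have "isCont h p" unfolding h_def using p by (intro continuous_intros) auto
      then have "(h \<longlongrightarrow> h p) (at p)" by (simp add: isCont_def)
      then have "\<forall>\<^sub>F q in at p. h q < 0" using hp by (rule order_tendstoD)
      then obtain d where d: "d > 0" "\<And>q. q \<noteq> p \<Longrightarrow> dist q p < d \<Longrightarrow> h q < 0"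
        by (auto simp: eventually_at)
      define q where "q = max ((1 + p) / 2) (p - d / 2)"
      have q: "1 < q" "q < p" "dist q p < d"
        using p d(1) by (auto simp: q_def dist_real_def max_def field_simps)
      have hq: "h q < 0" using d(2) q by auto
      have "p_S N \<le> ereal q"
        unfolding p_S_def
      proof (rule SUP_least)
        fix r assume r: "r \<in> {r. 1 < r \<and> 0 < gamma_S N r}"
        show "ereal r \<le> ereal q"
        proof (rule ccontr)
          assume "\<not> ?thesis"
          then have "h r < h q" using q(1) by (intro dec) auto
          with hq r show False by (auto simp: pos)
        qed
      qed
      with le q(2) show False by (metis ereal_less_eq(3) le_less_trans not_le order_trans)
    qed
  qed
qed


section \<open>Smooth functions and test functions\<close>

definition partial :: "'a::euclidean_space \<Rightarrow> ('a \<Rightarrow> real) \<Rightarrow> 'a \<Rightarrow> real" where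
  "partial i f x = frechet_derivative f (at x) i"

primrec C_k :: "nat \<Rightarrow> ('a::euclidean_space \<Rightarrow> real) \<Rightarrow> bool" where
  "C_k 0 f \<longleftrightarrow> continuous_on UNIV f"
| "C_k (Suc k) f \<longleftrightarrow> (\<forall>x. f differentiable (at x)) \<and> (\<forall>i\<in>Basis. C_k k (partial i f))"

definition smooth :: "('a::euclidean_space \<Rightarrow> real) \<Rightarrow> bool" where
  "smooth f \<longleftrightarrow> (\<forall>k. C_k k f)"

definition supp :: "('a::topological_space \<Rightarrow> real) \<Rightarrow> 'a set" where
  "supp f = closure {x. f x \<noteq> 0}"

definition Cc_smooth :: "('a::euclidean_space \<Rightarrow> real) \<Rightarrow> bool" where
  "Cc_smooth f \<longleftrightarrow> smooth f \<and> compact (supp f)"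

text \<open>
  The time horizon \<open>T\<close> is an extended real, so that \<open>T = \<infinity>\<close> (a global solution) is covered.
\<close>

definition time_ico :: "ereal \<Rightarrow> real set" where
  "time_ico T = {t. 0 \<le> t \<and> ereal t < T}"

definition time_ioo :: "ereal \<Rightarrow> real set" where
  "time_ioo T = {t. 0 < t \<and> ereal t < T}"

text \<open>
  \<open>\<Psi> \<in> C\<^sub>c\<^sup>\<infinity>(\<real>\<^sup>N \<times> [0,T))\<close>, with smoothness up to \<open>t = 0\<close> expressed by a smooth
  extension to \<open>\<real>\<^sup>N \<times> \<real>\<close>. Only the restriction of \<open>\<Psi>\<close> to \<open>\<real>\<^sup>N \<times> [0,T)\<close> is relevant:
  \<open>\<Psi>\<close> need not vanish at time \<open>0\<close>, nor be compactly supported in \<open>t < 0\<close> or \<open>t \<ge> T\<close>.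
\<close>

definition test_fun :: "ereal \<Rightarrow> ('a::euclidean_space \<times> real \<Rightarrow> real) \<Rightarrow> bool" where
  "test_fun T \<Psi> \<longleftrightarrow> smooth \<Psi> \<and>
     compact (closure {z \<in> UNIV \<times> time_ico T. \<Psi> z \<noteq> 0}) \<and>
     closure {z \<in> UNIV \<times> time_ico T. \<Psi> z \<noteq> 0} \<subseteq> UNIV \<times> time_ico T"


section \<open>Function spaces\<close>

text \<open>
  Elements of the Lebesgue and Sobolev spaces are represented by functions; all notions below
  are invariant under changing these on null sets.
\<close>

definition L2 :: "('a::euclidean_space \<Rightarrow> 'b::euclidean_space) \<Rightarrow> bool" where
  "L2 f \<longleftrightarrow> f \<in> borel_measurable lebesgue \<and> integrable lebesgue (\<lambda>x. (norm (f x))\<^sup>2)"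

definition L2_norm :: "('a::euclidean_space \<Rightarrow> 'b::euclidean_space) \<Rightarrow> real" where
  "L2_norm f = sqrt (\<integral>x. (norm (f x))\<^sup>2 \<partial>lebesgue)"

definition weak_gradient :: "('a::euclidean_space \<Rightarrow> real) \<Rightarrow> ('a \<Rightarrow> 'a) \<Rightarrow> bool" where
  "weak_gradient f F \<longleftrightarrow> (\<forall>\<phi>. Cc_smooth \<phi> \<longrightarrow> (\<forall>i\<in>Basis.
     (\<integral>x. f x * partial i \<phi> x \<partial>lebesgue) = - (\<integral>x. (F x \<bullet> i) * \<phi> x \<partial>lebesgue)))"

text \<open>\<open>u \<in> C(I; H\<^sup>1)\<close>, with \<open>Du t\<close> the weak gradient of \<open>u t\<close>.\<close>

definition C0_H1 ::
  "real set \<Rightarrow> (real \<Rightarrow> 'a::euclidean_space \<Rightarrow> real) \<Rightarrow> (real \<Rightarrow> 'a \<Rightarrow> 'a) \<Rightarrow> bool" where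
  "C0_H1 I u Du \<longleftrightarrow>
     (\<forall>t\<in>I. L2 (u t) \<and> L2 (Du t) \<and> weak_gradient (u t) (Du t)) \<and>
     (\<forall>t\<in>I. ((\<lambda>s. sqrt ((L2_norm (\<lambda>x. u s x - u t x))\<^sup>2 +
                            (L2_norm (\<lambda>x. Du s x - Du t x))\<^sup>2)) \<longlongrightarrow> 0) (at t within I))"

text \<open>
  \<open>u \<in> C\<^sup>1(I; L\<^sup>2)\<close>, with \<open>ut\<close> the derivative of \<open>u\<close>; it is one-sided at an end point
  belonging to \<open>I\<close>.
\<close>

definition C1_L2 ::
  "real set \<Rightarrow> (real \<Rightarrow> 'a::euclidean_space \<Rightarrow> real) \<Rightarrow> (real \<Rightarrow> 'a \<Rightarrow> real) \<Rightarrow> bool" where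
  "C1_L2 I u ut \<longleftrightarrow>
     (\<forall>t\<in>I. L2 (u t) \<and> L2 (ut t)) \<and>
     (\<forall>t\<in>I. ((\<lambda>s. L2_norm (\<lambda>x. (u s x - u t x) / (s - t) - ut t x)) \<longlongrightarrow> 0) (at t within I)) \<and>
     (\<forall>t\<in>I. ((\<lambda>s. L2_norm (\<lambda>x. ut s x - ut t x)) \<longlongrightarrow> 0) (at t within I))"

definition simple_L1 :: "(real \<Rightarrow> 'a::euclidean_space \<Rightarrow> real) \<Rightarrow> bool" where
  "simple_L1 s \<longleftrightarrow> (\<exists>m A h.
     (\<forall>k<m. A k \<in> sets lebesgue \<and> integrable lebesgue (h k)) \<and>
     (\<forall>t x. s t x = (\<Sum>k<(m::nat). indicator (A k) t * h k x)))"

text \<open>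
  The Bochner space \<open>L\<^sup>1(I; L\<^sup>1)\<close>: \<open>w t\<close> lies in \<open>L\<^sup>1\<close> for almost every \<open>t\<close>, the map \<open>w\<close> is
  strongly measurable (an a.e. limit of simple functions), and its norm is integrable.
\<close>

definition L1_L1 :: "real set \<Rightarrow> (real \<Rightarrow> 'a::euclidean_space \<Rightarrow> real) \<Rightarrow> bool" where
  "L1_L1 I w \<longleftrightarrow>
     (AE t in lebesgue. t \<in> I \<longrightarrow> integrable lebesgue (w t)) \<and>
     (\<exists>s. (\<forall>n. simple_L1 (s n)) \<and>
        (AE t in lebesgue. t \<in> I \<longrightarrow>
           (\<lambda>n. \<integral>x. \<bar>s n t x - w t x\<bar> \<partial>lebesgue) \<longlonglongrightarrow> 0)) \<and>
     set_integrable lebesgue I (\<lambda>t. \<integral>x. \<bar>w t x\<bar> \<partial>lebesgue)"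

text \<open>
  Support in \<open>\<real>\<^sup>N \<times> [0,T)\<close> of a function that is continuous in time with values in
  \<open>L\<^sup>2\<close>: a point lies outside if \<open>u s\<close> vanishes a.e. near it, for all \<open>s\<close> near it.
\<close>

definition supp_st ::
  "ereal \<Rightarrow> (real \<Rightarrow> 'a::euclidean_space \<Rightarrow> real) \<Rightarrow> ('a \<times> real) set" where
  "supp_st T u = {(x, t). t \<in> time_ico T \<and>
     \<not> (\<exists>\<delta>>0. \<forall>s \<in> time_ico T \<inter> ball t \<delta>. AE y in lebesgue. y \<in> ball x \<delta> \<longrightarrow> u s y = 0)}"


section \<open>Weak solutions\<close>

definition weak_solution ::
  "(real \<Rightarrow> real) \<Rightarrow> ('a::euclidean_space \<Rightarrow> real) \<Rightarrow> ('a \<Rightarrow> real) \<Rightarrow> real \<Rightarrow> ereal \<Rightarrow>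
   (real \<Rightarrow> 'a \<Rightarrow> real) \<Rightarrow> bool" where
  "weak_solution G f g \<epsilon> T u \<longleftrightarrow> (\<exists>ut Du.
     C0_H1 (time_ico T) u Du \<and> C1_L2 (time_ico T) u ut \<and>
     L1_L1 (time_ioo T) (\<lambda>t x. G (u t x)) \<and>
     (AE x in lebesgue. u 0 x = \<epsilon> * f x) \<and> (AE x in lebesgue. ut 0 x = \<epsilon> * g x) \<and>
     (\<forall>\<Psi>. test_fun T \<Psi> \<longrightarrow>
        \<epsilon> * (\<integral>x. g x * \<Psi> (x, 0) \<partial>lebesgue)
          + (LINT t:time_ioo T|lebesgue. (\<integral>x. G (u t x) * \<Psi> (x, t) \<partial>lebesgue))
        = (LINT t:time_ioo T|lebesgue.
             (\<integral>x. - ut t x * partial (0, 1) \<Psi> (x, t)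
                 + (\<Sum>i\<in>Basis. (Du t x \<bullet> i) * partial (i, 0) \<Psi> (x, t)) \<partial>lebesgue))))"

end

theory Submission
  imports Defs
begin

text \<open>
  Pair the equation with \<open>\<psi>\<^sub>R(t) \<Phi>(x, t)\<close>, where \<open>\<psi>\<^sub>R\<close> cuts off at time \<open>R < T\<close> and \<open>\<Phi>\<close> is a positive
  solution of the free wave equation; Young's inequality then absorbs the right-hand side, since
  \<open>\<psi>\<^sub>R\<close> is a high power of a cutoff. All \<open>\<Phi>\<close> are explicit functions of the Lorentz form
  \<open>q\<^sub>s = (t + s)\<^sup>2 - |x|\<^sup>2\<close>, and a large shift \<open>s\<close> makes the sign of the data term that of \<open>\<integral> g\<close>.

  \<^item> \<open>\<Phi> = 1\<close> gives \<open>\<epsilon> + \<integral>\<integral> \<psi>\<^sub>R G(u) \<le> C R\<^bsup>N + 1 - 2p/(p - 1)\<^esup>\<close>.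

  \<^item> \<open>\<Phi> = (t + s) q\<^sub>s\<^bsup>-(N + 1)/2\<^esup>\<close> concentrates near the light cone and bounds
    \<open>\<integral>\<integral> G(u)\<close> over \<open>R/2 \<le> t \<le> R\<close> from below by \<open>c \<epsilon>\<^sup>p R\<^bsup>N - (N - 1)p/2\<^esup>\<close>; with the first
    bound this is the subcritical case.

  \<^item> In the critical case \<open>\<Phi>\<close> is a sum over dyadic shifts \<open>s\<close> of multiples of
    \<open>q\<^sub>s\<^bsup>-(N - 1)/2\<^esup>\<close>, bounded below by a multiple of \<open>t\<^bsup>-\<beta>\<^esup>\<close> with \<open>\<beta> = (N - 1)/2 - 1/p\<close>.
    The integrals \<open>A\<^sub>j\<close> of \<open>t\<^bsup>-\<beta>\<^esup> G(u)\<close> over \<open>t \<le> 2\<^sup>j\<close> satisfy, with \<open>D\<^sub>j = A\<^sub>j\<^sub>+\<^sub>1 - A\<^sub>j\<close>,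
    \<open>D\<^sub>j \<ge> c \<epsilon>\<^sup>p\<close>, \<open>A\<^sub>j\<^sup>p \<le> C j\<^bsup>p - 1\<^esup> D\<^sub>j\<close> and \<open>A\<^sub>j \<le> C j\<close>, a discrete blow-up
    inequality forcing \<open>j \<le> C \<epsilon>\<^bsup>-p(p - 1)\<^esup>\<close>.
\<close>

section \<open>Smooth functions\<close>

text \<open>The d'Alembertian of \<open>q powr (- m)\<close> is
  \<open>2 * m * (2 * m + 1 - N) * q powr (- m - 1)\<close>, so m = (N - 1)/2 gives an exact
  solution; for N \<ge> 2 its time derivative is, up to a constant,
  \<open>(t + s) * q powr (- (N + 1) / 2)\<close>. The singularity on q = 0 shapes the construction:
  u lives in |x| \<le> r0 + t, where a shift s \<ge> r0 + 2 forces q > 1, so powers can be truncated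
  smoothly below q = 1. The truncation is invisible to u and makes the test functions compactly
  supported in space.

  The critical case cannot use one shift: inside the cone \<open>q powr (- (N - 1) / 2)\<close>
  decays like \<open>t powr (- (N - 1))\<close>, faster than the weight
  \<open>t powr (- \<beta>)\<close>. Summing shifts of size 2^k with weights 2^(k A) raises the
  interior. For A = (N - 1)/2 + 1/p the error caused by the cutoff behaves like
  \<open>d powr (1 / p - 1)\<close> in the distance d to the shifted cone; its power p/(p - 1) is
  1/d, with a logarithmic integral. This logarithm, of order j at R = 2^j, produces the factor
  \<open>j powr (p - 1)\<close> and thereby the exponential lifespan.\<close>

lemma partial_eq: "(f has_derivative f') (at x) \<Longrightarrow> partial i f x = f' i"
  by (metis partial_def frechet_derivative_at)

section \<open>Closure properties of smooth functions\<close>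

lemma C_k_SucD: "C_k (Suc k) f \<Longrightarrow> C_k k f"
proof (induction k arbitrary: f)
  case 0
  then show ?case
    by (auto simp: continuous_on_eq_continuous_at intro: differentiable_imp_continuous_within)
next
  case (Suc k)
  then show ?case by (metis C_k.simps(2))
qed

lemma C_k_const [simp]: "C_k k (\<lambda>x::'a::euclidean_space. c)"
proof (induction k arbitrary: c)
  case (Suc k)
  have "partial i (\<lambda>x::'a. c) = (\<lambda>x. 0)" for i
    by (rule ext, rule partial_eq) (auto intro: derivative_eq_intros)
  with Suc show ?case by simp
qed simp

lemma C_k_linear: "bounded_linear L \<Longrightarrow> C_k k (L :: 'a::euclidean_space \<Rightarrow> real)"
proof (cases k)
  case (Suc l)
  assume L: "bounded_linear L"
  have "partial i L = (\<lambda>x. L i)" for i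
    by (rule ext, rule partial_eq) (rule bounded_linear_imp_has_derivative[OF L])
  then show ?thesis using Suc L by (auto intro: bounded_linear_imp_differentiable)
qed (auto intro: linear_continuous_on)

lemma partial_add:
  assumes "f differentiable (at x)" "g differentiable (at x)"
  shows "partial i (\<lambda>x. f x + g x) x = partial i f x + partial i g x"
  unfolding partial_def using assms
  by (intro partial_eq[unfolded partial_def] has_derivative_add)
     (auto simp: frechet_derivative_works)

lemma partial_mult:
  fixes f g :: "'a::euclidean_space \<Rightarrow> real"
  assumes "f differentiable (at x)" "g differentiable (at x)"
  shows "partial i (\<lambda>x. f x * g x) x = f x * partial i g x + partial i f x * g x"
  unfolding partial_def using assms
  by (intro partial_eq[unfolded partial_def] has_derivative_mult)
     (auto simp: frechet_derivative_works)

lemma partial_compose: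
  fixes f :: "'a::euclidean_space \<Rightarrow> real" and h :: "real \<Rightarrow> real"
  assumes "f differentiable (at x)" "h differentiable (at (f x))"
  shows "partial i (\<lambda>x. h (f x)) x = partial 1 h (f x) * partial i f x"
proof -
  let ?H = "frechet_derivative h (at (f x))" and ?F = "frechet_derivative f (at x)"
  have H: "(h has_derivative ?H) (at (f x))" and F: "(f has_derivative ?F) (at x)"
    using assms by (auto simp: frechet_derivative_works)
  have "((\<lambda>x. h (f x)) has_derivative (\<lambda>v. ?H (?F v))) (at x)"
    by (rule has_derivative_compose[OF F H])
  moreover have "?H (?F i) = ?F i *\<^sub>R ?H 1"
    using has_derivative_linear[OF H] by (metis linear_cmul mult.right_neutral real_scaleR_def)
  ultimately show ?thesis using partial_eq[of "\<lambda>x. h (f x)" "\<lambda>v. ?H (?F v)" x i]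
    by (simp add: partial_def mult.commute)
qed

lemma C_k_add: "C_k k f \<Longrightarrow> C_k k g \<Longrightarrow> C_k k (\<lambda>x. f x + g x)"
proof (induction k arbitrary: f g)
  case 0 then show ?case by (auto intro: continuous_intros)
next
  case (Suc k)
  then have "partial i (\<lambda>x. f x + g x) = (\<lambda>x. partial i f x + partial i g x)" for i
    by (intro ext partial_add) auto
  with Suc show ?case by auto
qed

lemma C_k_mult: "C_k k f \<Longrightarrow> C_k k g \<Longrightarrow> C_k k (\<lambda>x. f x * g x)"
proof (induction k arbitrary: f g)
  case 0 then show ?case by (auto intro: continuous_intros)
next
  case (Suc k)
  then have "partial i (\<lambda>x. f x * g x) = (\<lambda>x. f x * partial i g x + partial i f x * g x)" for i
    by (intro ext partial_mult) auto
  with Suc C_k_SucD[of k f] C_k_SucD[of k g] show ?case by (auto intro!: C_k_add)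
qed

lemma C_k_compose:
  fixes h :: "real \<Rightarrow> real"
  shows "C_k k h \<Longrightarrow> C_k k f \<Longrightarrow> C_k k (\<lambda>x. h (f x))"
proof (induction k arbitrary: h f)
  case 0 then show ?case by (auto intro: continuous_on_compose2)
next
  case (Suc k)
  then have "partial i (\<lambda>x. h (f x)) = (\<lambda>x. partial 1 h (f x) * partial i f x)" for i
    by (intro ext partial_compose) auto
  with Suc C_k_SucD[of k f] show ?case
    by (auto intro!: C_k_mult differentiable_compose[of h f])
qed

lemma smooth_const [simp]: "smooth (\<lambda>x. c)"
  and smooth_linear: "bounded_linear L \<Longrightarrow> smooth L"
  and smooth_add: "smooth f \<Longrightarrow> smooth g \<Longrightarrow> smooth (\<lambda>x. f x + g x)"
  and smooth_mult: "smooth f \<Longrightarrow> smooth g \<Longrightarrow> smooth (\<lambda>x. f x * g x)"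
  and smooth_compose: "smooth h \<Longrightarrow> smooth f \<Longrightarrow> smooth (\<lambda>x. h (f x))"
  by (auto simp: smooth_def C_k_linear C_k_add C_k_mult C_k_compose)

lemma smooth_partial: "smooth f \<Longrightarrow> i \<in> Basis \<Longrightarrow> smooth (partial i f)"
  unfolding smooth_def by (metis C_k.simps(2))

lemma smooth_differentiable: "smooth f \<Longrightarrow> f differentiable (at x)"
  unfolding smooth_def by (metis C_k.simps(2))

lemma smooth_continuous: "smooth f \<Longrightarrow> continuous_on S f"
  unfolding smooth_def by (metis C_k.simps(1) continuous_on_subset subset_UNIV)

lemma smooth_diff:
  assumes "smooth f" "smooth g" shows "smooth (\<lambda>x. f x - g x)"
  using smooth_add[OF assms(1) smooth_mult[OF smooth_const[of "-1"] assms(2)]] by simp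

lemma smooth_sum: "finite I \<Longrightarrow> (\<And>k. k \<in> I \<Longrightarrow> smooth (f k)) \<Longrightarrow> smooth (\<lambda>x. \<Sum>k\<in>I. f k x)"
  by (induction I rule: finite_induct) (auto intro: smooth_add)

lemma smooth_power: "smooth f \<Longrightarrow> smooth (\<lambda>x. f x ^ n)"
  by (induction n) (auto intro: smooth_mult)

lemma smooth_has_real_derivative:
  "smooth (h::real \<Rightarrow> real) \<Longrightarrow> (h has_real_derivative partial 1 h x) (at x)"
proof -
  assume "smooth h"
  then have H: "(h has_derivative frechet_derivative h (at x)) (at x)"
    using smooth_differentiable frechet_derivative_works by blast
  have "frechet_derivative h (at x) v = partial 1 h x * v" for v
    using linear_cmul[OF has_derivative_linear[OF H], of v 1]
    by (simp add: partial_def mult.commute)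
  then have "frechet_derivative h (at x) = (*) (partial 1 h x)" by (rule ext)
  then show ?thesis using H by (simp add: has_field_derivative_def)
qed

lemma partial_real_eq: "(h has_real_derivative d) (at x) \<Longrightarrow> partial 1 h x = d"
  unfolding has_field_derivative_def by (drule partial_eq[where i = 1]) simp

text \<open>\<open>frechet_derivative\<close> is a choice among the derivatives at the point, and
  the set chosen from depends only on the germ; so germs determine \<open>partial\<close> even where
  no derivative exists.\<close>

lemma partial_transform:
  assumes "open S" "x \<in> S" "\<And>y. y \<in> S \<Longrightarrow> f y = g y"
  shows "partial i f x = partial i g x"
proof -
  have "(f has_derivative f') (at x) \<longleftrightarrow> (g has_derivative f') (at x)" for f'
    using assms has_derivative_transform_within_open by metis
  then show ?thesis by (simp add: partial_def frechet_derivative_def)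
qed

lemma partial_zero_open:
  assumes "open S" "x \<in> S" "\<And>y. y \<in> S \<Longrightarrow> f y = 0"
  shows "partial i f x = 0"
  using partial_transform[OF assms(1,2), of f "\<lambda>_. 0"] assms(3)
  by (simp add: partial_eq[OF has_derivative_const])

lemma partial_const [simp]: "partial i (\<lambda>x. c) x = 0"
  by (rule partial_eq[OF has_derivative_const])

lemma partial_sum:
  "finite I \<Longrightarrow> (\<And>k. k \<in> I \<Longrightarrow> smooth (f k)) \<Longrightarrow>
    partial i (\<lambda>x. \<Sum>k\<in>I. f k x) x = (\<Sum>k\<in>I. partial i (f k) x)"
  by (induction I rule: finite_induct)
     (auto simp: partial_add smooth_differentiable smooth_sum)

text \<open>The powers of \<open>1 / x\<close> make this family closed under differentiation.\<close>

definition flat :: "nat \<Rightarrow> real \<Rightarrow> real" where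
  "flat n x = (if x > 0 then (1 / x) ^ n * exp (- (1 / x)) else 0)"

text \<open>A single term of the exponential series bounds \<open>y ^ (n + 2)\<close> by
  \<open>fact (n + 2) * exp y\<close> for y = 1/x. The two spare powers leave a quadratic bound,
  which makes the difference quotient at 0 vanish in the limit.\<close>

lemma flat_le: "flat n x \<le> fact (n + 2) * x\<^sup>2"
proof (cases "x > 0")
  case True
  define y where "y = 1 / x"
  have y: "y > 0" "x = 1 / y" using True by (auto simp: y_def)
  have "(\<Sum>k\<in>{n+2}. y ^ k /\<^sub>R fact k) \<le> (\<Sum>k. y ^ k /\<^sub>R fact k)"
    using y by (intro sum_le_suminf summable_exp_generic) auto
  then have "y ^ (n + 2) \<le> fact (n + 2) * exp y"
  proof -
    assume "(\<Sum>k\<in>{n+2}. y ^ k /\<^sub>R fact k) \<le> (\<Sum>k. y ^ k /\<^sub>R fact k)"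
    then have "y ^ (n + 2) / fact (n + 2) \<le> exp y"
      by (simp add: exp_def divide_inverse mult.commute del: fact_Suc)
    then show ?thesis by (simp add: pos_divide_le_eq mult.commute del: fact_Suc)
  qed
  then have "y ^ (n + 2) * exp (- y) \<le> fact (n + 2)"
    by (simp add: exp_minus divide_inverse[symmetric] pos_divide_le_eq del: fact_Suc)
  then have "y ^ (n + 2) * exp (- y) * x\<^sup>2 \<le> fact (n + 2) * x\<^sup>2"
    by (intro mult_right_mono) auto
  moreover have "y ^ (n + 2) * exp (- y) * x\<^sup>2 = flat n x"
    using True y by (simp add: flat_def power_add power2_eq_square)
  ultimately show ?thesis by simp
qed (auto simp: flat_def)

lemma flat_derivative:
  "(flat n has_real_derivative (- real n * flat (n + 1) x + flat (n + 2) x)) (at x)"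
proof -
  consider "x > 0" | "x < 0" | "x = 0" by linarith
  then show ?thesis
  proof cases
    case 1
    have "((\<lambda>x. (1 / x) ^ n * exp (- (1 / x))) has_real_derivative
        (- real n * flat (n + 1) x + flat (n + 2) x)) (at x)"
    proof -
      have inv: "((\<lambda>x. 1 / x) has_real_derivative (- (1 / x)\<^sup>2)) (at x)"
        using 1 by (auto intro!: derivative_eq_intros simp: power2_eq_square)
      have "((\<lambda>x. (1 / x) ^ n * exp (- (1 / x))) has_real_derivative
          (real n * (- (1 / x)\<^sup>2 * (1 / x) ^ (n - 1))) * exp (- (1 / x))
          + exp (- (1 / x)) * (- (- (1 / x)\<^sup>2)) * (1 / x) ^ n) (at x)"
        using DERIV_mult[OF DERIV_power[OF inv, of n] DERIV_chain2[OF DERIV_exp DERIV_minus[OF inv]]]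
        by simp
      moreover have "(real n * (- c\<^sup>2 * c ^ (n - 1))) * e + e * (- (- c\<^sup>2)) * c ^ n
          = - real n * (c ^ (n + 1) * e) + c ^ (n + 2) * e" for c e :: real
        by (cases n) (simp_all add: power2_eq_square algebra_simps)
      ultimately show ?thesis using 1 by (simp only: flat_def if_True)
    qed
    then show ?thesis
      by (rule has_field_derivative_transform_within_open[where S = "{0<..}"])
         (use 1 in \<open>auto simp: flat_def\<close>)
  next
    case 2
    have "(flat n has_real_derivative 0) (at x)"
      by (rule has_field_derivative_transform_within_open[where S = "{..<0}" and f = "\<lambda>_. 0"])
         (use 2 in \<open>auto simp: flat_def\<close>)
    then show ?thesis using 2 by (simp add: flat_def)
  next
    case 3
    have "((\<lambda>h. (flat n h - flat n 0) / h) \<longlongrightarrow> 0) (at 0)"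
    proof (rule Lim_null_comparison)
      show "\<forall>\<^sub>F h in at 0. norm ((flat n h - flat n 0) / h) \<le> fact (n + 2) * \<bar>h\<bar>"
      proof (rule always_eventually, rule allI)
        fix h
        have "0 \<le> flat n h" by (auto simp: flat_def)
        then show "norm ((flat n h - flat n 0) / h) \<le> fact (n + 2) * \<bar>h\<bar>"
          using flat_le[of n h]
          by (cases "h = 0")
             (auto simp: flat_def power2_eq_square pos_divide_le_eq abs_mult mult.assoc simp del:
                 fact_Suc)
      qed
      show "((\<lambda>h. fact (n + 2) * \<bar>h\<bar>) \<longlongrightarrow> 0) (at (0::real))"
        by (auto intro!: tendsto_eq_intros)
    qed
    then show ?thesis using 3 by (simp add: DERIV_def flat_def)
  qed
qed

lemma smooth_flat: "smooth (flat n)"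
proof -
  have "C_k k (flat n)" for k
  proof (induction k arbitrary: n)
    case 0
    show ?case
      using DERIV_isCont[OF flat_derivative] by (simp add: continuous_on_eq_continuous_at)
  next
    case (Suc k)
    have "partial 1 (flat n) = (\<lambda>x. - real n * flat (n + 1) x + flat (n + 2) x)"
      by (intro ext partial_real_eq flat_derivative)
    moreover have "flat n differentiable (at x)" for x
      using flat_derivative by (metis differentiable_def has_field_derivative_def)
    moreover have "C_k k (\<lambda>x. - real n * flat (n + 1) x + flat (n + 2) x)"
      by (intro C_k_add C_k_mult C_k_const Suc.IH)
    ultimately show ?case by simp
  qed
  then show ?thesis by (simp add: smooth_def)
qed

text \<open>For x \<le> 0 the inner value \<open>flat 0 (1 - x)\<close> is at least
  \<open>exp (- 1)\<close>, so the outer argument is nonpositive; for x \<ge> 1 the inner value is 0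
  and the last factor normalises \<open>exp (- exp 1)\<close> to 1. Nesting two flat functions, in
  place of the usual quotient, relies on sums, products and compositions alone.\<close>

definition step :: "real \<Rightarrow> real" where
  "step x = flat 0 (exp (- 1) - flat 0 (1 - x)) * exp (exp 1)"

lemma smooth_step: "smooth step"
  unfolding step_def
  by (intro smooth_mult smooth_compose[OF smooth_flat] smooth_diff smooth_const)
     (auto intro: smooth_linear)

lemma step_0: "x \<le> 0 \<Longrightarrow> step x = 0"
proof -
  assume x: "x \<le> 0"
  then have "1 / (1 - x) \<le> 1" by (simp add: field_simps)
  with x show ?thesis by (simp add: step_def flat_def)
qed

lemma step_1: "x \<ge> 1 \<Longrightarrow> step x = 1"
  by (simp add: step_def flat_def field_simps flip: exp_add)

lemma step_nonneg: "0 \<le> step x"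
  by (simp add: step_def flat_def)

lemma step_le_1: "step x \<le> 1"
proof -
  have *: "flat 0 y \<le> exp (- exp 1)" if y: "y \<le> exp (- 1)" for y
  proof (cases "y > 0")
    case True
    then have "exp 1 \<le> 1 / y" using y by (simp add: exp_minus field_simps)
    then show ?thesis using True by (simp add: flat_def)
  qed (simp add: flat_def)
  have "flat 0 (exp (- 1) - flat 0 (1 - x)) \<le> exp (- exp 1)"
    by (rule *) (simp add: flat_def)
  then show ?thesis unfolding step_def by (simp add: exp_minus field_simps)
qed

text \<open>The power \<open>z powr a\<close>, switched on between z = 1/2 and z = 1. It is smooth
  on the whole line, and the truncation is not seen where the Lorentz form exceeds 1.\<close>

definition spow :: "real \<Rightarrow> real \<Rightarrow> real" where
  "spow a z = step (2 * z - 1) * z powr a"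

lemma spow_eq: "z \<ge> 1 \<Longrightarrow> spow a z = z powr a"
  by (simp add: spow_def step_1)

lemma spow_0: "z \<le> 1 / 2 \<Longrightarrow> spow a z = 0"
  by (simp add: spow_def step_0)

lemma spow_nonneg: "0 \<le> spow a z"
  by (simp add: spow_def step_nonneg)

text \<open>Products \<open>\<tau> z * z powr a\<close> with \<tau> vanishing for z \<le> 1/2 are
  closed under differentiation: the derivative is a sum of two of them, with factors
  \<open>partial 1 \<tau>\<close> and \<open>a * \<tau>\<close>. Hence the induction runs over all
  \<tau> and a at once.\<close>

lemma smooth_cutoff_powr:
  assumes "smooth \<tau>" "\<And>z. z \<le> 1 / 2 \<Longrightarrow> \<tau> z = 0"
  shows "smooth (\<lambda>z::real. \<tau> z * z powr a)"
proof -
  have d: "((\<lambda>z. \<tau> z * z powr a) has_real_derivative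
      (partial 1 \<tau> x * x powr a + a * \<tau> x * x powr (a - 1))) (at x)"
    if "smooth \<tau>" "\<And>z. z \<le> 1 / 2 \<Longrightarrow> \<tau> z = 0" for \<tau> a x
  proof (cases "x > 0")
    case True
    have "((\<lambda>z. z powr a) has_real_derivative (a * x powr (a - 1))) (at x)"
      using True by (rule has_real_derivative_powr)
    from DERIV_mult[OF smooth_has_real_derivative[OF that(1), of x] this]
    show ?thesis by (simp add: algebra_simps)
  next
    case False
    have "partial 1 \<tau> x = 0"
      by (rule partial_zero_open[of "{..<1/2}"]) (use False that in auto)
    moreover have "((\<lambda>z. \<tau> z * z powr a) has_real_derivative 0) (at x)"
      by (rule has_field_derivative_transform_within_open[where S = "{..<1/2}" and f = "\<lambda>_. 0"])
         (use False that in auto)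
    moreover have "\<tau> x = 0" using False that by simp
    ultimately show ?thesis by simp
  qed
  have "C_k k (\<lambda>z. \<tau> z * z powr a)" for k
    using assms
  proof (induction k arbitrary: \<tau> a)
    case 0
    have "isCont (\<lambda>z. \<tau> z * z powr a) x" for x
      by (rule DERIV_isCont[OF d]) (use 0 in auto)
    then show ?case by (simp add: continuous_on_eq_continuous_at)
  next
    case (Suc k)
    have eq: "partial 1 (\<lambda>z. \<tau> z * z powr a)
        = (\<lambda>x. partial 1 \<tau> x * x powr a + (a * \<tau> x) * x powr (a - 1))"
      by (rule ext, rule partial_real_eq) (use d[OF Suc.prems] in simp)
    have diff: "(\<lambda>z. \<tau> z * z powr a) differentiable (at x)" for x
      using d[OF Suc.prems, of a x] by (metis differentiable_def has_field_derivative_def)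
    have p0: "partial 1 \<tau> z = 0" if "z < 1 / 2" for z
      by (rule partial_zero_open[of "{..<1/2}"]) (use that Suc.prems in auto)
    have sp: "smooth (partial 1 \<tau>)" using Suc.prems by (auto intro: smooth_partial)
    \<comment> \<open>At the end point \<tau> is known to vanish on one side only, so locality does
      not apply; the derivative there is a left limit of zeros.\<close>
    have "partial 1 \<tau> (1/2) = 0"
    proof (rule tendsto_unique[of "at_left (1/2)"])
      show "(partial 1 \<tau> \<longlongrightarrow> partial 1 \<tau> (1 / 2)) (at_left (1/2))"
        using smooth_continuous[OF sp, of UNIV]
        by (auto simp: continuous_on_eq_continuous_at isCont_def intro: tendsto_mono[OF at_le])
      show "(partial 1 \<tau> \<longlongrightarrow> 0) (at_left (1/2))"
        by (rule tendsto_eventually) (auto simp: eventually_at_left_field intro!: exI[of _ 0] p0)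
    qed auto
    then have p0': "partial 1 \<tau> z = 0" if "z \<le> 1 / 2" for z
      using p0 that by (metis order_le_less)
    show ?case
      using diff Suc.prems by (auto simp: eq intro!: C_k_add Suc.IH sp p0' smooth_mult)
  qed
  then show ?thesis by (simp add: smooth_def)
qed

lemma smooth_spow: "smooth (spow a)"
  unfolding spow_def
proof (rule smooth_cutoff_powr)
  show "smooth (\<lambda>z. step (2 * z - 1))"
    by (intro smooth_compose[OF smooth_step] smooth_diff smooth_const smooth_linear
        bounded_linear_mult_right)
qed (simp add: step_0)

lemma partial_spow: "z > 1 \<Longrightarrow> partial 1 (spow a) z = a * z powr (a - 1)"
  using partial_transform[of "{1<..}" z "spow a" "\<lambda>z. z powr a" 1]
    partial_real_eq[OF has_real_derivative_powr[of z a]]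
  by (auto simp: spow_eq)

lemma partial_partial_spow:
  "z > 1 \<Longrightarrow> partial 1 (partial 1 (spow a)) z = a * (a - 1) * z powr (a - 2)"
proof -
  assume z: "z > 1"
  have "partial 1 (partial 1 (spow a)) z = partial 1 (\<lambda>z. a * z powr (a - 1)) z"
    using z by (intro partial_transform[of "{1<..}"]) (auto simp: partial_spow)
  also have "\<dots> = a * ((a - 1) * z powr (a - 1 - 1))"
    using z DERIV_cmult[OF has_real_derivative_powr[of z "a - 1"], of a]
    by (intro partial_real_eq) auto
  finally show ?thesis by simp
qed

section \<open>Pairings of square integrable functions with test functions\<close>

lemma smooth_snd_compose: "smooth h \<Longrightarrow> smooth (\<lambda>z::'a::euclidean_space \<times> real. h (snd z))"
  by (rule smooth_compose) (auto intro: smooth_linear bounded_linear_snd)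

lemma partial_fst:
  fixes \<Theta> :: "'a::euclidean_space \<times> real \<Rightarrow> real"
  assumes "\<Theta> differentiable (at (x, t))"
  shows "partial i (\<lambda>x. \<Theta> (x, t)) x = partial (i, 0) \<Theta> (x, t)"
proof -
  have "((\<lambda>x. (x, t)) has_derivative (\<lambda>h. (h, 0))) (at x)"
    by (auto intro!: derivative_eq_intros)
  from has_derivative_compose[OF this, of \<Theta>] assms
  show ?thesis
    by (subst partial_eq) (auto simp: partial_def frechet_derivative_works)
qed

lemma has_real_derivative_snd:
  fixes \<Theta> :: "'a::euclidean_space \<times> real \<Rightarrow> real"
  assumes "smooth \<Theta>"
  shows "((\<lambda>t. \<Theta> (x, t)) has_real_derivative partial (0, 1) \<Theta> (x, t)) (at t)"
proof -
  let ?D = "frechet_derivative \<Theta> (at (x, t))"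
  have D: "(\<Theta> has_derivative ?D) (at (x, t))"
    using smooth_differentiable[OF assms] frechet_derivative_works by blast
  have "((\<lambda>t. (x, t)) has_derivative (\<lambda>h. (0, h))) (at t)"
    by (auto intro!: derivative_eq_intros)
  from has_derivative_compose[OF this D]
  have "((\<lambda>t. \<Theta> (x, t)) has_derivative (\<lambda>h. ?D (0, h))) (at t)" .
  moreover have "?D (0, h) = partial (0, 1) \<Theta> (x, t) * h" for h
    using linear_cmul[OF has_derivative_linear[OF D], of h "(0, 1)"]
    by (simp add: partial_def mult.commute)
  ultimately show ?thesis by (simp add: has_field_derivative_def cong: if_cong)
qed

lemma smooth_slice:
  fixes \<Theta> :: "'a::euclidean_space \<times> real \<Rightarrow> real"
  assumes "smooth \<Theta>" shows "smooth (\<lambda>x. \<Theta> (x, t))"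
proof -
  have "C_k k (\<lambda>x. \<Theta> (x, t))" for k
    using assms
  proof (induction k arbitrary: \<Theta>)
    case 0
    then show ?case using smooth_continuous[of \<Theta> UNIV]
      by (auto intro!: continuous_on_compose2[of UNIV \<Theta>] continuous_intros)
  next
    case (Suc k)
    have d: "(\<lambda>x. \<Theta> (x, t)) differentiable (at x)" for x
      by (rule differentiable_compose[of \<Theta>])
         (auto intro: smooth_differentiable Suc.prems differentiable_Pair)
    have "partial i (\<lambda>x. \<Theta> (x, t)) = (\<lambda>x. partial (i, 0) \<Theta> (x, t))" for i
      by (intro ext partial_fst smooth_differentiable Suc.prems)
    moreover have "C_k k (\<lambda>x. partial (i, 0) \<Theta> (x, t))" if "i \<in> Basis" for i
      by (intro Suc.IH smooth_partial Suc.prems) (use that in \<open>auto simp: Basis_prod_def\<close>)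
    ultimately show ?case using d by simp
  qed
  then show ?thesis by (simp add: smooth_def)
qed

text \<open>Two-sided in time because test functions are smooth on the whole space-time. The
  cylinder is closed, so every derivative inherits the same radii.\<close>

definition cyl_supp :: "real \<Rightarrow> real \<Rightarrow> ('a::euclidean_space \<times> real \<Rightarrow> real) \<Rightarrow> bool" where
  "cyl_supp R \<rho> \<Theta> \<longleftrightarrow> (\<forall>x t. \<Theta> (x, t) \<noteq> 0 \<longrightarrow> \<bar>t\<bar> \<le> R \<and> norm x \<le> \<rho>)"

lemma cyl_suppD: "cyl_supp R \<rho> \<Theta> \<Longrightarrow> \<Theta> (x, t) \<noteq> 0 \<Longrightarrow> \<bar>t\<bar> \<le> R \<and> norm x \<le> \<rho>"
  unfolding cyl_supp_def by blast

lemma cyl_supp_partial: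
  fixes \<Theta> :: "'a::euclidean_space \<times> real \<Rightarrow> real"
  assumes "cyl_supp R \<rho> \<Theta>"
  shows "cyl_supp R \<rho> (partial i \<Theta>)"
  unfolding cyl_supp_def
proof (intro allI impI, rule ccontr)
  fix x t
  assume *: "partial i \<Theta> (x, t) \<noteq> 0" "\<not> (\<bar>t\<bar> \<le> R \<and> norm x \<le> \<rho>)"
  have "closed (cball 0 \<rho> \<times> {- R..R} :: ('a \<times> real) set)" by (intro closed_Times) auto
  then have "partial i \<Theta> (x, t) = 0"
  proof (intro partial_zero_open[of "- (cball 0 \<rho> \<times> {- R..R})"])
    fix z :: "'a \<times> real" assume "z \<in> - (cball 0 \<rho> \<times> {- R..R})"
    then show "\<Theta> z = 0" using cyl_suppD[OF assms, of "fst z" "snd z"]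
      by (cases "\<Theta> z = 0") (auto simp: abs_le_iff mem_Times_iff)
  qed (use * in \<open>auto simp: open_Compl abs_le_iff\<close>)
  with * show False by simp
qed

section \<open>Square integrable functions and the Cauchy-Schwarz inequality\<close>

lemma L2_real_iff: "L2 (f :: 'a::euclidean_space \<Rightarrow> real) \<longleftrightarrow>
    f \<in> borel_measurable lebesgue \<and> integrable lebesgue (\<lambda>x. (f x)\<^sup>2)"
  by (simp add: L2_def)

lemma L2_mult_integrable:
  fixes f g :: "'a::euclidean_space \<Rightarrow> real"
  assumes "L2 f" "L2 g" shows "integrable lebesgue (\<lambda>x. f x * g x)"
proof (rule Bochner_Integration.integrable_bound)
  show "integrable lebesgue (\<lambda>x. (f x)\<^sup>2 + (g x)\<^sup>2)"
    using assms by (auto simp: L2_real_iff)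
  show "AE x in lebesgue. norm (f x * g x) \<le> norm ((f x)\<^sup>2 + (g x)\<^sup>2)"
  proof (rule AE_I2)
    fix x
    have "0 \<le> (\<bar>f x\<bar> - \<bar>g x\<bar>)\<^sup>2 + (f x)\<^sup>2 + (g x)\<^sup>2" by simp
    then have "2 * (\<bar>f x\<bar> * \<bar>g x\<bar>) \<le> 2 * ((f x)\<^sup>2 + (g x)\<^sup>2)"
      by (simp add: power2_diff)
    then show "norm (f x * g x) \<le> norm ((f x)\<^sup>2 + (g x)\<^sup>2)"
      by (simp add: abs_mult)
  qed
qed (use assms in \<open>auto simp: L2_real_iff\<close>)

lemma L2_cmult: "L2 f \<Longrightarrow> L2 (\<lambda>x. c * f x :: real)"
  by (auto simp: L2_real_iff power_mult_distrib)

lemma L2_divide: "L2 f \<Longrightarrow> L2 (\<lambda>x. f x / c :: real)"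
  using L2_cmult[of f "inverse c"] by (simp add: divide_inverse mult.commute)

lemma L2_add:
  fixes f g :: "'a::euclidean_space \<Rightarrow> real"
  assumes "L2 f" "L2 g" shows "L2 (\<lambda>x. f x + g x)"
proof -
  have "integrable lebesgue (\<lambda>x. (f x)\<^sup>2 + (g x)\<^sup>2 + 2 * (f x * g x))"
    using assms L2_mult_integrable[OF assms] by (auto simp: L2_real_iff)
  then show ?thesis using assms by (auto simp: L2_real_iff power2_sum mult.assoc)
qed

lemma L2_diff:
  fixes f g :: "'a::euclidean_space \<Rightarrow> real"
  assumes "L2 f" "L2 g" shows "L2 (\<lambda>x. f x - g x)"
  using L2_add[OF assms(1) L2_cmult[OF assms(2), of "-1"]] by simp

lemma L2_inner:
  fixes F :: "'a::euclidean_space \<Rightarrow> 'a"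
  assumes "L2 F" "i \<in> Basis" shows "L2 (\<lambda>x. F x \<bullet> i)"
proof -
  have m: "(\<lambda>x. F x \<bullet> i) \<in> borel_measurable lebesgue" using assms by (auto simp: L2_def)
  have "integrable lebesgue (\<lambda>x. (F x \<bullet> i)\<^sup>2)"
  proof (rule Bochner_Integration.integrable_bound)
    show "integrable lebesgue (\<lambda>x. (norm (F x))\<^sup>2)" using assms by (auto simp: L2_def)
    show "AE x in lebesgue. norm ((F x \<bullet> i)\<^sup>2) \<le> norm ((norm (F x))\<^sup>2)"
      using Basis_le_norm[OF assms(2)] by (auto intro!: AE_I2 simp: abs_le_square_iff[symmetric])
  qed (use m in auto)
  with m show ?thesis by (simp add: L2_real_iff)
qed

lemma L2_norm_nonneg: "0 \<le> L2_norm f"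
  by (simp add: L2_norm_def)

text \<open>The integral of (f + s g)^2 is a quadratic polynomial in s without negative values, so
  its discriminant is nonpositive.\<close>

lemma L2_Cauchy_Schwarz:
  fixes f g :: "'a::euclidean_space \<Rightarrow> real"
  assumes "L2 f" "L2 g"
  shows "\<bar>\<integral>x. f x * g x \<partial>lebesgue\<bar> \<le> L2_norm f * L2_norm g"
proof -
  let ?a = "\<integral>x. (f x)\<^sup>2 \<partial>lebesgue" and ?b = "\<integral>x. f x * g x \<partial>lebesgue"
    and ?c = "\<integral>x. (g x)\<^sup>2 \<partial>lebesgue"
  have i: "integrable lebesgue (\<lambda>x. (f x)\<^sup>2)" "integrable lebesgue (\<lambda>x. (g x)\<^sup>2)"
    "integrable lebesgue (\<lambda>x. f x * g x)"
    using assms L2_mult_integrable by (auto simp: L2_real_iff)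
  have quad: "0 \<le> ?a + 2 * s * ?b + s\<^sup>2 * ?c" for s
  proof -
    have "0 \<le> (\<integral>x. (f x + s * g x)\<^sup>2 \<partial>lebesgue)" by simp
    also have "\<dots> = (\<integral>x. (f x)\<^sup>2 + 2 * s * (f x * g x) + s\<^sup>2 * (g x)\<^sup>2 \<partial>lebesgue)"
      by (intro Bochner_Integration.integral_cong)
         (auto simp: power2_sum power_mult_distrib algebra_simps)
    also have "\<dots> = ?a + 2 * s * ?b + s\<^sup>2 * ?c" using i by simp
    finally show ?thesis .
  qed
  have ac: "0 \<le> ?a" "0 \<le> ?c" by simp_all
  have "?b\<^sup>2 \<le> ?a * ?c"
  proof (cases "?c = 0")
    case True
    have "?b = 0"
    proof (rule ccontr)
      assume b: "?b \<noteq> 0"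
      \<comment> \<open>With \<open>?c = 0\<close> the quadratic is affine in s, and this s gives it
        the value -1.\<close>
      have "?a + 2 * (- (?a + 1) / (2 * ?b)) * ?b = - 1" using b by (simp add: field_simps)
      then show False using quad[of "- (?a + 1) / (2 * ?b)"] True by simp
    qed
    then show ?thesis using True by simp
  next
    case False
    then have c: "?c > 0" using ac(2) by (metis order_le_less)
    have "?a + 2 * (- ?b / ?c) * ?b + (- ?b / ?c)\<^sup>2 * ?c = ?a - ?b\<^sup>2 / ?c"
      using c by (simp add: field_simps power2_eq_square)
    then have "?b\<^sup>2 / ?c \<le> ?a" using quad[of "- ?b / ?c"] by simp
    then show ?thesis using c by (simp add: pos_divide_le_eq)
  qed
  then have "sqrt (?b\<^sup>2) \<le> sqrt (?a * ?c)" by (rule real_sqrt_le_mono)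
  then show ?thesis by (simp add: L2_norm_def real_sqrt_mult)
qed

lemma bounded_support_integrable:
  fixes h :: "'a::euclidean_space \<Rightarrow> real"
  assumes "continuous_on UNIV h" "\<And>x. \<bar>h x\<bar> \<le> M" "\<And>x. h x \<noteq> 0 \<Longrightarrow> norm x \<le> \<rho>"
  shows "integrable lebesgue h"
proof (rule Bochner_Integration.integrable_bound)
  show "integrable lebesgue (\<lambda>x. M * indicator (cball (0::'a) \<rho>) x :: real)"
    by (intro integrable_mult_right integrable_real_indicator) (use
        emeasure_lborel_cball_finite[of "0::'a" \<rho>] in auto)
  have "h \<in> borel_measurable borel" using assms(1) by (rule borel_measurable_continuous_onI)
  then show "h \<in> borel_measurable lebesgue" by (simp add: measurable_completion)
  show "AE x in lebesgue. norm (h x) \<le> norm (M * indicator (cball (0::'a) \<rho>) x :: real)"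
    using assms(2,3) by (fastforce intro!: AE_I2 simp: indicator_def intro: order_trans[OF _
        abs_ge_self])
qed

lemma L2_bounded_support:
  fixes h :: "'a::euclidean_space \<Rightarrow> real"
  assumes "continuous_on UNIV h" "\<And>x. \<bar>h x\<bar> \<le> M" "\<And>x. h x \<noteq> 0 \<Longrightarrow> norm x \<le> \<rho>"
  shows "L2 h" "L2_norm h \<le> M * sqrt (measure lebesgue (cball (0::'a) \<rho>))"
proof -
  have M: "0 \<le> M" using assms(2)[of undefined] by linarith
  have sq: "(h x)\<^sup>2 \<le> M\<^sup>2" for x using assms(2)[of x] M by (simp add: abs_le_square_iff[symmetric])
  have i: "integrable lebesgue (\<lambda>x. (h x)\<^sup>2)"
    by (rule bounded_support_integrable[where M = "M\<^sup>2" and \<rho> = \<rho>])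
       (use assms sq in \<open>auto intro: continuous_intros\<close>)
  have "h \<in> borel_measurable borel" using assms(1) by (rule borel_measurable_continuous_onI)
  then have "h \<in> borel_measurable lebesgue" by (simp add: measurable_completion)
  with i show "L2 h" by (simp add: L2_real_iff)
  have "(\<integral>x. (h x)\<^sup>2 \<partial>lebesgue) \<le> (\<integral>x. M\<^sup>2 * indicator (cball (0::'a) \<rho>) x \<partial>lebesgue)"
  proof (rule Bochner_Integration.integral_mono[OF i])
    show "integrable lebesgue (\<lambda>x. M\<^sup>2 * indicator (cball (0::'a) \<rho>) x :: real)"
      by (intro integrable_mult_right integrable_real_indicator) (use
          emeasure_lborel_cball_finite[of "0::'a" \<rho>] in auto)
    show "(h x)\<^sup>2 \<le> M\<^sup>2 * indicator (cball (0::'a) \<rho>) x" for x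
      using sq[of x] assms(3)[of x] by (auto simp: indicator_def)
  qed
  also have "\<dots> = M\<^sup>2 * measure lebesgue (cball (0::'a) \<rho>)" by simp
  finally have "L2_norm h \<le> sqrt (M\<^sup>2 * measure lebesgue (cball (0::'a) \<rho>))"
    by (simp add: L2_norm_def)
  also have "\<dots> = M * sqrt (measure lebesgue (cball (0::'a) \<rho>))"
    using M by (simp add: real_sqrt_mult)
  finally show "L2_norm h \<le> M * sqrt (measure lebesgue (cball (0::'a) \<rho>))" .
qed

text \<open>For functions living in one fixed ball the L2 norm is at most the supremum times the
  root of the volume, so uniform convergence suffices.\<close>

lemma L2_norm_tendsto_0:
  fixes h :: "real \<Rightarrow> 'a::euclidean_space \<Rightarrow> real"
  assumes "\<forall>\<^sub>F s in F. continuous_on UNIV (h s) \<and> (\<forall>x. h s x \<noteq> 0 \<longrightarrow> norm x \<le> \<rho>)"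
    and "\<And>e. e > 0 \<Longrightarrow> \<forall>\<^sub>F s in F. \<forall>x. \<bar>h s x\<bar> \<le> e"
  shows "((\<lambda>s. L2_norm (h s)) \<longlongrightarrow> 0) F"
proof (rule tendstoI)
  fix e :: real assume e: "e > 0"
  define V where "V = sqrt (measure lebesgue (cball (0::'a) \<rho>)) + 1"
  have V: "V > 0" by (simp add: V_def add_nonneg_pos)
  have "\<forall>\<^sub>F s in F. \<forall>x. \<bar>h s x\<bar> \<le> e / (2 * V)" using assms(2)[of "e / (2 * V)"] e V by simp
  with assms(1) show "\<forall>\<^sub>F s in F. dist (L2_norm (h s)) 0 < e"
  proof eventually_elim
    case (elim s)
    have "L2_norm (h s) \<le> e / (2 * V) * sqrt (measure lebesgue (cball (0::'a) \<rho>))"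
      by (rule L2_bounded_support(2)) (use elim in auto)
    also have "\<dots> \<le> e / (2 * V) * V" using e V by (intro mult_left_mono) (auto simp: V_def)
    also have "\<dots> < e" using e V by simp
    finally show ?case by (simp add: L2_norm_nonneg)
  qed
qed

section \<open>Continuity and differentiability in time of pairings\<close>

lemma slice_continuous:
  fixes \<Theta> :: "'a::euclidean_space \<times> real \<Rightarrow> real"
  assumes "continuous_on UNIV \<Theta>" shows "continuous_on UNIV (\<lambda>x. \<Theta> (x, t))"
  by (rule continuous_on_compose2[OF assms]) (auto intro: continuous_intros)

lemma compact_support_bounded:
  fixes \<Theta> :: "'a::euclidean_space \<times> real \<Rightarrow> real"
  assumes "continuous_on UNIV \<Theta>" "cyl_supp R \<rho> \<Theta>"
  obtains M where "\<And>z. \<bar>\<Theta> z\<bar> \<le> M"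
proof -
  have "compact (\<Theta> ` (cball 0 \<rho> \<times> {- R..R}))"
    by (intro compact_continuous_image compact_Times continuous_on_subset[OF assms(1)]) auto
  then have "bounded (\<Theta> ` (cball 0 \<rho> \<times> {- R..R}))" by (rule compact_imp_bounded)
  then obtain M where "\<forall>y \<in> \<Theta> ` (cball 0 \<rho> \<times> {- R..R}). norm y \<le> M"
    unfolding bounded_iff by blast
  then have M: "\<And>z. z \<in> cball 0 \<rho> \<times> {- R..R} \<Longrightarrow> \<bar>\<Theta> z\<bar> \<le> M"
    by (simp only: ball_simps real_norm_def)
  have "\<bar>\<Theta> z\<bar> \<le> max M 0" for z
    using M[of z] cyl_suppD[OF assms(2), of "fst z" "snd z"]
    by (cases "\<Theta> z = 0") (auto simp: abs_le_iff mem_Times_iff max_def)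
  then show thesis by (rule that)
qed

lemma compact_support_L2:
  fixes \<Theta> :: "'a::euclidean_space \<times> real \<Rightarrow> real"
  assumes "continuous_on UNIV \<Theta>" "cyl_supp R \<rho> \<Theta>"
  shows "L2 (\<lambda>x. \<Theta> (x, t))"
proof -
  obtain M where "\<And>z. \<bar>\<Theta> z\<bar> \<le> M" by (rule compact_support_bounded[OF assms]) auto
  then show ?thesis
    by (intro L2_bounded_support(1)[where M = M and \<rho> = \<rho>] slice_continuous[OF assms(1)])
       (use cyl_suppD[OF assms(2)] in auto)
qed

lemma compact_support_uniform:
  fixes \<Theta> :: "'a::euclidean_space \<times> real \<Rightarrow> real"
  assumes "continuous_on UNIV \<Theta>" "cyl_supp R \<rho> \<Theta>" "e > 0"
  obtains d where "d > 0" "\<And>x s t. \<bar>s - t\<bar> < d \<Longrightarrow> \<bar>\<Theta> (x, s) - \<Theta> (x, t)\<bar> \<le> e"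
proof -
  \<comment> \<open>The time interval is enlarged by 1: if one of the two times lies in the support,
    the other is closer than 1 to it and stays in the compact set.\<close>
  have "uniformly_continuous_on (cball 0 \<rho> \<times> {- R - 1..R + 1}) \<Theta>"
    by (intro compact_uniformly_continuous compact_Times continuous_on_subset[OF assms(1)]) auto
  then obtain d where d: "d > 0" "\<And>z z'. z \<in> cball 0 \<rho> \<times> {- R - 1..R + 1} \<Longrightarrow>
      z' \<in> cball 0 \<rho> \<times> {- R - 1..R + 1} \<Longrightarrow> dist z' z < d \<Longrightarrow> dist (\<Theta> z') (\<Theta> z) < e"
    unfolding uniformly_continuous_on_def using assms(3) by metis
  show thesis
  proof (rule that[of "min d 1"])
    fix x :: 'a and s t :: real assume st: "\<bar>s - t\<bar> < min d 1"
    show "\<bar>\<Theta> (x, s) - \<Theta> (x, t)\<bar> \<le> e"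
    proof (cases "\<Theta> (x, s) = 0 \<and> \<Theta> (x, t) = 0")
      case False
      then have "norm x \<le> \<rho>" "\<bar>s\<bar> \<le> R + 1" "\<bar>t\<bar> \<le> R + 1"
        using cyl_suppD[OF assms(2), of x s] cyl_suppD[OF assms(2), of x t] st
            by (auto simp: abs_if split: if_splits)
      then have "dist (\<Theta> (x, s)) (\<Theta> (x, t)) < e"
        using st by (intro d(2)) (auto simp: dist_Pair_Pair dist_real_def abs_le_iff)
      then show ?thesis by (simp add: dist_real_def)
    qed (use assms(3) in auto)
  qed (use d in auto)
qed

lemma L2_norm_slice_diff:
  fixes \<Theta> :: "'a::euclidean_space \<times> real \<Rightarrow> real"
  assumes "continuous_on UNIV \<Theta>" "cyl_supp R \<rho> \<Theta>"
  shows "((\<lambda>s. L2_norm (\<lambda>x. \<Theta> (x, s) - \<Theta> (x, t))) \<longlongrightarrow> 0) (at t within S)"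
proof (rule L2_norm_tendsto_0)
  show "\<forall>\<^sub>F s in at t within S. continuous_on UNIV (\<lambda>x. \<Theta> (x, s) - \<Theta> (x, t)) \<and>
      (\<forall>x. \<Theta> (x, s) - \<Theta> (x, t) \<noteq> 0 \<longrightarrow> norm x \<le> \<rho>)"
  proof (intro always_eventually allI conjI impI)
    fix s x
    show "continuous_on UNIV (\<lambda>x. \<Theta> (x, s) - \<Theta> (x, t))"
      by (intro continuous_on_diff slice_continuous assms(1))
    assume "\<Theta> (x, s) - \<Theta> (x, t) \<noteq> 0"
    then show "norm x \<le> \<rho>" using cyl_suppD[OF assms(2), of x s] cyl_suppD[OF assms(2), of x t]
      by (cases "\<Theta> (x, s) = 0") auto
  qed
  fix e :: real assume "e > 0"
  from compact_support_uniform[OF assms this] obtain d where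
    d: "d > 0" "\<And>x s t. \<bar>s - t\<bar> < d \<Longrightarrow> \<bar>\<Theta> (x, s) - \<Theta> (x, t)\<bar> \<le> e" by metis
  then show "\<forall>\<^sub>F s in at t within S. \<forall>x. \<bar>\<Theta> (x, s) - \<Theta> (x, t)\<bar> \<le> e"
    unfolding eventually_at by (intro exI[of _ d]) (auto simp: dist_real_def)
qed

text \<open>A limit of products, with y converging in L2 and \<Theta> uniformly. Membership of y in
  L2 is asked for eventually only, so that y may be a difference quotient, meaningful for s \<noteq>
  t.\<close>

lemma L2_pairing_tendsto:
  fixes \<Theta> :: "'a::euclidean_space \<times> real \<Rightarrow> real"
  assumes \<Theta>: "continuous_on UNIV \<Theta>" "cyl_supp R \<rho> \<Theta>"
    and y: "\<forall>\<^sub>F s in at t within S. L2 (y s)" "L2 w"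
      "((\<lambda>s. L2_norm (\<lambda>x. y s x - w x)) \<longlongrightarrow> 0) (at t within S)"
  shows "((\<lambda>s. \<integral>x. y s x * \<Theta> (x, s) \<partial>lebesgue) \<longlongrightarrow> (\<integral>x. w x * \<Theta> (x, t) \<partial>lebesgue)) (at t within S)"
proof -
  have L: "L2 (\<lambda>x. \<Theta> (x, s))" for s by (rule compact_support_L2[OF \<Theta>])
  note D = L2_norm_slice_diff[OF \<Theta>, of t S]
  have "((\<lambda>s. L2_norm (\<lambda>x. y s x - w x) * (L2_norm (\<lambda>x. \<Theta> (x, s) - \<Theta> (x, t)) + L2_norm (\<lambda>x. \<Theta> (x, t)))
      + L2_norm w * L2_norm (\<lambda>x. \<Theta> (x, s) - \<Theta> (x, t))) \<longlongrightarrow> 0) (at t within S)"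
    using tendsto_add[OF tendsto_mult[OF y(3) tendsto_add[OF D tendsto_const]] tendsto_mult[OF
        tendsto_const D]]
    by simp
  then have "((\<lambda>s. (\<integral>x. y s x * \<Theta> (x, s) \<partial>lebesgue) - (\<integral>x. w x * \<Theta> (x, t) \<partial>lebesgue))
      \<longlongrightarrow> 0) (at t within S)"
  proof (rule Lim_null_comparison[rotated])
    show "\<forall>\<^sub>F s in at t within S. norm ((\<integral>x. y s x * \<Theta> (x, s) \<partial>lebesgue) -
        (\<integral>x. w x * \<Theta> (x, t) \<partial>lebesgue))
        \<le> L2_norm (\<lambda>x. y s x - w x) * (L2_norm (\<lambda>x. \<Theta> (x, s) - \<Theta> (x, t)) + L2_norm (\<lambda>x. \<Theta> (x, t)))
          + L2_norm w * L2_norm (\<lambda>x. \<Theta> (x, s) - \<Theta> (x, t))"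
      using y(1)
    proof eventually_elim
      case (elim s)
      let ?y = "\<lambda>x. y s x - w x" and ?T = "\<lambda>x. \<Theta> (x, s) - \<Theta> (x, t)"
      have l: "L2 ?y" "L2 ?T" by (auto intro: L2_diff elim y(2) L)
      have "(\<integral>x. y s x * \<Theta> (x, s) \<partial>lebesgue) - (\<integral>x. w x * \<Theta> (x, t) \<partial>lebesgue)
          = (\<integral>x. y s x * \<Theta> (x, s) - w x * \<Theta> (x, t) \<partial>lebesgue)"
        by (intro Bochner_Integration.integral_diff[symmetric] L2_mult_integrable elim y(2) L)
      \<comment> \<open>Both factors are expanded around their limits, so that each of the three
        products contains a small factor and Cauchy-Schwarz applies.\<close>
      also have "\<dots> = (\<integral>x. ?y x * ?T x + ?y x * \<Theta> (x, t) + w x * ?T x \<partial>lebesgue)"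
        by (intro Bochner_Integration.integral_cong) (auto simp: algebra_simps)
      also have "\<dots> = (\<integral>x. ?y x * ?T x \<partial>lebesgue) + (\<integral>x. ?y x * \<Theta> (x, t) \<partial>lebesgue)
          + (\<integral>x. w x * ?T x \<partial>lebesgue)"
        using L2_mult_integrable[OF l] L2_mult_integrable[OF l(1) L[of t]] L2_mult_integrable[OF
            y(2) l(2)]
        by simp
      finally show ?case
        using L2_Cauchy_Schwarz[OF l] L2_Cauchy_Schwarz[OF l(1) L[of t]] L2_Cauchy_Schwarz[OF y(2) l(2)]
        by (simp add: distrib_left)
    qed
  qed
  then show ?thesis using LIM_zero_iff by blast
qed

lemma L2_pairing_continuous:
  fixes \<Theta> :: "'a::euclidean_space \<times> real \<Rightarrow> real"
  assumes \<Theta>: "continuous_on UNIV \<Theta>" "cyl_supp R \<rho> \<Theta>"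
    and y: "\<And>t. t \<in> S \<Longrightarrow> L2 (y t)"
      "\<And>t. t \<in> S \<Longrightarrow> ((\<lambda>s. L2_norm (\<lambda>x. y s x - y t x)) \<longlongrightarrow> 0) (at t within S)"
  shows "continuous_on S (\<lambda>t. \<integral>x. y t x * \<Theta> (x, t) \<partial>lebesgue)"
  unfolding continuous_on_def
  by (intro ballI L2_pairing_tendsto[OF \<Theta>])
     (auto simp: eventually_at_topological intro: y exI[of _ UNIV])

text \<open>By the mean value theorem the quotient is the time derivative at an intermediate time,
  and that derivative is uniformly continuous; hence d depends neither on x nor on t.\<close>

lemma difference_quotient_uniform:
  fixes \<Theta> :: "'a::euclidean_space \<times> real \<Rightarrow> real"
  assumes \<Theta>: "smooth \<Theta>" "cyl_supp R \<rho> \<Theta>" and "e > 0"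
  obtains d where "d > 0" "\<And>x s t. \<bar>s - t\<bar> < d \<Longrightarrow> s \<noteq> t \<Longrightarrow>
    \<bar>(\<Theta> (x, s) - \<Theta> (x, t)) / (s - t) - partial (0, 1) \<Theta> (x, t)\<bar> \<le> e"
proof -
  have "smooth (partial (0, 1) \<Theta>)" by (intro smooth_partial \<Theta>) (simp add: Basis_prod_def)
  from compact_support_uniform[OF smooth_continuous[OF this] cyl_supp_partial[OF \<Theta>(2)] \<open>e > 0\<close>]
  obtain d where d: "d > 0"
    "\<And>x s t. \<bar>s - t\<bar> < d \<Longrightarrow> \<bar>partial (0, 1) \<Theta> (x, s) - partial (0, 1) \<Theta> (x, t)\<bar> \<le> e" by metis
  show thesis
  proof (rule that[OF d(1)])
    fix x :: 'a and s t :: real assume st: "\<bar>s - t\<bar> < d" "s \<noteq> t"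
    have MVT: "\<exists>z. l < z \<and> z < u \<and> \<Theta> (x, u) - \<Theta> (x, l) = (u - l) * partial (0, 1) \<Theta> (x, z)"
      if "l < u" for l u
      using MVT2[OF that, of "\<lambda>t. \<Theta> (x, t)" "\<lambda>t. partial (0, 1) \<Theta> (x, t)"]
        has_real_derivative_snd[OF \<Theta>(1)] by blast
    have "\<exists>z. \<bar>z - t\<bar> < d \<and> (\<Theta> (x, s) - \<Theta> (x, t)) / (s - t) = partial (0, 1) \<Theta> (x, z)"
    proof (cases "s < t")
      case True
      then obtain z where "s < z" "z < t" "\<Theta> (x, t) - \<Theta> (x, s) = (t - s) * partial (0, 1) \<Theta> (x, z)"
        using MVT by blast
      then show ?thesis using st True by (intro exI[of _ z]) (auto simp: field_simps)
    next
      case False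
      then have "t < s" using st by simp
      then obtain z where "t < z" "z < s" "\<Theta> (x, s) - \<Theta> (x, t) = (s - t) * partial (0, 1) \<Theta> (x, z)"
        using MVT by blast
      then show ?thesis using st by (intro exI[of _ z]) (auto simp: field_simps)
    qed
    then show "\<bar>(\<Theta> (x, s) - \<Theta> (x, t)) / (s - t) - partial (0, 1) \<Theta> (x, t)\<bar> \<le> e"
      using d(2) by metis
  qed
qed

text \<open>Product rule: the difference quotient splits into the quotient of u paired with \<Theta>
  at time s, and u at time t paired with the quotient of \<Theta>. The L2-valued derivative of u
  thus becomes an ordinary one, open to the fundamental theorem of calculus.\<close>

lemma L2_pairing_derivative:
  fixes \<Theta> :: "'a::euclidean_space \<times> real \<Rightarrow> real"
  assumes \<Theta>: "smooth \<Theta>" "cyl_supp R \<rho> \<Theta>"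
    and u: "\<And>t. t \<in> S \<Longrightarrow> L2 (u t)" "L2 w"
      "((\<lambda>s. L2_norm (\<lambda>x. (u s x - u t x) / (s - t) - w x)) \<longlongrightarrow> 0) (at t within S)"
    and t: "t \<in> S"
  shows "((\<lambda>t. \<integral>x. u t x * \<Theta> (x, t) \<partial>lebesgue) has_real_derivative
    ((\<integral>x. w x * \<Theta> (x, t) \<partial>lebesgue) + (\<integral>x. u t x * partial (0, 1) \<Theta> (x, t) \<partial>lebesgue))) (at t within S)"
proof -
  note C = smooth_continuous[OF \<Theta>(1), of UNIV]
  have sp: "smooth (partial (0, 1) \<Theta>)" by (intro smooth_partial \<Theta>) (simp add: Basis_prod_def)
  note C' = smooth_continuous[OF sp, of UNIV] and S' = cyl_supp_partial[OF \<Theta>(2), where i = "(0,1)"]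
  have L: "L2 (\<lambda>x. \<Theta> (x, s))" for s by (rule compact_support_L2[OF C \<Theta>(2)])
  have L': "L2 (\<lambda>x. partial (0, 1) \<Theta> (x, t))" by (rule compact_support_L2[OF C' S'])
  have ev: "\<forall>\<^sub>F s in at t within S. s \<in> S \<and> s \<noteq> t"
    by (auto simp: eventually_at_topological intro: exI[of _ UNIV])
  have "((\<lambda>s. \<integral>x. ((u s x - u t x) / (s - t)) * \<Theta> (x, s) \<partial>lebesgue) \<longlongrightarrow>
      (\<integral>x. w x * \<Theta> (x, t) \<partial>lebesgue)) (at t within S)"
  proof (rule L2_pairing_tendsto[OF C \<Theta>(2) _ u(2,3)])
    show "\<forall>\<^sub>F s in at t within S. L2 (\<lambda>x. (u s x - u t x) / (s - t))"
      using ev by eventually_elim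
        (intro L2_divide L2_diff u t; simp)
  qed
  moreover have "((\<lambda>s. \<integral>x. u t x * ((\<Theta> (x, s) - \<Theta> (x, t)) / (s - t)) \<partial>lebesgue)
      \<longlongrightarrow> (\<integral>x. u t x * partial (0, 1) \<Theta> (x, t) \<partial>lebesgue)) (at t within S)"
  proof -
    let ?Q = "\<lambda>s x. (\<Theta> (x, s) - \<Theta> (x, t)) / (s - t) - partial (0, 1) \<Theta> (x, t)"
    have q: "continuous_on UNIV (?Q s)" "?Q s x \<noteq> 0 \<Longrightarrow> norm x \<le> \<rho>" if "s \<noteq> t" for s x
    proof -
      show "continuous_on UNIV (?Q s)"
        using that slice_continuous[OF C] slice_continuous[OF C']
        by (intro continuous_on_diff continuous_on_divide continuous_on_const) auto
      show "norm x \<le> \<rho>" if "?Q s x \<noteq> 0"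
        using that cyl_suppD[OF \<Theta>(2), of x s] cyl_suppD[OF \<Theta>(2), of x t] cyl_suppD[OF S', of x t]
        by (cases "\<Theta> (x, s) = 0"; cases "\<Theta> (x, t) = 0") auto
    qed
    have l: "L2 (?Q s)" if "s \<noteq> t" for s
      by (intro L2_diff L2_divide L L')
    have "((\<lambda>s. L2_norm (?Q s)) \<longlongrightarrow> 0) (at t within S)"
    proof (rule L2_norm_tendsto_0)
      show "\<forall>\<^sub>F s in at t within S. continuous_on UNIV (?Q s) \<and> (\<forall>x. ?Q s x \<noteq> 0 \<longrightarrow> norm x \<le> \<rho>)"
        using ev by eventually_elim (use q in blast)
      fix e :: real assume "e > 0"
      from difference_quotient_uniform[OF \<Theta> this] obtain d where d: "d > 0"
        "\<And>x s t. \<bar>s - t\<bar> < d \<Longrightarrow> s \<noteq> t \<Longrightarrow>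
          \<bar>(\<Theta> (x, s) - \<Theta> (x, t)) / (s - t) - partial (0, 1) \<Theta> (x, t)\<bar> \<le> e" by metis
      then show "\<forall>\<^sub>F s in at t within S. \<forall>x. \<bar>?Q s x\<bar> \<le> e"
        unfolding eventually_at by (intro exI[of _ d]) (auto simp: dist_real_def)
    qed
    from tendsto_mult[OF tendsto_const this]
    have "((\<lambda>s. L2_norm (u t) * L2_norm (?Q s)) \<longlongrightarrow> 0) (at t within S)" by simp
    then have "((\<lambda>s. (\<integral>x. u t x * ((\<Theta> (x, s) - \<Theta> (x, t)) / (s - t)) \<partial>lebesgue)
        - (\<integral>x. u t x * partial (0, 1) \<Theta> (x, t) \<partial>lebesgue)) \<longlongrightarrow> 0) (at t within S)"
    proof (rule Lim_null_comparison[rotated])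
      show "\<forall>\<^sub>F s in at t within S. norm ((\<integral>x. u t x * ((\<Theta> (x, s) - \<Theta> (x, t)) / (s - t)) \<partial>lebesgue)
        - (\<integral>x. u t x * partial (0, 1) \<Theta> (x, t) \<partial>lebesgue)) \<le> L2_norm (u t) * L2_norm (?Q s)"
        using ev
      proof eventually_elim
        case (elim s)
        have l2: "L2 (\<lambda>x. (\<Theta> (x, s) - \<Theta> (x, t)) / (s - t))"
          by (intro L2_diff L2_divide L)
        have "(\<integral>x. u t x * ((\<Theta> (x, s) - \<Theta> (x, t)) / (s - t)) \<partial>lebesgue)
          - (\<integral>x. u t x * partial (0, 1) \<Theta> (x, t) \<partial>lebesgue) = (\<integral>x. u t x * ?Q s x \<partial>lebesgue)"
          unfolding right_diff_distrib
          by (intro Bochner_Integration.integral_diff[symmetric] L2_mult_integrable[OF u(1)[OF t]] l2 L')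
        then show ?case using L2_Cauchy_Schwarz[OF u(1)[OF t] l] elim by simp
      qed
    qed
    then show ?thesis using LIM_zero_iff by blast
  qed
  ultimately have "((\<lambda>s. (\<integral>x. ((u s x - u t x) / (s - t)) * \<Theta> (x, s) \<partial>lebesgue)
      + (\<integral>x. u t x * ((\<Theta> (x, s) - \<Theta> (x, t)) / (s - t)) \<partial>lebesgue)) \<longlongrightarrow>
      (\<integral>x. w x * \<Theta> (x, t) \<partial>lebesgue) + (\<integral>x. u t x * partial (0, 1) \<Theta> (x, t) \<partial>lebesgue)) (at t within S)"
    by (rule tendsto_add)
  moreover have "\<forall>\<^sub>F s in at t within S. (\<integral>x. ((u s x - u t x) / (s - t)) * \<Theta> (x, s) \<partial>lebesgue)
      + (\<integral>x. u t x * ((\<Theta> (x, s) - \<Theta> (x, t)) / (s - t)) \<partial>lebesgue)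
      = ((\<integral>x. u s x * \<Theta> (x, s) \<partial>lebesgue) - (\<integral>x. u t x * \<Theta> (x, t) \<partial>lebesgue)) / (s - t)"
    using ev
  proof eventually_elim
    case (elim s)
    let ?A = "\<integral>x. u s x * \<Theta> (x, s) \<partial>lebesgue" and ?B = "\<integral>x. u t x * \<Theta> (x, s) \<partial>lebesgue"
      and ?D = "\<integral>x. u t x * \<Theta> (x, t) \<partial>lebesgue"
    have i: "integrable lebesgue (\<lambda>x. u r x * \<Theta> (x, r'))" if "r \<in> {s, t}" for r r'
      using that elim t by (intro L2_mult_integrable u L) auto
    have "(\<integral>x. ((u s x - u t x) / (s - t)) * \<Theta> (x, s) \<partial>lebesgue) =
        (\<integral>x. (u s x * \<Theta> (x, s) - u t x * \<Theta> (x, s)) / (s - t) \<partial>lebesgue)"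
      by (simp add: left_diff_distrib)
    also have "\<dots> = (?A - ?B) / (s - t)" using i by simp
    finally have 1: "(\<integral>x. ((u s x - u t x) / (s - t)) * \<Theta> (x, s) \<partial>lebesgue) = (?A - ?B) / (s - t)" .
    have "(\<integral>x. u t x * ((\<Theta> (x, s) - \<Theta> (x, t)) / (s - t)) \<partial>lebesgue) =
        (\<integral>x. (u t x * \<Theta> (x, s) - u t x * \<Theta> (x, t)) / (s - t) \<partial>lebesgue)"
      by (simp add: right_diff_distrib)
    also have "\<dots> = (?B - ?D) / (s - t)" using i by simp
    finally show ?case using 1 elim by (simp add: add_divide_distrib[symmetric])
  qed
  ultimately show ?thesis
    unfolding has_field_derivative_iff by (rule Lim_transform_eventually)
qed

section \<open>From weak solutions to test function inequalities\<close>

definition dalembertian :: "('a::euclidean_space \<times> real \<Rightarrow> real) \<Rightarrow> 'a \<times> real \<Rightarrow> real" where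
  "dalembertian \<Psi> z = partial (0, 1) (partial (0, 1) \<Psi>) z
     - (\<Sum>i\<in>Basis. partial (i, 0) (partial (i, 0) \<Psi>) z)"

lemma Basis_time [simp]: "(0::'a::euclidean_space, 1::real) \<in> Basis"
  by (simp add: Basis_prod_def)

lemma Basis_space [simp]: "i \<in> Basis \<Longrightarrow> (i::'a::euclidean_space, 0::real) \<in> Basis"
  by (simp add: Basis_prod_def)

lemma cyl_supp_sum:
  "finite I \<Longrightarrow> (\<And>i. i \<in> I \<Longrightarrow> cyl_supp R \<rho> (f i)) \<Longrightarrow> cyl_supp R \<rho> (\<lambda>z. \<Sum>i\<in>I. f i z)"
  unfolding cyl_supp_def by (metis (mono_tags, lifting) sum.neutral)

lemma cyl_supp_diff:
  "cyl_supp R \<rho> f \<Longrightarrow> cyl_supp R \<rho> g \<Longrightarrow> cyl_supp R \<rho> (\<lambda>z. f z - g z)"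
  unfolding cyl_supp_def by (metis diff_zero)

lemma cyl_supp_cmult: "cyl_supp R \<rho> f \<Longrightarrow> cyl_supp R \<rho> (\<lambda>z. c * f z)"
  by (auto simp: cyl_supp_def)

text \<open>The strict inequality \<open>ereal R < T\<close> keeps the closed cylinder inside the
  half-open time interval.\<close>

lemma test_fun_cyl_supp:
  fixes \<Psi> :: "'a::euclidean_space \<times> real \<Rightarrow> real"
  assumes "smooth \<Psi>" "cyl_supp R \<rho> \<Psi>" "ereal R < T"
  shows "test_fun T \<Psi>"
proof -
  let ?S = "{z \<in> UNIV \<times> time_ico T. \<Psi> z \<noteq> 0}" and ?K = "cball (0::'a) \<rho> \<times> {0..R}"
  have "?S \<subseteq> ?K"
  proof
    fix z assume "z \<in> ?S"
    then show "z \<in> ?K" using cyl_suppD[OF assms(2), of "fst z" "snd z"]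
      by (cases z) (auto simp: time_ico_def)
  qed
  moreover have K: "compact ?K" by (intro compact_Times) auto
  ultimately have cl: "closure ?S \<subseteq> ?K" by (intro closure_minimal compact_imp_closed)
  have "compact (closure ?S)"
    using compact_Int_closed[OF K closed_closure, of ?S] cl by (simp add: Int_absorb1)
  moreover have "?K \<subseteq> UNIV \<times> time_ico T"
    using assms(3) by (auto simp: time_ico_def intro: le_less_trans[of "ereal _" "ereal R"])
  ultimately show ?thesis using assms(1) cl by (auto simp: test_fun_def)
qed

lemma set_lebesgue_integral_FTC:
  fixes v :: "real \<Rightarrow> real"
  assumes "\<And>t. t \<in> {a..b} \<Longrightarrow> (v has_real_derivative v' t) (at t within {a..b})"
    "continuous_on {a..b} v'" "a \<le> b"
  shows "set_integrable lebesgue {a<..b} v'" "(LINT t:{a<..b}|lebesgue. v' t) = v b - v a"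
proof -
  have "set_integrable lebesgue {a..b} v'" by (rule absolutely_integrable_continuous_real[OF assms(2)])
  then show i: "set_integrable lebesgue {a<..b} v'"
    by (rule set_integrable_subset) auto
  have "(v' has_integral (v b - v a)) {a..b}"
    by (rule fundamental_theorem_of_calculus[OF assms(3)])
       (use assms(1) in \<open>auto simp: has_real_derivative_iff_has_vector_derivative\<close>)
  then have "(v' has_integral (v b - v a)) {a<..b}"
    by (subst has_integral_spike_set_eq[where T = "{a..b}"]) (auto intro: negligible_subset[of "{a}"])
  then show "(LINT t:{a<..b}|lebesgue. v' t) = v b - v a"
    using set_lebesgue_integral_eq_integral[OF i] by (simp add: integral_unique)
qed

text \<open>All derivatives move from u to \<Psi>. In space this is the definition of the weak
  gradient, applied to slices of the first derivatives of \<Psi>; in time it is the fundamental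
  theorem for the pairing of u with the time derivative of \<Psi>, whose value at 0 is the f-term.
  As \<Psi> is supported in |t| \<le> R0 < R, the value at R vanishes, and the right-hand side lives
  on a bounded interval even for infinite T.\<close>

lemma weak_solution_strong_form:
  fixes u :: "real \<Rightarrow> 'a::euclidean_space \<Rightarrow> real"
  assumes sol: "weak_solution G f g \<epsilon> T u" and f: "f \<in> borel_measurable lebesgue"
    and \<Psi>: "smooth \<Psi>" "cyl_supp R0 \<rho> \<Psi>" and R: "0 < R" "R0 < R" "ereal R < T"
  shows "\<epsilon> * ((\<integral>x. g x * \<Psi> (x, 0) \<partial>lebesgue) - (\<integral>x. f x * partial (0, 1) \<Psi> (x, 0) \<partial>lebesgue))
      + (LINT t:time_ioo T|lebesgue. (\<integral>x. G (u t x) * \<Psi> (x, t) \<partial>lebesgue))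
      = (LINT t:{0<..R}|lebesgue. (\<integral>x. u t x * dalembertian \<Psi> (x, t) \<partial>lebesgue))" (is ?eq)
    and "set_integrable lebesgue {0<..R} (\<lambda>t. \<integral>x. u t x * dalembertian \<Psi> (x, t) \<partial>lebesgue)" (is ?int)
proof -
  obtain ut Du where H1: "C0_H1 (time_ico T) u Du" and C1: "C1_L2 (time_ico T) u ut"
    and u0: "AE x in lebesgue. u 0 x = \<epsilon> * f x"
    and weak: "\<forall>\<Psi>. test_fun T \<Psi> \<longrightarrow> \<epsilon> * (\<integral>x. g x * \<Psi> (x, 0) \<partial>lebesgue)
          + (LINT t:time_ioo T|lebesgue. (\<integral>x. G (u t x) * \<Psi> (x, t) \<partial>lebesgue))
        = (LINT t:time_ioo T|lebesgue.
             (\<integral>x. - ut t x * partial (0, 1) \<Psi> (x, t)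
                 + (\<Sum>i\<in>Basis. (Du t x \<bullet> i) * partial (i, 0) \<Psi> (x, t)) \<partial>lebesgue))"
    using sol unfolding weak_solution_def by (elim exE conjE) (rule that)
  have J: "{0..R} \<subseteq> time_ico T"
    using R by (auto simp: time_ico_def intro: le_less_trans[of "ereal _" "ereal R"])
  have D: "{0<..R} \<subseteq> time_ioo T"
    using R by (auto simp: time_ioo_def intro: le_less_trans[of "ereal _" "ereal R"])
  define \<Theta> where "\<Theta> = partial (0, 1) \<Psi>"
  define P where "P i = partial (i, 0) \<Psi>" for i
  define L where "L z = (\<Sum>i\<in>Basis. partial (i, 0) (P i) z)" for z
  have \<Theta>: "smooth \<Theta>" "cyl_supp R0 \<rho> \<Theta>"
    unfolding \<Theta>_def by (auto intro: smooth_partial cyl_supp_partial \<Psi>)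
  have \<Theta>': "smooth (partial (0, 1) \<Theta>)" "cyl_supp R0 \<rho> (partial (0, 1) \<Theta>)"
    by (auto intro: smooth_partial cyl_supp_partial \<Theta>)
  have P: "smooth (P i)" "cyl_supp R0 \<rho> (P i)" if "i \<in> Basis" for i
    unfolding P_def using that by (auto intro: smooth_partial cyl_supp_partial \<Psi>)
  have P': "smooth (partial (i, 0) (P i))" "cyl_supp R0 \<rho> (partial (i, 0) (P i))" if "i \<in> Basis" for i
    using that by (auto intro: smooth_partial cyl_supp_partial P)
  have L: "smooth L" "cyl_supp R0 \<rho> L"
    unfolding L_def by (auto intro!: smooth_sum cyl_supp_sum P')
  have dal: "dalembertian \<Psi> = (\<lambda>z. partial (0, 1) \<Theta> z - L z)"
    by (simp add: fun_eq_iff dalembertian_def \<Theta>_def L_def P_def)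
  have Q: "smooth (dalembertian \<Psi>)" "cyl_supp R0 \<rho> (dalembertian \<Psi>)"
    unfolding dal by (auto intro: smooth_diff cyl_supp_diff \<Theta>' L)
  note slice = compact_support_L2[OF smooth_continuous]
  have L2u: "L2 (u t)" and L2ut: "L2 (ut t)" and L2D: "L2 (Du t)" and wg: "weak_gradient (u t) (Du t)"
    if "t \<in> {0..R}" for t
    using that J H1 C1 by (auto simp: C0_H1_def C1_L2_def)
  have du: "((\<lambda>s. L2_norm (\<lambda>x. (u s x - u t x) / (s - t) - ut t x)) \<longlongrightarrow> 0) (at t within {0..R})"
    if "t \<in> {0..R}" for t
    by (rule tendsto_within_subset[OF _ J]) (use that J C1 in \<open>auto simp: C1_L2_def\<close>)
  have cut: "((\<lambda>s. L2_norm (\<lambda>x. ut s x - ut t x)) \<longlongrightarrow> 0) (at t within {0..R})"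
    if "t \<in> {0..R}" for t
    by (rule tendsto_within_subset[OF _ J]) (use that J C1 in \<open>auto simp: C1_L2_def\<close>)
  have cu: "((\<lambda>s. L2_norm (\<lambda>x. u s x - u t x)) \<longlongrightarrow> 0) (at t within {0..R})" if "t \<in> {0..R}" for t
  proof (rule Lim_null_comparison)
    show "((\<lambda>s. sqrt ((L2_norm (\<lambda>x. u s x - u t x))\<^sup>2 + (L2_norm (\<lambda>x. Du s x - Du t x))\<^sup>2)) \<longlongrightarrow> 0)
        (at t within {0..R})"
      by (rule tendsto_within_subset[OF _ J]) (use that J H1 in \<open>auto simp: C0_H1_def\<close>)
    show "\<forall>\<^sub>F s in at t within {0..R}. norm (L2_norm (\<lambda>x. u s x - u t x))
        \<le> sqrt ((L2_norm (\<lambda>x. u s x - u t x))\<^sup>2 + (L2_norm (\<lambda>x. Du s x - Du t x))\<^sup>2)"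
      by (intro always_eventually allI real_le_rsqrt) (simp add: L2_norm_nonneg)
  qed
  define v where "v t = (\<integral>x. u t x * \<Theta> (x, t) \<partial>lebesgue)" for t
  define v' where "v' t = (\<integral>x. ut t x * \<Theta> (x, t) \<partial>lebesgue)
    + (\<integral>x. u t x * partial (0, 1) \<Theta> (x, t) \<partial>lebesgue)" for t
  define U where "U t = (\<integral>x. u t x * dalembertian \<Psi> (x, t) \<partial>lebesgue)" for t
  define w where "w t = (\<integral>x. - ut t x * partial (0, 1) \<Psi> (x, t)
                 + (\<Sum>i\<in>Basis. (Du t x \<bullet> i) * partial (i, 0) \<Psi> (x, t)) \<partial>lebesgue)" for t
  have cv': "continuous_on {0..R} v'"
    unfolding v'_def
    by (intro continuous_on_add L2_pairing_continuous[OF smooth_continuous[OF \<Theta>(1)] \<Theta>(2)]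
        L2_pairing_continuous[OF smooth_continuous[OF \<Theta>'(1)] \<Theta>'(2)] L2u L2ut cu cut)
  have cU: "continuous_on {0..R} U"
    unfolding U_def
    by (intro L2_pairing_continuous[OF smooth_continuous[OF Q(1)] Q(2)] L2u cu)
  then have iU: "set_integrable lebesgue {0<..R} U"
    by (intro set_integrable_subset[OF absolutely_integrable_continuous_real[of 0 R U]]) auto
  then show ?int by (simp add: U_def[abs_def])
  have "(v has_real_derivative v' t) (at t within {0..R})" if "t \<in> {0..R}" for t
    unfolding v_def v'_def
    by (intro L2_pairing_derivative[OF \<Theta>]) (use that L2u L2ut du in auto)
  note FTC = set_lebesgue_integral_FTC[OF this cv' less_imp_le[OF R(1)]]
  have vR: "v R = 0"
  proof -
    have "\<Theta> (x, R) = 0" for x using cyl_suppD[OF \<Theta>(2), of x R] R by auto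
    then show ?thesis by (simp add: v_def)
  qed
  have v0: "v 0 = \<epsilon> * (\<integral>x. f x * \<Theta> (x, 0) \<partial>lebesgue)"
  proof -
    have m: "(\<lambda>x. \<Theta> (x, 0)) \<in> borel_measurable lebesgue"
      using slice[OF \<Theta>] by (simp add: L2_real_iff)
    have "u 0 \<in> borel_measurable lebesgue" using L2u[of 0] R by (simp add: L2_real_iff)
    then have "v 0 = (\<integral>x. \<epsilon> * (f x * \<Theta> (x, 0)) \<partial>lebesgue)"
      unfolding v_def using u0 f m by (intro integral_cong_AE) auto
    then show ?thesis by simp
  qed
  have w: "w t = U t - v' t" if t: "t \<in> {0..R}" for t
  proof -
    have i1: "integrable lebesgue (\<lambda>x. ut t x * \<Theta> (x, t))"
      by (intro L2_mult_integrable L2ut t slice[OF \<Theta>])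
    have i2: "integrable lebesgue (\<lambda>x. (Du t x \<bullet> i) * P i (x, t))" if "i \<in> Basis" for i
      by (intro L2_mult_integrable L2_inner L2D t that slice[OF P])
    have i3: "integrable lebesgue (\<lambda>x. u t x * partial (i, 0) (P i) (x, t))" if "i \<in> Basis" for i
      by (intro L2_mult_integrable L2u t slice[OF P'] that)
    have i4: "integrable lebesgue (\<lambda>x. u t x * partial (0, 1) \<Theta> (x, t))"
      by (intro L2_mult_integrable L2u t slice[OF \<Theta>'])
    have i5: "integrable lebesgue (\<lambda>x. u t x * L (x, t))"
      by (intro L2_mult_integrable L2u t slice[OF L])
    have grad: "(\<integral>x. (Du t x \<bullet> i) * P i (x, t) \<partial>lebesgue)
        = - (\<integral>x. u t x * partial (i, 0) (P i) (x, t) \<partial>lebesgue)" if i: "i \<in> Basis" for i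
    proof -
      have "{x. P i (x, t) \<noteq> 0} \<subseteq> cball 0 \<rho>" using cyl_suppD[OF P(2)[OF i]] by auto
      then have "supp (\<lambda>x. P i (x, t)) \<subseteq> cball 0 \<rho>"
        unfolding supp_def by (intro closure_minimal) auto
      then have "compact (supp (\<lambda>x. P i (x, t)))"
        using compact_Int_closed[OF compact_cball, of "supp (\<lambda>x. P i (x, t))" 0 \<rho>]
        by (simp add: Int_absorb1 supp_def)
      then have "Cc_smooth (\<lambda>x. P i (x, t))"
        by (simp add: Cc_smooth_def smooth_slice P(1)[OF i])
      with wg[OF t] i have "(\<integral>x. u t x * partial i (\<lambda>x. P i (x, t)) x \<partial>lebesgue)
          = - (\<integral>x. (Du t x \<bullet> i) * P i (x, t) \<partial>lebesgue)"
        unfolding weak_gradient_def by blast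
      then show ?thesis
        by (simp add: partial_fst smooth_differentiable P(1)[OF i])
    qed
    have "w t = - (\<integral>x. ut t x * \<Theta> (x, t) \<partial>lebesgue)
        + (\<Sum>i\<in>Basis. \<integral>x. (Du t x \<bullet> i) * P i (x, t) \<partial>lebesgue)"
      unfolding w_def \<Theta>_def[symmetric] P_def[symmetric]
      using i1 i2 by (subst Bochner_Integration.integral_add) auto
    also have "(\<Sum>i\<in>Basis. \<integral>x. (Du t x \<bullet> i) * P i (x, t) \<partial>lebesgue)
        = - (\<Sum>i\<in>Basis. \<integral>x. u t x * partial (i, 0) (P i) (x, t) \<partial>lebesgue)"
      by (simp add: grad sum_negf)
    also have "(\<Sum>i\<in>Basis. \<integral>x. u t x * partial (i, 0) (P i) (x, t) \<partial>lebesgue)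
        = (\<integral>x. u t x * L (x, t) \<partial>lebesgue)"
      unfolding L_def sum_distrib_left
      by (rule Bochner_Integration.integral_sum[symmetric]) (rule i3)
    also have "- (\<integral>x. ut t x * \<Theta> (x, t) \<partial>lebesgue) + - (\<integral>x. u t x * L (x, t) \<partial>lebesgue) = U t - v' t"
      unfolding U_def v'_def dal right_diff_distrib using i4 i5 by simp
    finally show ?thesis .
  qed
  have w0: "w t = 0" if "R < t" for t
  proof -
    have "\<Theta> (x, t) = 0" "i \<in> Basis \<Longrightarrow> P i (x, t) = 0" for x i
      using that R cyl_suppD[OF \<Theta>(2), of x t] cyl_suppD[OF P(2), of i x t] by auto
    then show ?thesis by (simp add: w_def \<Theta>_def P_def)
  qed
  have "(LINT t:time_ioo T|lebesgue. w t) = (LINT t:{0<..R}|lebesgue. U t - v' t)"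
    unfolding set_lebesgue_integral_def
  proof (intro Bochner_Integration.integral_cong refl)
    fix t
    show "indicat_real (time_ioo T) t *\<^sub>R w t = indicat_real {0<..R} t *\<^sub>R (U t - v' t)"
      using w[of t] w0[of t] D by (auto simp: indicator_def time_ioo_def)
  qed
  also have "\<dots> = (LINT t:{0<..R}|lebesgue. U t) - (v R - v 0)"
    using iU FTC by (simp add: set_integral_diff)
  finally have "(LINT t:time_ioo T|lebesgue. w t) = (LINT t:{0<..R}|lebesgue. U t)
      + \<epsilon> * (\<integral>x. f x * \<Theta> (x, 0) \<partial>lebesgue)"
    using vR v0 by simp
  then show ?eq
    using weak[rule_format, OF test_fun_cyl_supp[OF \<Psi>, of T]] R less_trans[of "ereal R0" "ereal R" T]
    by (simp add: w_def U_def \<Theta>_def right_diff_distrib)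
qed

text \<open>The issue is measurability in t. For a simple approximant the pairing is a finite sum of
  indicators times continuous functions of t; boundedness of \<Theta> carries the L1 convergence
  over to the pairings for almost every t. Integrability follows by domination with M times the
  norm.\<close>

lemma L1_pairing_integrable:
  fixes w :: "real \<Rightarrow> 'a::euclidean_space \<Rightarrow> real"
  assumes w: "L1_L1 I w" and I: "I \<in> sets lebesgue"
    and \<Theta>: "continuous_on UNIV \<Theta>" "\<And>z. \<bar>\<Theta> z\<bar> \<le> M"
  shows "set_integrable lebesgue I (\<lambda>t. \<integral>x. w t x * \<Theta> (x, t) \<partial>lebesgue)"
proof -
  have M: "0 \<le> M" using \<Theta>(2)[of undefined] by linarith
  have m\<Theta>: "(\<lambda>x. \<Theta> (x, t)) \<in> borel_measurable lebesgue" for t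
    using borel_measurable_continuous_onI[OF slice_continuous[OF \<Theta>(1)]]
    by (simp add: measurable_completion)
  have ip: "integrable lebesgue (\<lambda>x. h x * \<Theta> (x, t))" if "integrable lebesgue h" for h t
  proof (rule Bochner_Integration.integrable_bound)
    show "integrable lebesgue (\<lambda>x. M * h x)" using that by simp
    show "AE x in lebesgue. norm (h x * \<Theta> (x, t)) \<le> norm (M * h x)"
      using \<Theta>(2) M by (auto simp: abs_mult mult.commute[of M] intro!: mult_left_mono AE_I2)
  qed (use that m\<Theta> in auto)
  have cont: "continuous_on UNIV (\<lambda>t. \<integral>x. h x * \<Theta> (x, t) \<partial>lebesgue)" if h: "integrable lebesgue h" for h
    unfolding continuous_on_sequentially
  proof (intro allI ballI impI, elim conjE)
    fix X :: "nat \<Rightarrow> real" and t assume X: "X \<longlonglongrightarrow> t"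
    show "((\<lambda>t. \<integral>x. h x * \<Theta> (x, t) \<partial>lebesgue) \<circ> X) \<longlonglongrightarrow> (\<integral>x. h x * \<Theta> (x, t) \<partial>lebesgue)"
      unfolding o_def
    proof (rule integral_dominated_convergence[where w = "\<lambda>x. M * \<bar>h x\<bar>"])
      show "AE x in lebesgue. (\<lambda>i. h x * \<Theta> (x, X i)) \<longlonglongrightarrow> h x * \<Theta> (x, t)"
      proof (intro AE_I2 tendsto_mult tendsto_const)
        fix x
        show "(\<lambda>i. \<Theta> (x, X i)) \<longlonglongrightarrow> \<Theta> (x, t)"
          by (rule continuous_on_tendsto_compose[OF \<Theta>(1)]) (auto intro: tendsto_Pair X)
      qed
      show "AE x in lebesgue. norm (h x * \<Theta> (x, X i)) \<le> M * \<bar>h x\<bar>" for i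
        using \<Theta>(2) by (auto simp: abs_mult mult.commute[of M] intro!: mult_left_mono AE_I2)
    qed (use h m\<Theta> in auto)
  qed
  obtain s where s: "\<And>n. simple_L1 (s n)"
    and lim: "AE t in lebesgue. t \<in> I \<longrightarrow> (\<lambda>n. \<integral>x. \<bar>s n t x - w t x\<bar> \<partial>lebesgue) \<longlonglongrightarrow> 0"
    using w unfolding L1_L1_def by blast
  have wi: "AE t in lebesgue. t \<in> I \<longrightarrow> integrable lebesgue (w t)"
    and wn: "set_integrable lebesgue I (\<lambda>t. \<integral>x. \<bar>w t x\<bar> \<partial>lebesgue)"
    using w unfolding L1_L1_def by blast+
  define A where "A n t = (\<integral>x. s n t x * \<Theta> (x, t) \<partial>lebesgue)" for n t
  have si: "integrable lebesgue (s n t)" and Am: "A n \<in> borel_measurable lebesgue" for n t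
  proof -
    obtain m B h where Bh: "\<And>k. k < m \<Longrightarrow> B k \<in> sets lebesgue" "\<And>k. k < m \<Longrightarrow> integrable lebesgue (h k)"
      and sn: "\<And>t x. s n t x = (\<Sum>k<(m::nat). indicator (B k) t * h k x)"
      using s[of n] unfolding simple_L1_def by blast
    have sn': "s n t = (\<lambda>x. \<Sum>k<m. indicator (B k) t * h k x)" for t by (rule ext) (rule sn)
    show "integrable lebesgue (s n t)" unfolding sn' using Bh by auto
    have "A n t = (\<Sum>k<m. indicator (B k) t * (\<integral>x. h k x * \<Theta> (x, t) \<partial>lebesgue))" for t
    proof -
      have "A n t = (\<integral>x. (\<Sum>k<m. indicator (B k) t * (h k x * \<Theta> (x, t))) \<partial>lebesgue)"
        by (simp add: A_def sn sum_distrib_right mult.assoc)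
      also have "\<dots> = (\<Sum>k<m. indicator (B k) t * (\<integral>x. h k x * \<Theta> (x, t) \<partial>lebesgue))"
        using ip[OF Bh(2)] by (subst Bochner_Integration.integral_sum) auto
      finally show ?thesis .
    qed
    then have "A n = (\<lambda>t. \<Sum>k<m. indicator (B k) t * (\<integral>x. h k x * \<Theta> (x, t) \<partial>lebesgue))" by (rule ext)
    moreover have "(\<lambda>t. \<integral>x. h k x * \<Theta> (x, t) \<partial>lebesgue) \<in> borel_measurable lebesgue" if "k < m" for k
      using borel_measurable_continuous_onI[OF cont[OF Bh(2)[OF that]]]
          by (simp add: measurable_completion)
    ultimately show "A n \<in> borel_measurable lebesgue"
      using Bh(1) by (simp only:) (intro borel_measurable_sum borel_measurable_times
          borel_measurable_indicator; simp)
  qed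
  define F where "F t = indicator I t * (\<integral>x. w t x * \<Theta> (x, t) \<partial>lebesgue)" for t
  have "AE t in lebesgue. (\<lambda>n. indicator I t * A n t) \<longlonglongrightarrow> F t"
    using lim wi
  proof eventually_elim
    case (elim t)
    show ?case
    proof (cases "t \<in> I")
      case True
      with elim have wt: "integrable lebesgue (w t)"
        and l: "(\<lambda>n. \<integral>x. \<bar>s n t x - w t x\<bar> \<partial>lebesgue) \<longlonglongrightarrow> 0" by auto
      have "(\<lambda>n. A n t - (\<integral>x. w t x * \<Theta> (x, t) \<partial>lebesgue)) \<longlonglongrightarrow> 0"
      proof (rule Lim_null_comparison)
        show "\<forall>\<^sub>F n in sequentially. norm (A n t - (\<integral>x. w t x * \<Theta> (x, t) \<partial>lebesgue))
            \<le> M * (\<integral>x. \<bar>s n t x - w t x\<bar> \<partial>lebesgue)"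
        proof (intro always_eventually allI)
          fix n
          have "A n t - (\<integral>x. w t x * \<Theta> (x, t) \<partial>lebesgue) = (\<integral>x. (s n t x - w t x) * \<Theta> (x, t) \<partial>lebesgue)"
            unfolding A_def left_diff_distrib
            by (rule Bochner_Integration.integral_diff[symmetric]) (intro ip si wt)+
          moreover have "norm (\<integral>x. (s n t x - w t x) * \<Theta> (x, t) \<partial>lebesgue)
              \<le> (\<integral>x. M * \<bar>s n t x - w t x\<bar> \<partial>lebesgue)"
          proof (rule Bochner_Integration.integral_norm_bound_integral)
            show "integrable lebesgue (\<lambda>x. (s n t x - w t x) * \<Theta> (x, t))"
              by (intro ip Bochner_Integration.integrable_diff si wt)
            show "integrable lebesgue (\<lambda>x. M * \<bar>s n t x - w t x\<bar>)"
              using si wt by auto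
            show "norm ((s n t x - w t x) * \<Theta> (x, t)) \<le> M * \<bar>s n t x - w t x\<bar>" for x
              using \<Theta>(2) by (auto simp: abs_mult mult.commute[of M] intro!: mult_left_mono)
          qed
          ultimately show "norm (A n t - (\<integral>x. w t x * \<Theta> (x, t) \<partial>lebesgue))
            \<le> M * (\<integral>x. \<bar>s n t x - w t x\<bar> \<partial>lebesgue)" by simp
        qed
        show "(\<lambda>n. M * (\<integral>x. \<bar>s n t x - w t x\<bar> \<partial>lebesgue)) \<longlonglongrightarrow> 0"
          using tendsto_mult[OF tendsto_const[of M] l] by simp
      qed
      then show ?thesis using True by (simp add: F_def LIM_zero_iff)
    qed (simp add: F_def)
  qed
  then obtain N where N: "N \<in> null_sets lebesgue"
    "\<And>t. t \<notin> N \<Longrightarrow> (\<lambda>n. indicator I t * A n t) \<longlonglongrightarrow> F t"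
    by (auto simp: completion.AE_iff_null_sets)
  \<comment> \<open>Convergence may fail on the null set N, so N is removed before passing to the
    limit and restored by completeness of Lebesgue measure.\<close>
  have "(\<lambda>t. indicator (- N) t * F t) \<in> borel_measurable lebesgue"
  proof (rule borel_measurable_LIMSEQ_real)
    show "(\<lambda>n. indicator (- N) t * (indicator I t * A n t)) \<longlonglongrightarrow> indicator (- N) t * F t" for t
      using N(2)[of t] by (cases "t \<in> N") auto
    have "- N \<in> sets lebesgue" using N(1) by (simp add: null_setsD2 Compl_in_sets_lebesgue)
    then show "(\<lambda>t. indicator (- N) t * (indicator I t * A n t)) \<in> borel_measurable lebesgue" for n
      using Am I by (intro borel_measurable_times) auto
  qed
  then have Fm: "F \<in> borel_measurable lebesgue"
    by (rule borel_measurable_AE) (rule AE_I'[OF N(1)], auto simp: indicator_def)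
  have "integrable lebesgue F"
  proof (rule Bochner_Integration.integrable_bound)
    show "integrable lebesgue (\<lambda>t. M * (indicator I t * (\<integral>x. \<bar>w t x\<bar> \<partial>lebesgue)))"
      using wn by (simp add: set_integrable_def)
    show "AE t in lebesgue. norm (F t) \<le> norm (M * (indicator I t * (\<integral>x. \<bar>w t x\<bar> \<partial>lebesgue)))"
      using wi
    proof eventually_elim
      case (elim t)
      show ?case
      proof (cases "t \<in> I")
        case True
        then have "norm (\<integral>x. w t x * \<Theta> (x, t) \<partial>lebesgue) \<le> (\<integral>x. M * \<bar>w t x\<bar> \<partial>lebesgue)"
          using elim \<Theta>(2)
          by (intro Bochner_Integration.integral_norm_bound_integral ip)
             (auto simp: abs_mult mult.commute[of M] intro!: mult_left_mono)
        then show ?thesis using True M by (simp add: F_def abs_mult)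
      qed (simp add: F_def)
    qed
  qed (rule Fm)
  then show ?thesis by (simp add: F_def[abs_def] set_integrable_def)
qed

text \<open>Each point outside the cone has a ball on which \<open>u t\<close> vanishes almost
  everywhere. By Lindelof's theorem countably many such sets cover the exterior, so their
  exceptional null sets can be united.\<close>

lemma AE_zero_outside_supp:
  fixes u :: "real \<Rightarrow> 'a::euclidean_space \<Rightarrow> real"
  assumes supp: "supp_st T u \<subseteq> {(x, t). 0 \<le> t \<and> ereal t \<le> T \<and> norm x \<le> r0 + t}"
    and t: "t \<in> time_ico T"
  shows "AE y in lebesgue. norm y > r0 + t \<longrightarrow> u t y = 0"
proof -
  define F where "F = {B. open B \<and> (AE y in lebesgue. y \<in> B \<longrightarrow> u t y = 0)}"
  obtain F' where F': "F' \<subseteq> F" "countable F'" "\<Union>F' = \<Union>F"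
    using Lindelof[of F] by (auto simp: F_def)
  have "AE y in lebesgue. \<forall>B\<in>F'. y \<in> B \<longrightarrow> u t y = 0"
    using F'(1) by (subst AE_ball_countable[OF F'(2)]) (auto simp: F_def)
  moreover have "x \<in> \<Union>F" if x: "norm x > r0 + t" for x
  proof -
    have "(x, t) \<notin> supp_st T u" using supp x by auto
    then obtain \<delta> where "\<delta> > 0" "\<And>s. s \<in> time_ico T \<inter> ball t \<delta> \<Longrightarrow> AE y in lebesgue. y \<in> ball x \<delta> \<longrightarrow>
        u s y = 0"
      using t unfolding supp_st_def by blast
    then have "ball x \<delta> \<in> F" using t by (auto simp: F_def)
    then show ?thesis using \<open>\<delta> > 0\<close> by (meson UnionI centre_in_ball)
  qed
  ultimately show ?thesis using F'(3) by (auto elim!: eventually_mono)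
qed

lemma weighted_source_integrable:
  fixes u :: "real \<Rightarrow> 'a::euclidean_space \<Rightarrow> real"
  assumes sol: "weak_solution G f g \<epsilon> T u" and G0: "\<And>s. 0 \<le> G s" and R: "ereal R < T"
    and q: "q \<in> borel_measurable borel" "\<And>t. 0 \<le> q t" "\<And>t. q t \<le> B"
  shows "set_integrable lebesgue {0<..R} (\<lambda>t. q t * (\<integral>x. G (u t x) \<partial>lebesgue))"
proof -
  let ?D = "{0<..R}" and ?\<alpha> = "\<lambda>t. \<integral>x. G (u t x) \<partial>lebesgue"
  have D: "?D \<subseteq> time_ioo T"
    using R by (auto simp: time_ioo_def intro: le_less_trans[of "ereal _" "ereal R"])
  from sol have "L1_L1 (time_ioo T) (\<lambda>t x. G (u t x))"
    unfolding weak_solution_def by blast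
  then have "set_integrable lebesgue (time_ioo T) ?\<alpha>" using G0 by (simp add: L1_L1_def)
  from set_integrable_subset[OF this _ D] have i: "integrable lebesgue (\<lambda>t. indicator ?D t * ?\<alpha> t)"
    by (simp add: set_integrable_def)
  have "integrable lebesgue (\<lambda>t. q t * (indicator ?D t * ?\<alpha> t))"
  proof (rule Bochner_Integration.integrable_bound)
    show "integrable lebesgue (\<lambda>t. B * (indicator ?D t * ?\<alpha> t))" using i by simp
    have "q \<in> borel_measurable lebesgue" using q(1) by (simp add: measurable_completion)
    then show "(\<lambda>t. q t * (indicator ?D t * ?\<alpha> t)) \<in> borel_measurable lebesgue"
      by (intro borel_measurable_times[OF _ borel_measurable_integrable[OF i]])
    show "AE t in lebesgue. norm (q t * (indicator ?D t * ?\<alpha> t)) \<le> norm (B * (indicator ?D t * ?\<alpha> t))"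
      using q(2,3) order_trans[OF q(2,3)]
      by (auto simp: abs_mult intro!: AE_I2 mult_right_mono)
  qed
  then show ?thesis by (simp add: set_integrable_def mult.left_commute)
qed

text \<open>P is a lower bound of \<Psi> on the support cone. The Young bound splits
  \<open>u * dalembertian \<Psi>\<close> into a part controlled through
  \<open>\<bar>u\<bar> powr p \<le> G u / a\<close> and a kernel H free of u whose slices have
  integral at most b; integration over (0, R] yields \<open>R * b\<close>. The bound B makes the
  weighted source integrals exist.\<close>

lemma test_function_inequality:
  fixes u :: "real \<Rightarrow> 'a::euclidean_space \<Rightarrow> real"
  assumes sol: "weak_solution G f g \<epsilon> T u" and f: "f \<in> borel_measurable lebesgue"
    and supp: "supp_st T u \<subseteq> {(x, t). 0 \<le> t \<and> ereal t \<le> T \<and> norm x \<le> r0 + t}"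
    and G: "G 0 = 0" "\<And>s. a * \<bar>s\<bar> powr p \<le> G s" "0 < a"
    and \<Psi>: "smooth \<Psi>" "cyl_supp R0 \<rho> \<Psi>" "\<And>x t. 0 < t \<Longrightarrow> 0 \<le> \<Psi> (x, t)" and R: "0 < R" "R0 < R"
        "ereal R < T"
    and P: "P \<in> borel_measurable borel" "\<And>t. 0 \<le> P t" "\<And>t. P t \<le> B"
      "\<And>x t. 0 < t \<Longrightarrow> t \<le> R \<Longrightarrow> norm x \<le> r0 + t \<Longrightarrow> P t \<le> \<Psi> (x, t)"
    and Q: "Q \<in> borel_measurable borel" "\<And>t. 0 \<le> Q t" "\<And>t. Q t \<le> B"
    and H: "\<And>t. 0 < t \<Longrightarrow> t \<le> R \<Longrightarrow> integrable lebesgue (H t)" "\<And>t x. 0 \<le> H t x"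
      "\<And>t. 0 < t \<Longrightarrow> t \<le> R \<Longrightarrow> (\<integral>x. H t x \<partial>lebesgue) \<le> b"
    and young: "\<And>x t y. 0 < t \<Longrightarrow> t \<le> R \<Longrightarrow> norm x \<le> r0 + t \<Longrightarrow> 0 \<le> y \<Longrightarrow>
      y * \<bar>dalembertian \<Psi> (x, t)\<bar> \<le> Q t * y powr p + H t x"
  shows "\<epsilon> * ((\<integral>x. g x * \<Psi> (x, 0) \<partial>lebesgue) - (\<integral>x. f x * partial (0, 1) \<Psi> (x, 0) \<partial>lebesgue))
      + (LINT t:{0<..R}|lebesgue. P t * (\<integral>x. G (u t x) \<partial>lebesgue))
      \<le> (LINT t:{0<..R}|lebesgue. Q t * (\<integral>x. G (u t x) \<partial>lebesgue)) / a + R * b"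
proof -
  let ?D = "{0<..R}" and ?\<alpha> = "\<lambda>t. \<integral>x. G (u t x) \<partial>lebesgue"
    and ?g = "\<lambda>t. \<integral>x. G (u t x) * \<Psi> (x, t) \<partial>lebesgue"
    and ?U = "\<lambda>t. \<integral>x. u t x * dalembertian \<Psi> (x, t) \<partial>lebesgue"
  have G0: "0 \<le> G s" for s
    using G(2)[of s] G(3) by (meson mult_nonneg_nonneg order_trans less_imp_le powr_ge_zero)
  have DT: "?D \<subseteq> time_ioo T" "?D \<subseteq> time_ico T"
    using R by (auto simp: time_ioo_def time_ico_def intro: le_less_trans[of "ereal _" "ereal R"])
  have ioo: "time_ioo T \<in> sets lebesgue"
  proof -
    have "time_ioo T = {0<..} \<inter> ereal -` {..<T}" by (auto simp: time_ioo_def)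
    then have "open (time_ioo T)" by (auto intro!: open_Int open_vimage continuous_on_ereal
        continuous_on_id)
    then show ?thesis by (simp add: lebesgue_openin)
  qed
  have lm: "?D \<in> lmeasurable"
    by (rule bounded_set_imp_lmeasurable) (auto intro: bounded_subset[of "{0..R}"])
  note strong = weak_solution_strong_form[OF sol f \<Psi>(1,2) R]
  obtain M where M: "\<And>z. \<bar>\<Psi> z\<bar> \<le> M"
    by (rule compact_support_bounded[OF smooth_continuous[OF \<Psi>(1)] \<Psi>(2)]) auto
  from sol have L1: "L1_L1 (time_ioo T) (\<lambda>t x. G (u t x))"
    unfolding weak_solution_def by blast
  have ig: "set_integrable lebesgue (time_ioo T) ?g"
    by (rule L1_pairing_integrable[OF L1 ioo smooth_continuous[OF \<Psi>(1)] M])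
  have i\<alpha>: "set_integrable lebesgue (time_ioo T) ?\<alpha>"
    using L1 G0 by (simp add: L1_L1_def)
  have iG: "AE t in lebesgue. t \<in> time_ioo T \<longrightarrow> integrable lebesgue (\<lambda>x. G (u t x))"
    using L1 by (simp add: L1_L1_def)
  have L2u: "L2 (u t)" if "t \<in> ?D" for t
    using sol DT that unfolding weak_solution_def C0_H1_def by blast
  have zero: "AE x in lebesgue. r0 + t < norm x \<longrightarrow> u t x = 0" if "t \<in> ?D" for t
    by (rule AE_zero_outside_supp[OF supp]) (use DT that in auto)
  have iD: "set_integrable lebesgue ?D (\<lambda>t. q t * ?\<alpha> t)"
    if "q \<in> borel_measurable borel" "\<And>t. 0 \<le> q t" "\<And>t. q t \<le> B" for q
    by (rule weighted_source_integrable[OF sol G0 R(3) that])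
  have \<Psi>m: "(\<lambda>x. \<Psi> (x, t)) \<in> borel_measurable lebesgue" for t
    using compact_support_L2[OF smooth_continuous[OF \<Psi>(1)] \<Psi>(2)] by (simp add: L2_real_iff)
  \<comment> \<open>Times between R and T are discarded, since G and \<Psi> are nonnegative
    there.\<close>
  have "(LINT t:?D|lebesgue. P t * ?\<alpha> t) \<le> (LINT t:time_ioo T|lebesgue. ?g t)"
    unfolding set_lebesgue_integral_def
  proof (rule integral_mono_AE)
    show "AE t in lebesgue. indicat_real ?D t *\<^sub>R (P t * ?\<alpha> t) \<le> indicat_real (time_ioo T) t *\<^sub>R ?g t"
      using iG
    proof eventually_elim
      case (elim t)
      show ?case
      proof (cases "t \<in> ?D")
        case True
        then have i: "integrable lebesgue (\<lambda>x. G (u t x))" using elim DT by auto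
        have "(\<integral>x. P t * G (u t x) \<partial>lebesgue) \<le> ?g t"
        proof (rule integral_mono_AE)
          show "integrable lebesgue (\<lambda>x. G (u t x) * \<Psi> (x, t))"
          proof (rule Bochner_Integration.integrable_bound)
            show "integrable lebesgue (\<lambda>x. G (u t x) * M)" using i by simp
            show "AE x in lebesgue. norm (G (u t x) * \<Psi> (x, t)) \<le> norm (G (u t x) * M)"
              using order_trans[OF M abs_ge_self] by (auto simp: abs_mult intro!: AE_I2 mult_left_mono)
          qed (use i \<Psi>m in auto)
          show "AE x in lebesgue. P t * G (u t x) \<le> G (u t x) * \<Psi> (x, t)"
            using zero[OF True]
          proof eventually_elim
            case (elim x)
            show ?case
            proof (cases "norm x \<le> r0 + t")
              case True
              then show ?thesis using P(4)[of t x] \<open>t \<in> ?D\<close> G0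
                by (subst mult.commute) (auto intro!: mult_left_mono)
            qed (use elim G(1) in auto)
          qed
        qed (use i in simp)
        then show ?thesis using True DT by auto
      next
        case False
        then show ?thesis using G0 \<Psi>(3)
          by (auto intro!: Bochner_Integration.integral_nonneg simp: indicator_def time_ioo_def)
      qed
    qed
  qed (use ig iD[OF P(1-3)] in \<open>simp_all add: set_integrable_def\<close>)
  moreover have "(LINT t:?D|lebesgue. ?U t) \<le> (LINT t:?D|lebesgue. Q t * ?\<alpha> t / a + b)"
    unfolding set_lebesgue_integral_def
  proof (rule integral_mono_AE)
    show "integrable lebesgue (\<lambda>t. indicat_real ?D t *\<^sub>R ?U t)"
      using strong(2) by (simp add: set_integrable_def)
    show "integrable lebesgue (\<lambda>t. indicat_real ?D t *\<^sub>R (Q t * ?\<alpha> t / a + b))"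
      using set_integral_add(1)[OF set_integrable_divide[OF iD[OF Q], of a]
          absolutely_integrable_on_const[OF lm, of b]]
      by (simp add: set_integrable_def)
    show "AE t in lebesgue. indicat_real ?D t *\<^sub>R ?U t \<le> indicat_real ?D t *\<^sub>R (Q t * ?\<alpha> t / a + b)"
      using iG
    proof eventually_elim
      case (elim t)
      show ?case
      proof (cases "t \<in> ?D")
        case True
        then have i: "integrable lebesgue (\<lambda>x. G (u t x))" using elim DT by auto
        have Dm: "continuous_on UNIV (dalembertian \<Psi>)" "cyl_supp R0 \<rho> (dalembertian \<Psi>)"
          unfolding dalembertian_def[abs_def]
          by (auto intro!: smooth_continuous smooth_diff smooth_sum cyl_supp_diff cyl_supp_sum
              smooth_partial cyl_supp_partial \<Psi>)
        have "?U t \<le> (\<integral>x. Q t / a * G (u t x) + H t x \<partial>lebesgue)"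
        proof (rule integral_mono_AE)
          show "integrable lebesgue (\<lambda>x. u t x * dalembertian \<Psi> (x, t))"
            by (intro L2_mult_integrable L2u True compact_support_L2[OF Dm])
          show "integrable lebesgue (\<lambda>x. Q t / a * G (u t x) + H t x)"
            using i H(1) True by auto
          show "AE x in lebesgue. u t x * dalembertian \<Psi> (x, t) \<le> Q t / a * G (u t x) + H t x"
            using zero[OF True]
          proof eventually_elim
            case (elim x)
            show ?case
            proof (cases "norm x \<le> r0 + t")
              case True
              have "u t x * dalembertian \<Psi> (x, t) \<le> \<bar>u t x\<bar> * \<bar>dalembertian \<Psi> (x, t)\<bar>"
                by (metis abs_ge_self abs_mult)
              also have "\<dots> \<le> Q t * \<bar>u t x\<bar> powr p + H t x"
                using young True \<open>t \<in> ?D\<close> by auto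
              also have "Q t * \<bar>u t x\<bar> powr p \<le> Q t * (G (u t x) / a)"
                using G(2)[of "u t x"] G(3) Q(2) by (intro mult_left_mono) (auto simp: field_simps)
              finally show ?thesis by simp
            qed (use elim G(1) H(2) in auto)
          qed
        qed
        also have "\<dots> = Q t / a * ?\<alpha> t + (\<integral>x. H t x \<partial>lebesgue)"
          using i H(1) True by (subst Bochner_Integration.integral_add) auto
        also have "\<dots> \<le> Q t * ?\<alpha> t / a + b" using H(3) True by auto
        finally show ?thesis using True by simp
      qed simp
    qed
  qed
  moreover have "(LINT t:?D|lebesgue. Q t * ?\<alpha> t / a + b) = (LINT t:?D|lebesgue. Q t * ?\<alpha> t) / a + R * b"
  proof -
    have "(LINT t:?D|lebesgue. b) = R * b" using R(1) by (simp add: set_lebesgue_integral_def)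
    then show ?thesis
      using set_integral_add(2)[OF set_integrable_divide[OF iD[OF Q], of a]
          absolutely_integrable_on_const[OF lm, of b]] by simp
  qed
  ultimately show ?thesis using strong(1) by linarith
qed

section \<open>Solutions of the wave equation built from the Lorentz form\<close>

lemma dalembertian_sum:
  fixes f :: "'k \<Rightarrow> 'a::euclidean_space \<times> real \<Rightarrow> real"
  assumes I: "finite I" and f: "\<And>k. k \<in> I \<Longrightarrow> smooth (f k)"
  shows "dalembertian (\<lambda>z. \<Sum>k\<in>I. b k * f k z) z = (\<Sum>k\<in>I. b k * dalembertian (f k) z)"
proof -
  have cm: "partial i (\<lambda>z. c * h z) = (\<lambda>z. c * partial i h z)" if "smooth h" for i c and h :: "'a
      \<times> real \<Rightarrow> real"
    using that by (intro ext) (simp add: partial_mult smooth_differentiable)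
  have p2: "partial i (partial i (\<lambda>z. \<Sum>k\<in>I. b k * f k z)) z = (\<Sum>k\<in>I. b k * partial i (partial i (f
      k)) z)"
    if i: "i \<in> Basis" for i
  proof -
    have "partial i (\<lambda>z. \<Sum>k\<in>I. b k * f k z) = (\<lambda>z. \<Sum>k\<in>I. b k * partial i (f k) z)"
      by (rule ext) (simp add: partial_sum I f smooth_mult cm)
    then show ?thesis
      by (simp add: partial_sum I f smooth_mult smooth_partial i cm)
  qed
  show ?thesis
    by (simp add: dalembertian_def p2 sum_subtractf[symmetric] right_diff_distrib sum_distrib_left
        sum.swap[of _ I])
qed

section \<open>Functions of time multiplied by functions of the Lorentz form\<close>

definition lorentz :: "real \<Rightarrow> 'a::euclidean_space \<times> real \<Rightarrow> real" where
  "lorentz s z = (snd z + s)\<^sup>2 - (norm (fst z))\<^sup>2"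

lemma lorentz_derivative:
  "(lorentz s has_derivative (\<lambda>h. 2 * (snd z + s) * snd h - 2 * (fst z \<bullet> fst h))) (at z)"
  unfolding lorentz_def power2_norm_eq_inner
  by (auto intro!: derivative_eq_intros simp: inner_commute power2_eq_square algebra_simps)

lemma partial_lorentz:
  "partial (0, 1) (lorentz s) z = 2 * (snd z + s)"
  "partial (i, 0) (lorentz s) z = - 2 * (fst z \<bullet> i)"
  by (simp_all add: partial_eq[OF lorentz_derivative])

lemma smooth_inner_fst: "smooth (\<lambda>z::'a::euclidean_space \<times> real. fst z \<bullet> i)"
  by (intro smooth_linear) (simp add: bounded_linear_fst bounded_linear_inner_left_comp)

lemma smooth_lorentz: "smooth (lorentz s :: 'a::euclidean_space \<times> real \<Rightarrow> real)"
proof -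
  have "smooth (\<lambda>z::'a \<times> real. (snd z + s)^2 - (\<Sum>i\<in>Basis. (fst z \<bullet> i)^2))"
    by (intro smooth_diff smooth_power smooth_add smooth_sum smooth_const smooth_inner_fst)
       (auto intro: smooth_linear bounded_linear_snd)
  moreover have "(norm x)\<^sup>2 = (\<Sum>i\<in>Basis. (x \<bullet> i)\<^sup>2)" for x :: 'a
    by (simp add: norm_eq_sqrt_inner euclidean_inner[of x x] power2_eq_square sum_nonneg)
  ultimately show ?thesis by (simp add: lorentz_def[abs_def])
qed

definition cone_fun ::
  "real \<Rightarrow> (real \<Rightarrow> real) \<Rightarrow> (real \<Rightarrow> real) \<Rightarrow> 'a::euclidean_space \<times> real \<Rightarrow> real" where
  "cone_fun s \<zeta> F z = \<zeta> (snd z) * F (lorentz s z)"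

lemma smooth_cone_fun:
  assumes "smooth \<zeta>" "smooth F" shows "smooth (cone_fun s \<zeta> F)"
  unfolding cone_fun_def[abs_def]
  by (intro smooth_mult smooth_snd_compose[OF assms(1)] smooth_compose[OF assms(2) smooth_lorentz])

lemma partial_time_cone_fun:
  assumes "smooth \<zeta>" "smooth F"
  shows "partial (0, 1) (cone_fun s \<zeta> F) z
    = cone_fun s (partial 1 \<zeta>) F z + cone_fun s (\<lambda>t. 2 * (t + s) * \<zeta> t) (partial 1 F) z"
proof -
  have 1: "partial (0, 1) (\<lambda>z::'a \<times> real. \<zeta> (snd z)) z = partial 1 \<zeta> (snd z)"
    using partial_compose[of snd z \<zeta> "(0,1)"] smooth_differentiable[OF assms(1)]
    by (simp add: partial_eq[OF has_derivative_snd[OF has_derivative_ident]]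
        bounded_linear_imp_differentiable bounded_linear_snd)
  have 2: "partial (0, 1) (\<lambda>z. F (lorentz s z)) z = partial 1 F (lorentz s z) * (2 * (snd z + s))"
    by (simp add: partial_compose smooth_differentiable assms smooth_lorentz partial_lorentz)
  show ?thesis
    unfolding cone_fun_def[abs_def]
    by (subst partial_mult)
       (auto simp: 1 2 algebra_simps intro!: smooth_differentiable smooth_snd_compose[OF assms(1)]
           smooth_compose[OF assms(2) smooth_lorentz])
qed

lemma partial_space_cone_fun:
  assumes "smooth \<zeta>" "smooth F"
  shows "partial (i, 0) (cone_fun s \<zeta> F) z = - 2 * (fst z \<bullet> i) * cone_fun s \<zeta> (partial 1 F) z"
proof -
  have 1: "partial (i, 0) (\<lambda>z::'a \<times> real. \<zeta> (snd z)) z = 0"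
    using partial_compose[of snd z \<zeta> "(i,0)"] smooth_differentiable[OF assms(1)]
    by (simp add: partial_eq[OF has_derivative_snd[OF has_derivative_ident]]
        bounded_linear_imp_differentiable bounded_linear_snd)
  have 2: "partial (i, 0) (\<lambda>z. F (lorentz s z)) z = partial 1 F (lorentz s z) * (- 2 * (fst z \<bullet> i))"
    by (simp add: partial_compose smooth_differentiable assms smooth_lorentz partial_lorentz)
  show ?thesis
    unfolding cone_fun_def[abs_def]
    by (subst partial_mult)
       (auto simp: 1 2 algebra_simps intro!: smooth_differentiable smooth_snd_compose[OF assms(1)]
           smooth_compose[OF assms(2) smooth_lorentz])
qed

lemma smooth_id: "smooth (\<lambda>t::real. t)"
  by (rule smooth_linear) (rule bounded_linear_ident)

lemma partial_real_mult:
  "smooth h \<Longrightarrow> smooth k \<Longrightarrow> partial 1 (\<lambda>t::real. h t * k t) t = h t * partial 1 k t + partial 1 h t * k t"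
  by (intro partial_mult smooth_differentiable)

lemma partial_shift: "partial 1 (\<lambda>t::real. c * (t + s)) t = c"
  by (rule partial_real_eq) (auto intro!: derivative_eq_intros)

text \<open>The second time derivative contributes 4 (t + s)^2 F'', the Laplacian 4 |x|^2 F''; the
  difference is 4 q F'', so x enters through the Lorentz form alone. The first-order terms, 2 F'
  from time and 2 N F' from space, give the factor N + 1.\<close>

lemma dalembertian_cone_fun:
  fixes z :: "'a::euclidean_space \<times> real"
  assumes z: "smooth \<zeta>" and F: "smooth F"
  shows "dalembertian (cone_fun s \<zeta> F) z =
    partial 1 (partial 1 \<zeta>) (snd z) * F (lorentz s z)
    + 4 * (snd z + s) * partial 1 \<zeta> (snd z) * partial 1 F (lorentz s z)
    + \<zeta> (snd z) * (2 * (real DIM('a) + 1) * partial 1 F (lorentz s z)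
        + 4 * lorentz s z * partial 1 (partial 1 F) (lorentz s z))"
proof -
  have z': "smooth (partial 1 \<zeta>)" and F': "smooth (partial 1 F)"
    by (auto intro: smooth_partial z F)
  have lin: "smooth (\<lambda>t. 2 * (t + s))" for s :: real
    by (intro smooth_mult smooth_add smooth_const smooth_id)
  have sz: "smooth (\<lambda>t. 2 * (t + s) * \<zeta> t)" by (intro smooth_mult[OF lin z])
  have tt: "partial (0, 1) (partial (0, 1) (cone_fun s \<zeta> F)) z =
      partial 1 (partial 1 \<zeta>) (snd z) * F (lorentz s z)
      + 4 * (snd z + s) * partial 1 \<zeta> (snd z) * partial 1 F (lorentz s z)
      + \<zeta> (snd z) * (2 * partial 1 F (lorentz s z)
          + 4 * (snd z + s)\<^sup>2 * partial 1 (partial 1 F) (lorentz s z))"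
  proof -
    have "partial (0, 1) (cone_fun s \<zeta> F) = (\<lambda>z::'a \<times> real. cone_fun s (partial 1 \<zeta>) F z
        + cone_fun s (\<lambda>t. 2 * (t + s) * \<zeta> t) (partial 1 F) z)"
      by (rule ext) (rule partial_time_cone_fun[OF z F])
    then have "partial (0, 1) (partial (0, 1) (cone_fun s \<zeta> F)) z =
        partial (0, 1) (cone_fun s (partial 1 \<zeta>) F) z
        + partial (0, 1) (cone_fun s (\<lambda>t. 2 * (t + s) * \<zeta> t) (partial 1 F)) z"
      by (simp only:) (rule partial_add; intro smooth_differentiable smooth_cone_fun z' F sz F')
    then show ?thesis
      by (simp only: partial_time_cone_fun[OF z' F] partial_time_cone_fun[OF sz F'] cone_fun_def
          partial_real_mult[OF lin z] partial_shift)
        (simp add: algebra_simps power2_eq_square)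
  qed
  have xx: "partial (i, 0) (partial (i, 0) (cone_fun s \<zeta> F)) z =
      \<zeta> (snd z) * (- 2 * partial 1 F (lorentz s z)
        + 4 * (fst z \<bullet> i)\<^sup>2 * partial 1 (partial 1 F) (lorentz s z))" if i: "i \<in> Basis" for i
  proof -
    have l: "smooth (\<lambda>z::'a \<times> real. - 2 * (fst z \<bullet> i))"
      by (intro smooth_mult smooth_const smooth_inner_fst)
    have pl: "partial (i, 0) (\<lambda>z::'a \<times> real. - 2 * (fst z \<bullet> i)) z = - 2"
      by (subst partial_eq[of _ "\<lambda>h. - 2 * (fst h \<bullet> i)"])
         (auto intro!: derivative_eq_intros simp: i inner_same_Basis)
    have "partial (i, 0) (cone_fun s \<zeta> F) = (\<lambda>z::'a \<times> real. - 2 * (fst z \<bullet> i) * cone_fun s \<zeta>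
        (partial 1 F) z)"
      by (rule ext) (rule partial_space_cone_fun[OF z F])
    then have "partial (i, 0) (partial (i, 0) (cone_fun s \<zeta> F)) z =
        - 2 * (fst z \<bullet> i) * partial (i, 0) (cone_fun s \<zeta> (partial 1 F)) z +
            - 2 * cone_fun s \<zeta> (partial 1 F) z"
      by (simp only: partial_mult[OF smooth_differentiable[OF l] smooth_differentiable[OF
          smooth_cone_fun[OF z F']]] pl)
    then show ?thesis
      by (simp add: partial_space_cone_fun[OF z F'] cone_fun_def algebra_simps power2_eq_square)
  qed
  have nrm: "(\<Sum>i\<in>Basis. (fst z \<bullet> i)\<^sup>2) = (norm (fst z))\<^sup>2"
    by (simp add: norm_eq_sqrt_inner euclidean_inner[of "fst z" "fst z"] power2_eq_square sum_nonneg)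
  have "(\<Sum>i\<in>Basis. partial (i, 0) (partial (i, 0) (cone_fun s \<zeta> F)) z)
      = (\<Sum>i\<in>(Basis::'a set). \<zeta> (snd z) * (- 2 * partial 1 F (lorentz s z))
        + (\<zeta> (snd z) * (4 * partial 1 (partial 1 F) (lorentz s z))) * (fst z \<bullet> i)\<^sup>2)"
    by (intro sum.cong refl) (simp add: xx algebra_simps)
  also have "\<dots> = real DIM('a) * (\<zeta> (snd z) * (- 2 * partial 1 F (lorentz s z)))
      + (\<zeta> (snd z) * (4 * partial 1 (partial 1 F) (lorentz s z))) * (norm (fst z))\<^sup>2"
    by (simp only: sum.distrib sum_distrib_left[symmetric] nrm sum_constant) (simp add: ac_simps)
  finally show ?thesis
    unfolding dalembertian_def tt by (simp add: lorentz_def algebra_simps)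
qed

text \<open>The last coefficient is 4 m (m + 1) - 2 m (N + 1). It vanishes for m = 0 and m = (N -
  1)/2; for m = (N + 1)/2 it equals 4 m, and then \<zeta> = t + s makes the last two terms cancel.
  These three cases are the three test functions.\<close>

lemma dalembertian_cone_powr:
  fixes z :: "'a::euclidean_space \<times> real"
  assumes z: "smooth \<zeta>" and q: "1 < lorentz s z"
  shows "dalembertian (cone_fun s \<zeta> (spow (- m))) z =
    partial 1 (partial 1 \<zeta>) (snd z) * lorentz s z powr (- m)
    - 4 * m * (snd z + s) * partial 1 \<zeta> (snd z) * lorentz s z powr (- m - 1)
    + 2 * m * (2 * m + 1 - real DIM('a)) * \<zeta> (snd z) * lorentz s z powr (- m - 1)"
proof -
  have "lorentz s z * lorentz s z powr (- m - 2) = lorentz s z powr (- m - 1)"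
  proof -
    have "- m - 1 = 1 + (- m - 2)" by simp
    then show ?thesis using q by (simp only: powr_add) simp
  qed
  then show ?thesis
    using q unfolding dalembertian_cone_fun[OF z smooth_spow]
    by (simp add: spow_eq partial_spow partial_partial_spow mult.assoc mult.left_commute[of
        "lorentz s z"])
       (simp add: algebra_simps)
qed

text \<open>The support ends at 3R/4, strictly before R, and the mirrored second factor makes it
  compact towards negative times as well. The exponent is at least twice the conjugate exponent of
  p.\<close>

definition cutoff :: "real \<Rightarrow> real \<Rightarrow> real \<Rightarrow> real" where
  "cutoff p R t = (step (3 - 4 * (t / R)) * step (3 + 4 * (t / R))) ^ nat \<lceil>2 * p / (p - 1)\<rceil>"

lemma smooth_cutoff: "smooth (cutoff p R)"
  unfolding cutoff_def[abs_def] divide_inverse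
  by (intro smooth_power smooth_mult smooth_compose[OF smooth_step] smooth_diff smooth_add
      smooth_const smooth_id)

lemma cutoff_bounds: "0 \<le> cutoff p R t" "cutoff p R t \<le> 1"
  unfolding cutoff_def
  by (auto intro!: power_le_one mult_le_one zero_le_power mult_nonneg_nonneg step_nonneg step_le_1)

lemma cutoff_eq_1:
  assumes "0 < R" "\<bar>t\<bar> \<le> R / 2" shows "cutoff p R t = 1"
proof -
  have "t / R \<le> 1 / 2" "- 1 / 2 \<le> t / R" using assms by (auto simp: field_simps abs_le_iff)
  then show ?thesis by (simp add: cutoff_def step_1)
qed

lemma cutoff_exponent: "1 < p \<Longrightarrow> 2 * p / (p - 1) \<le> real (nat \<lceil>2 * p / (p - 1)\<rceil>)"
  "1 < p \<Longrightarrow> 2 < nat \<lceil>2 * p / (p - 1)\<rceil>"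
proof -
  assume p: "1 < p"
  show "2 * p / (p - 1) \<le> real (nat \<lceil>2 * p / (p - 1)\<rceil>)" by (rule real_nat_ceiling_ge)
  moreover have "2 < 2 * p / (p - 1)" using p by (simp add: field_simps)
  ultimately show "2 < nat \<lceil>2 * p / (p - 1)\<rceil>" by linarith
qed

lemma cutoff_eq_0:
  assumes "1 < p" "0 < R" "3 * R / 4 \<le> \<bar>t\<bar>" shows "cutoff p R t = 0"
proof -
  have "3 / 4 \<le> t / R \<or> t / R \<le> - 3 / 4" using assms by (auto simp: field_simps abs_if split: if_splits)
  then have "3 - 4 * (t / R) \<le> 0 \<or> 3 + 4 * (t / R) \<le> 0" by linarith
  then have e0: "step (3 - 4 * (t / R)) * step (3 + 4 * (t / R)) = 0"
    by (elim disjE) (simp_all only: step_0 mult_zero_left mult_zero_right)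
  have "0 < nat \<lceil>2 * p / (p - 1)\<rceil>" using cutoff_exponent(2)[OF assms(1)] by linarith
  then show ?thesis unfolding cutoff_def e0 by (rule zero_power)
qed

lemma cutoff_derivatives_0:
  assumes "0 < R" "\<bar>t\<bar> < R / 2"
  shows "partial 1 (cutoff p R) t = 0" "partial 1 (partial 1 (cutoff p R)) t = 0"
proof -
  have 1: "partial 1 (cutoff p R) t = 0" if "t \<in> {- R / 2<..<R / 2}" for t
  proof -
    have "partial 1 (cutoff p R) t = partial 1 (\<lambda>_. 1) t"
      by (rule partial_transform[of "{- R / 2<..<R / 2}"]) (use that assms(1) in \<open>auto intro!:
          cutoff_eq_1\<close>)
    then show ?thesis by simp
  qed
  show "partial 1 (cutoff p R) t = 0" by (rule 1) (use assms in auto)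
  show "partial 1 (partial 1 (cutoff p R)) t = 0"
    by (rule partial_zero_open[of "{- R / 2<..<R / 2}"]) (use 1 assms in auto)
qed

text \<open>The exponent in the definition of \<open>cutoff\<close> is what makes a power \<open>1 / p\<close> of the cutoff
  survive two differentiations.\<close>

lemma cutoff_derivatives_bound:
  assumes p: "1 < p"
  obtains C where "0 < C"
    "\<And>R t. 0 < R \<Longrightarrow> \<bar>partial 1 (cutoff p R) t\<bar> \<le> C / R * cutoff p R t powr (1 / p)"
    "\<And>R t. 0 < R \<Longrightarrow> \<bar>partial 1 (partial 1 (cutoff p R)) t\<bar> \<le> C / R\<^sup>2 * cutoff p R t powr (1 / p)"
proof -
  define n where "n = nat \<lceil>2 * p / (p - 1)\<rceil>"
  have n: "2 * p / (p - 1) \<le> real n" "2 < n" using cutoff_exponent[OF p] by (simp_all add: n_def)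
  define e where "e x = step (3 - 4 * x) * step (3 + 4 * x)" for x :: real
  have se: "smooth e" unfolding e_def
    by (intro smooth_mult smooth_compose[OF smooth_step] smooth_diff smooth_add smooth_const smooth_id)
  have se1: "smooth (partial 1 e)" by (intro smooth_partial se) simp
  have se2: "smooth (partial 1 (partial 1 e))" by (intro smooth_partial se1) simp
  have e0: "e x = 0" if "x \<in> - {- 1..1}" for x
    using that by (auto simp: e_def step_0)
  have e1: "partial 1 e x = 0" if "x \<in> - {- 1..1}" for x
    by (rule partial_zero_open[of "- {- 1..1}"]) (use that e0 in auto)
  have e2: "partial 1 (partial 1 e) x = 0" if "x \<in> - {- 1..1}" for x
    by (rule partial_zero_open[of "- {- 1..1}"]) (use that e1 in auto)
  have eb: "0 \<le> e x" "e x \<le> 1" for x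
    by (auto simp: e_def intro!: mult_le_one mult_nonneg_nonneg step_nonneg step_le_1)
  have bound: "\<exists>M\<ge>0. \<forall>x. \<bar>h x\<bar> \<le> M"
    if h: "smooth h" "\<And>x. x \<in> - {- 1..1} \<Longrightarrow> h x = 0" for h :: "real \<Rightarrow> real"
  proof -
    have "bounded (h ` {- 1..1})"
      by (intro compact_imp_bounded compact_continuous_image smooth_continuous h) simp
    then obtain M where M: "\<forall>y\<in>h ` {- 1..1}. norm y \<le> M" unfolding bounded_iff by blast
    then have "\<bar>h x\<bar> \<le> max M 0" for x
    proof (cases "x \<in> {- 1..1}")
      case True
      with M have "norm (h x) \<le> M" by blast
      then show ?thesis by simp
    qed (use h(2) in simp)
    then show ?thesis by (intro exI[of _ "max M 0"]) auto
  qed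
  obtain M1 where M1: "0 \<le> M1" "\<And>x. \<bar>partial 1 e x\<bar> \<le> M1" using bound[OF se1 e1] by blast
  obtain M2 where M2: "0 \<le> M2" "\<And>x. \<bar>partial 1 (partial 1 e) x\<bar> \<le> M2" using bound[OF se2 e2] by blast
  have pw: "e x ^ k \<le> (e x ^ n) powr (1 / p)" if k: "n - 2 \<le> k" for x k
  proof (cases "e x = 0")
    case True
    have "0 < k" using k n by linarith
    then show ?thesis by (simp add: True zero_power)
  next
    case False
    then have ex: "0 < e x" using eb(1)[of x] by simp
    \<comment> \<open>Equivalent to \<open>2 * p / (p - 1) \<le> real n\<close>: two derivatives use
      up two factors e, and the remaining n - 2 are still bounded by the power 1/p of the cutoff, as
      e \<le> 1.\<close>
    have "real n / p \<le> real (n - 2)"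
      using n p by (simp add: of_nat_diff field_simps)
    also have "\<dots> \<le> real k" using k by simp
    finally have "e x powr real k \<le> e x powr (real n / p)"
      using ex eb(2)[of x] by (intro powr_mono') auto
    then show ?thesis using ex by (simp add: powr_realpow[symmetric] powr_powr)
  qed
  define h1 where "h1 x = real n * e x ^ (n - 1) * partial 1 e x" for x
  define h2 where "h2 x = real n * (real (n - 1) * e x ^ (n - 2) * partial 1 e x * partial 1 e x
    + e x ^ (n - 1) * partial 1 (partial 1 e) x)" for x
  have d1: "((\<lambda>x. e x ^ n) has_real_derivative h1 x) (at x)" for x
    using DERIV_power[OF smooth_has_real_derivative[OF se, of x], of n] by (simp add: h1_def mult_ac)
  have d2: "(h1 has_real_derivative h2 x) (at x)" for x
    unfolding h1_def h2_def
    using DERIV_cmult[OF DERIV_mult[OF DERIV_power[OF smooth_has_real_derivative[OF se, of x], of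
        "n - 1"]
        smooth_has_real_derivative[OF se1, of x]], of "real n"]
    by (simp add: mult_ac numeral_2_eq_2 diff_diff_left)
  have cut: "cutoff p R = (\<lambda>t. e (t / R) ^ n)" for R
    by (simp add: cutoff_def e_def n_def fun_eq_iff)
  have c1: "partial 1 (cutoff p R) = (\<lambda>t. h1 (t / R) / R)" if "0 < R" for R
  proof
    fix t
    show "partial 1 (cutoff p R) t = h1 (t / R) / R"
      unfolding cut using that
      by (intro partial_real_eq DERIV_chain2[OF d1, of "\<lambda>t. t / R", THEN DERIV_cong])
         (auto intro!: derivative_eq_intros)
  qed
  have c2: "partial 1 (partial 1 (cutoff p R)) t = h2 (t / R) / R\<^sup>2" if "0 < R" for R t
    unfolding c1[OF that] using that
    by (intro partial_real_eq DERIV_cdivide[OF DERIV_chain2[OF d2, of "\<lambda>t. t / R"], THEN DERIV_cong])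
       (auto intro!: derivative_eq_intros simp: power2_eq_square)
  define C where "C = real n * (real n * M1 * M1 + M1 + M2) + 1"
  have C: "0 < C" using M1(1) M2(1) by (simp add: C_def add_nonneg_pos)
  have b1: "\<bar>h1 x\<bar> \<le> C * (e x ^ n) powr (1 / p)" for x
  proof -
    have "\<bar>h1 x\<bar> = real n * e x ^ (n - 1) * \<bar>partial 1 e x\<bar>"
      using eb by (simp add: h1_def abs_mult)
    also have "\<dots> \<le> real n * (e x ^ n) powr (1 / p) * M1"
      by (intro mult_mono mult_left_mono pw M1) (use eb in auto)
    also have "\<dots> = (real n * M1) * (e x ^ n) powr (1 / p)" by simp
    also have "\<dots> \<le> C * (e x ^ n) powr (1 / p)"
      using M1(1) M2(1) by (intro mult_right_mono) (auto simp: C_def algebra_simps)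
    finally show ?thesis .
  qed
  have b2: "\<bar>h2 x\<bar> \<le> C * (e x ^ n) powr (1 / p)" for x
  proof -
    let ?w = "(e x ^ n) powr (1 / p)"
    have "\<bar>h2 x\<bar> \<le> real n * (real (n - 1) * e x ^ (n - 2) * \<bar>partial 1 e x\<bar> * \<bar>partial 1 e x\<bar>
        + e x ^ (n - 1) * \<bar>partial 1 (partial 1 e) x\<bar>)"
      using eb unfolding h2_def abs_mult
      by (intro mult_mono order_trans[OF abs_triangle_ineq] add_mono) (auto simp: abs_mult)
    also have "\<dots> \<le> real n * (real n * ?w * M1 * M1 + ?w * M2)"
      using M1 M2 eb by (intro mult_left_mono add_mono mult_mono pw mult_nonneg_nonneg) auto
    also have "\<dots> = (real n * (real n * M1 * M1 + M2)) * ?w" by (simp add: algebra_simps)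
    also have "\<dots> \<le> C * ?w"
      using M1(1) M2(1) by (intro mult_right_mono) (auto simp: C_def algebra_simps)
    finally show ?thesis .
  qed
  show thesis
  proof (rule that[OF C])
    fix R t :: real assume R: "0 < R"
    show "\<bar>partial 1 (cutoff p R) t\<bar> \<le> C / R * cutoff p R t powr (1 / p)"
      unfolding c1[OF R] using b1[of "t / R"] R by (simp add: cut divide_right_mono)
    show "\<bar>partial 1 (partial 1 (cutoff p R)) t\<bar> \<le> C / R\<^sup>2 * cutoff p R t powr (1 / p)"
      unfolding c2[OF R] using b2[of "t / R"] R by (simp add: cut divide_right_mono)
  qed
qed

section \<open>Elementary estimates\<close>

text \<open>Below the threshold y = \<open>\<theta> * K powr (1 / (p - 1))\<close> the second term
  alone suffices, above it the first. The parameter \<theta> stays free, to be fixed for an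
  absorption or optimised.\<close>

lemma young_parametric:
  fixes y K \<theta> p :: real
  assumes "0 \<le> y" "0 \<le> K" "0 < \<theta>" "1 < p"
  shows "y * K \<le> \<theta> powr (1 - p) * y powr p + \<theta> * K powr (p / (p - 1))"
proof (cases "y \<le> \<theta> * K powr (1 / (p - 1))")
  case True
  have e: "p / (p - 1) = 1 / (p - 1) + 1" using assms by (simp add: field_simps)
  have "y * K \<le> \<theta> * K powr (1 / (p - 1)) * K" using True assms by (intro mult_right_mono) auto
  also have "\<dots> = \<theta> * K powr (p / (p - 1))"
    using assms(2) by (cases "K = 0") (simp_all add: e powr_add)
  finally show ?thesis by (simp add: add_increasing)
next
  case False
  then have y: "0 < y" using assms by (smt (verit, best) mult_nonneg_nonneg powr_ge_zero)
  have "K \<le> (y / \<theta>) powr (p - 1)"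
  proof (cases "K = 0")
    case False
    then have K: "0 < K" using assms by simp
    have "K powr (1 / (p - 1)) \<le> y / \<theta>" using \<open>\<not> y \<le> _\<close> assms by (simp add: field_simps)
    then have "(K powr (1 / (p - 1))) powr (p - 1) \<le> (y / \<theta>) powr (p - 1)"
      using assms by (intro powr_mono2) auto
    then show ?thesis using K assms by (simp add: powr_powr)
  qed simp
  then have "y * K \<le> y * (y / \<theta>) powr (p - 1)" using y by simp
  also have "\<dots> = \<theta> powr (1 - p) * y powr p"
    using y assms by (simp add: powr_divide powr_diff field_simps)
  finally show ?thesis using assms by (simp add: add_increasing2)
qed

text \<open>Recovers the form of Hoelder's inequality from the whole family of Young inequalities:
  \<theta> = X/(2B) makes the B-term half of X, which is absorbed on the left.\<close>

lemma young_optimise: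
  fixes X A B p :: real
  assumes "\<And>\<theta>. 0 < \<theta> \<Longrightarrow> X \<le> \<theta> powr (1 - p) * A + \<theta> * B" "0 < X" "0 < B" "1 < p"
  shows "X powr p \<le> 2 powr p * B powr (p - 1) * A"
proof -
  define \<theta> where "\<theta> = X / (2 * B)"
  have \<theta>: "0 < \<theta>" using assms by (simp add: \<theta>_def)
  have "\<theta> * B = X / 2" using assms by (simp add: \<theta>_def)
  with assms(1)[OF \<theta>] have "X / 2 \<le> \<theta> powr (1 - p) * A" by simp
  then have "\<theta> powr (p - 1) * (X / 2) \<le> \<theta> powr (p - 1) * (\<theta> powr (1 - p) * A)"
    by (intro mult_left_mono) auto
  also have "\<dots> = A" using \<theta> by (simp add: mult.assoc[symmetric] powr_add[symmetric])
  finally have A: "\<theta> powr (p - 1) * (X / 2) \<le> A" .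
  have "X powr p = (X powr (p - 1)) * X" using assms powr_add[of X "p - 1" 1] by simp
  also have "X powr (p - 1) = (2 * B) powr (p - 1) * \<theta> powr (p - 1)"
    using assms by (simp add: \<theta>_def powr_mult[symmetric])
  also have "(2 * B) powr (p - 1) * \<theta> powr (p - 1) * X = 2 * (2 * B) powr (p - 1) * (\<theta> powr (p
      - 1) * (X / 2))"
    by simp
  also have "\<dots> \<le> 2 * (2 * B) powr (p - 1) * A" using A by (intro mult_left_mono) auto
  also have "2 * (2 * B) powr (p - 1) = 2 powr p * B powr (p - 1)"
    using assms powr_add[of 2 "p - 1" 1] by (simp add: powr_mult)
  finally show ?thesis .
qed

section \<open>Integrals of powers of the distance to the light cone\<close>

lemma power_diff_le:
  fixes a b :: real
  assumes "0 \<le> b" "b \<le> a" shows "a ^ n - b ^ n \<le> real n * (a - b) * a ^ (n - 1)"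
proof (induction n)
  case (Suc n)
  have "a ^ Suc n - b ^ Suc n = a * (a ^ n - b ^ n) + (a - b) * b ^ n" by (simp add: algebra_simps)
  also have "\<dots> \<le> a * (real n * (a - b) * a ^ (n - 1)) + (a - b) * a ^ n"
    using assms Suc by (intro add_mono mult_left_mono power_mono) auto
  also have "\<dots> = real (Suc n) * (a - b) * a ^ (Suc n - 1)"
    by (cases n) (simp_all add: algebra_simps)
  finally show ?case .
qed simp

lemma shell_measure:
  fixes L \<delta> :: real
  assumes "0 < \<delta>" "0 < L"
  defines "S \<equiv> {x::'a::euclidean_space. L - 2 * \<delta> \<le> norm x \<and> norm x \<le> L - \<delta>}"
  shows "S \<in> lmeasurable"
    "measure lebesgue S \<le> (unit_ball_vol (real DIM('a)) * real DIM('a)) * \<delta> * L ^ (DIM('a) - 1)"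
proof -
  have "S = cball 0 (L - \<delta>) - ball 0 (L - 2 * \<delta>)" by (auto simp: S_def)
  then show lm: "S \<in> lmeasurable" by (simp add: fmeasurable.Diff)
  show "measure lebesgue S \<le> (unit_ball_vol (real DIM('a)) * real DIM('a)) * \<delta> * L ^ (DIM('a) - 1)"
  proof (cases "L - \<delta> < 0")
    case True
    have "norm x \<le> L - \<delta> \<Longrightarrow> False" for x :: 'a using True norm_ge_zero[of x] by linarith
    then have "S = {}" by (auto simp: S_def)
    then show ?thesis using assms(1,2) by (simp add: unit_ball_vol_nonneg)
  next
    case False
    \<comment> \<open>The inner radius is clipped at 0: for L \<le> 2 \<delta> the shell is a full
      ball.\<close>
    define b where "b = max 0 (L - 2 * \<delta>)"
    have b: "0 \<le> b" "b \<le> L - \<delta>" "L - \<delta> - b \<le> \<delta>" using False assms by (auto simp: b_def)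
    have "S = cball 0 (L - \<delta>) - ball 0 b"
      by (auto simp: S_def b_def max_def not_less not_le intro: order_trans[OF _ norm_ge_zero])
    then have "measure lebesgue S = measure lebesgue (cball (0::'a) (L - \<delta>))
        - measure lebesgue (ball (0::'a) b)"
      using b by (simp add: measurable_measure_Diff ball_subset_cball subset_trans[OF
          ball_subset_cball subset_cball])
    also have "\<dots> = unit_ball_vol (real DIM('a)) * ((L - \<delta>) ^ DIM('a) - b ^ DIM('a))"
      using b by (simp add: content_cball content_ball algebra_simps)
    also have "\<dots> \<le> unit_ball_vol (real DIM('a)) * (real DIM('a) * (L - \<delta> - b) * (L - \<delta>) ^ (DIM('a) - 1))"
      by (intro mult_left_mono power_diff_le b) (simp add: unit_ball_vol_nonneg)
    also have "\<dots> \<le> unit_ball_vol (real DIM('a)) * (real DIM('a) * \<delta> * L ^ (DIM('a) - 1))"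
      using b False assms by (intro mult_left_mono mult_mono power_mono) (auto simp:
          unit_ball_vol_nonneg)
    finally show ?thesis by (simp add: mult.assoc)
  qed
qed

lemma dyadic_index:
  fixes d :: real
  assumes "1 \<le> d" obtains l :: nat where "2 ^ l \<le> d" "d < 2 ^ Suc l"
proof -
  obtain n :: nat where n: "d < 2 ^ n" using real_arch_pow[of 2 d] by auto
  define m where "m = (LEAST n. d < 2 ^ n)"
  have m: "d < 2 ^ m" unfolding m_def by (rule LeastI[of "\<lambda>n. d < 2 ^ n", OF n])
  have "m \<noteq> 0"
  proof
    assume "m = 0" then show False using m assms by simp
  qed
  then obtain l where l: "m = Suc l" by (cases m) auto
  have "\<not> d < 2 ^ l" using not_less_Least[of l "\<lambda>n. d < 2 ^ n"] l by (simp add: m_def)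
  then show thesis using that[of l] m l by simp
qed

text \<open>The shell at distance between 2^k and 2^(k + 1) from the sphere of radius L has volume
  at most a constant times \<open>2 ^ k * L ^ (N - 1)\<close>, and the integrand there is at most
  \<open>(2 ^ k) powr (- \<gamma>)\<close>. The sum is left unevaluated because both regimes occur:
  it is geometric for \<gamma> > 1 and counts its terms for \<gamma> = 1.\<close>

lemma integral_dist_cone:
  fixes L \<gamma> :: real
  assumes L: "1 \<le> L" "L < 2 ^ Suc j" and \<gamma>: "0 \<le> \<gamma>"
  defines "h \<equiv> \<lambda>x::'a::euclidean_space. indicator (cball 0 (L - 1)) x * (L - norm x) powr (- \<gamma>)"
  shows "integrable lebesgue h"
    "(\<integral>x. h x \<partial>lebesgue) \<le> (unit_ball_vol (real DIM('a)) * real DIM('a)) * L ^ (DIM('a) - 1)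
       * (\<Sum>k\<le>j. (2 ^ k) powr (1 - \<gamma>))"
proof -
  define S where "S k = {x::'a. L - 2 * 2 ^ k \<le> norm x \<and> norm x \<le> L - 2 ^ k}" for k :: nat
  have S: "S k \<in> lmeasurable"
    "measure lebesgue (S k) \<le> (unit_ball_vol (real DIM('a)) * real DIM('a)) * 2 ^ k * L ^ (DIM('a)
        - 1)" for k
    using shell_measure[of "2 ^ k" L, where 'a = 'a] L by (simp_all add: S_def)
  have iS: "integrable lebesgue (indicator (S k) :: 'a \<Rightarrow> real)" for k
    using S(1)[of k] by (intro integrable_real_indicator) (auto simp only: fmeasurable_def
        mem_Collect_eq)
  define H where "H x = (\<Sum>k\<le>j. (2 ^ k) powr (- \<gamma>) * indicator (S k) x)" for x
  have iH: "integrable lebesgue H"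
    unfolding H_def by (intro Bochner_Integration.integrable_sum integrable_mult_right iS)
  have hH: "0 \<le> h x" "h x \<le> H x" for x
  proof -
    show "0 \<le> h x" by (simp add: h_def)
    show "h x \<le> H x"
    proof (cases "norm x \<le> L - 1")
      case True
      define d where "d = L - norm x"
      have d: "1 \<le> d" "d \<le> L" using True by (auto simp: d_def)
      then obtain l where l: "2 ^ l \<le> d" "d < 2 ^ Suc l" using dyadic_index by blast
      have "(2::real) ^ l < 2 ^ Suc j" using l d L by linarith
      then have lj: "l \<le> j" by (simp add: power_strict_increasing_iff del: power_Suc)
      have "h x = d powr (- \<gamma>)" using True by (simp add: h_def d_def)
      also have "\<dots> \<le> (2 ^ l) powr (- \<gamma>)" using l(1) \<gamma> by (intro powr_mono2') auto
      also have "\<dots> = (2 ^ l) powr (- \<gamma>) * indicator (S l) x"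
        using l by (simp add: S_def d_def)
      also have "\<dots> \<le> H x"
        unfolding H_def using lj by (intro member_le_sum) auto
      finally show ?thesis .
    qed (auto simp: h_def H_def intro!: sum_nonneg)
  qed
  have "h \<in> borel_measurable borel"
    unfolding h_def
    by (intro borel_measurable_times borel_measurable_indicator powr_real_measurable
        borel_measurable_diff borel_measurable_const borel_measurable_norm) auto
  then have mh: "h \<in> borel_measurable lebesgue" by (simp add: measurable_completion)
  show ih: "integrable lebesgue h"
    by (rule Bochner_Integration.integrable_bound[OF iH mh])
       (use hH order_trans[OF hH] in \<open>auto intro!: AE_I2\<close>)
  have "(\<integral>x. h x \<partial>lebesgue) \<le> (\<integral>x. H x \<partial>lebesgue)"
    by (rule Bochner_Integration.integral_mono[OF ih iH hH(2)])
  also have "\<dots> = (\<Sum>k\<le>j. (2 ^ k) powr (- \<gamma>) * measure lebesgue (S k))"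
    unfolding H_def
    by (subst Bochner_Integration.integral_sum) (intro integrable_mult_right iS, simp)
  also have "\<dots> \<le> (\<Sum>k\<le>j. (2 ^ k) powr (- \<gamma>) * ((unit_ball_vol (real DIM('a)) * real DIM('a)) * 2 ^
      k * L ^ (DIM('a) - 1)))"
    by (intro sum_mono mult_left_mono S) auto
  also have "\<dots> = (unit_ball_vol (real DIM('a)) * real DIM('a)) * L ^ (DIM('a) - 1) *
      (\<Sum>k\<le>j. (2 ^ k) powr (1 - \<gamma>))"
  proof -
    have "(2 ^ k) powr (1 - \<gamma>) = (2 ^ k) powr (- \<gamma>) * 2 ^ k" for k :: nat
      using powr_add[of "2 ^ k" "- \<gamma>" 1] by simp
    then show ?thesis by (simp add: sum_distrib_left mult_ac)
  qed
  finally show "(\<integral>x. h x \<partial>lebesgue) \<le> (unit_ball_vol (real DIM('a)) * real DIM('a)) * L ^ (DIM('a) - 1)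
       * (\<Sum>k\<le>j. (2 ^ k) powr (1 - \<gamma>))" .
qed

lemma geometric_sum_le:
  fixes x :: real assumes "0 \<le> x" "x < 1" shows "(\<Sum>k<n. x ^ k) \<le> 1 / (1 - x)"
proof -
  have "(1 - x) * (\<Sum>k<n. x ^ k) \<le> 1"
    using one_diff_power_eq[of x n] zero_le_power[OF assms(1), of n] by linarith
  then show ?thesis using assms by (simp add: pos_le_divide_eq mult.commute)
qed

lemma dyadic_powr: "(2 ^ k) powr a = (2 powr a) ^ k" for a :: real
  by (simp add: powr_powr powr_realpow[symmetric] mult.commute)

text \<open>The terms grow like 2^(k A) while 2^k \<le> d and decay like 2^(- k B) afterwards, so
  the sum is controlled by its peak \<open>d powr (- B)\<close>. Both sides of the peak are
  geometric, whence a bound uniform in j.\<close>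

lemma dyadic_sum_max:
  fixes d A B :: real
  assumes d: "1 \<le> d" and A: "0 < A" and B: "0 < B"
  shows "(\<Sum>k\<le>j. (2 ^ k) powr A * max d (2 ^ k) powr (- (A + B)))
    \<le> (1 / (1 - 2 powr (- A)) + 1 / (1 - 2 powr (- B))) * d powr (- B)"
proof -
  obtain l where l: "2 ^ l \<le> d" "d < 2 ^ Suc l" using dyadic_index[OF d] by blast
  let ?t = "\<lambda>k. (2 ^ k) powr A * max d (2 ^ k) powr (- (A + B))"
  have AB: "0 < 2 powr (- A)" "2 powr (- A) < 1" "0 < 2 powr (- B)" "2 powr (- B) < (1::real)"
    using A B by (auto simp: powr_less_one)
  have nn: "0 \<le> ?t k" for k by simp
  have low: "?t k \<le> d powr (- B) * (2 powr (- A)) ^ (l - k)" if "k \<le> l" for k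
  proof -
    have kd: "(2::real) ^ k \<le> d" using l(1) power_increasing[OF that, of "2::real"] by linarith
    have "(2 ^ k) powr A = (2 ^ l) powr A * (2 powr (- A)) ^ (l - k)"
    proof -
      have "(2 ^ l :: real) = 2 ^ k * 2 ^ (l - k)" using that by (simp add: power_add[symmetric])
      then have "(2 ^ l) powr A = (2 ^ k) powr A * (2 ^ (l - k)) powr A" by (simp add: powr_mult)
      then show ?thesis by (simp add: dyadic_powr powr_minus power_inverse)
    qed
    also have "\<dots> \<le> d powr A * (2 powr (- A)) ^ (l - k)"
      using l(1) A by (intro mult_right_mono powr_mono2) auto
    finally have "?t k \<le> d powr A * (2 powr (- A)) ^ (l - k) * d powr (- (A + B))"
      using kd by (intro mult_mono) (auto simp: max_def)
    also have "\<dots> = d powr (- B) * (2 powr (- A)) ^ (l - k)"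
      using d by (simp add: powr_add[symmetric] mult_ac)
    finally show ?thesis .
  qed
  have high: "?t k \<le> d powr (- B) * (2 powr (- B)) ^ (k - Suc l)" if "Suc l \<le> k" for k
  proof -
    have kd: "d \<le> (2::real) ^ k" using l(2) power_increasing[OF that, of "2::real"] by linarith
    then have "?t k = (2 ^ k) powr (- B)" by (simp add: max_def powr_add[symmetric])
    also have "\<dots> = (2 ^ Suc l * 2 ^ (k - Suc l)) powr (- B)"
      using that by (simp add: power_add[symmetric] del: power_Suc)
    also have "\<dots> = (2 ^ Suc l) powr (- B) * (2 powr (- B)) ^ (k - Suc l)"
      by (simp add: powr_mult dyadic_powr del: power_Suc)
    also have "\<dots> \<le> d powr (- B) * (2 powr (- B)) ^ (k - Suc l)"
      using l(2) d B by (intro mult_right_mono powr_mono2') auto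
    finally show ?thesis .
  qed
  have "(\<Sum>k\<le>j. ?t k) \<le> (\<Sum>k\<in>{..l} \<union> {Suc l..l + Suc j}. ?t k)"
    by (intro sum_mono2) (auto intro: nn)
  also have "\<dots> = (\<Sum>k\<le>l. ?t k) + (\<Sum>k\<in>{Suc l..l + Suc j}. ?t k)"
    by (intro sum.union_disjoint) auto
  also have "(\<Sum>k\<le>l. ?t k) \<le> (\<Sum>k\<le>l. d powr (- B) * (2 powr (- A)) ^ (l - k))"
    by (intro sum_mono low) auto
  also have "\<dots> = d powr (- B) * (\<Sum>k<Suc l. (2 powr (- A)) ^ k)"
    unfolding sum_distrib_left[symmetric] lessThan_Suc_atMost
    by (subst sum.atLeastAtMost_rev[of _ 0 l, unfolded atLeast0AtMost]) simp
  also have "\<dots> \<le> d powr (- B) * (1 / (1 - 2 powr (- A)))"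
    using AB by (intro mult_left_mono geometric_sum_le) auto
  also have "(\<Sum>k\<in>{Suc l..l + Suc j}. ?t k) \<le> (\<Sum>k\<in>{Suc l..l
      + Suc j}. d powr (- B) * (2 powr (- B)) ^ (k - Suc l))"
    by (intro sum_mono high) auto
  also have "\<dots> = d powr (- B) * (\<Sum>k<Suc j. (2 powr (- B)) ^ k)"
    unfolding sum_distrib_left[symmetric]
    by (rule arg_cong[of _ _ "\<lambda>x. _ * x"], rule sum.reindex_bij_witness[of _ "\<lambda>k. k
        + Suc l" "\<lambda>k. k - Suc l"]) auto
  also have "\<dots> \<le> d powr (- B) * (1 / (1 - 2 powr (- B)))"
    using AB by (intro mult_left_mono geometric_sum_le) auto
  finally show ?thesis by (simp add: algebra_simps)
qed

lemma lifespan_from_powr_bound: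
  fixes T :: ereal and C e :: real
  assumes "0 < T" "0 < C" "0 < e" "0 < \<epsilon>" "\<epsilon> \<le> 1" "0 < R0"
    and "\<And>R. R0 \<le> R \<Longrightarrow> ereal R < T \<Longrightarrow> \<epsilon> \<le> C * R powr (- e)"
  shows "T \<le> ereal ((C powr (1 / e) + R0) * \<epsilon> powr (- (1 / e)))"
proof (rule ccontr)
  \<comment> \<open>Adding R0 serves twice: together with \<epsilon> \<le> 1 it puts
    \<open>?R\<close> above R0, and it makes \<open>?R\<close> strictly larger than the value at
    which the assumed bound is an equality.\<close>
  let ?R = "(C powr (1 / e) + R0) * \<epsilon> powr (- (1 / e))"
  assume "\<not> T \<le> ereal ?R"
  then have RT: "ereal ?R < T" by simp
  have e1: "1 \<le> \<epsilon> powr (- (1 / e))"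
    using assms powr_mono2'[of "- (1 / e)" \<epsilon> 1] by simp
  have "R0 * 1 \<le> (C powr (1 / e) + R0) * \<epsilon> powr (- (1 / e))"
    using e1 assms by (intro mult_mono) auto
  then have "\<epsilon> \<le> C * ?R powr (- e)" using assms(7)[OF _ RT] by simp
  also have "\<dots> < C * (C powr (1 / e) * \<epsilon> powr (- (1 / e))) powr (- e)"
    using assms by (intro mult_strict_left_mono powr_less_mono2_neg mult_strict_right_mono) auto
  also have "(C powr (1 / e) * \<epsilon> powr (- (1 / e))) powr (- e) = (1 / C) * \<epsilon>"
  proof -
    have "(C powr (1 / e)) powr (- e) = 1 / C" "(\<epsilon> powr (- (1 / e))) powr (- e) = \<epsilon>"
      using assms by (simp_all only: powr_powr) (simp_all add: powr_minus_divide)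
    then show ?thesis by (simp only: powr_mult powr_ge_zero)
  qed
  finally show False using assms by simp
qed

text \<open>Discrete analogue of A' \<ge> A^p / j^(p - 1). By \<open>inc\<close>, A is at least a
  multiple of \<delta> n at j = n/2. From there on j \<le> n, so \<open>A j powr (1 - p)\<close>
  drops by a multiple of \<open>n powr (1 - p)\<close> in each of about n/2 steps while staying
  nonnegative. Hence, up to constants,
  \<open>n * n powr (1 - p) \<le> (\<delta> * n) powr (1 - p)\<close>, and the powers of n cancel
  except for the first. The bound \<open>up\<close> keeps relative increments bounded, as the
  passage from increments of A to those of the power requires.\<close>

lemma discrete_blow_up:
  fixes A :: "nat \<Rightarrow> real" and p C \<delta> :: real
  assumes p: "1 < p" and C: "1 \<le> C" and \<delta>: "0 < \<delta>" "\<delta> \<le> 1" and m: "1 \<le> m"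
    and inc: "\<And>j. m < j \<Longrightarrow> j \<le> n \<Longrightarrow> A (j - 1) + \<delta> / C \<le> A j"
    and sup: "\<And>j. m < j \<Longrightarrow> j \<le> n \<Longrightarrow> A (j - 1) powr p \<le> C * real j powr (p - 1) * (A j - A (j - 1))"
    and up: "\<And>j. m < j \<Longrightarrow> j \<le> n \<Longrightarrow> A (j - 1) \<le> C * real j"
    and pos: "0 \<le> A m"
  shows "real n \<le> (4 * real m + 4 + 2 * (1 + C powr p) powr p * C / (p - 1) * (4 * C) powr (p
      - 1)) * \<delta> powr (1 - p)"
    (is "_ \<le> ?K * _")
proof (cases "n \<le> 4 * m + 4")
  case True
  have "1 \<le> \<delta> powr (1 - p)" using \<delta> p powr_mono2'[of "1 - p" \<delta> 1] by simp
  moreover have "real n \<le> ?K"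
  proof -
    have "real n \<le> 4 * real m + 4" using True by linarith
    moreover have "0 \<le> 2 * (1 + C powr p) powr p * C / (p - 1) * (4 * C) powr (p - 1)" using C p by auto
    ultimately show ?thesis by linarith
  qed
  ultimately show ?thesis
    using mult_mono[of "real n" ?K 1 "\<delta> powr (1 - p)"] by simp
next
  case False
  \<comment> \<open>Half of the steps are kept for the descent, while n > 4 m + 4 leaves at least
    n/4 steps of linear growth between m and J.\<close>
  define J where "J = n div 2"
  have J: "2 * m \<le> J" "m < J" "J < n" "real n / 2 - 1 \<le> real J" "real n \<le> 4 * real (J - m)"
    "real n / 2 \<le> real (n - J)"
    using False m by (auto simp: J_def of_nat_diff field_simps)
  have lin: "\<delta> / C * real (j - m) \<le> A j" if "m \<le> j" "j \<le> n" for j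
    using that
  proof (induction j rule: dec_induct)
    case (step j)
    then show ?case using inc[of "Suc j"] by (simp add: Suc_diff_le algebra_simps)
  qed (use pos in simp)
  have Apos: "0 < A j" if "m < j" "j \<le> n" for j
    using lin[of j] that \<delta> C by (smt (verit) divide_pos_pos mult_pos_pos of_nat_0_less_iff
        zero_less_diff less_imp_le_nat)
  define c where "c = (p - 1) / (C * (1 + C powr p) powr p)"
  have "0 < 1 + C powr p" by (simp add: add_pos_nonneg)
  then have c: "0 < c" unfolding c_def using p C by (intro divide_pos_pos mult_pos_pos) auto
  have dec: "A j powr (1 - p) \<le> A (j - 1) powr (1 - p) - c * real n powr (1 - p)" if j: "J < j" "j
      \<le> n" for j
  proof -
    let ?b = "A (j - 1)"
    have b: "0 < ?b" using Apos[of "j - 1"] j J by auto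
    have jn: "0 < real j" "real j \<le> real n" using j by auto
    \<comment> \<open>The relative increment forced by \<open>sup\<close>, that is,
      \<open>?b * (1 + y) \<le> A j\<close>. By \<open>up\<close> it is at most C^p, and on this
      range \<open>(1 + y) powr (1 - p)\<close> lies below a line of fixed negative slope.\<close>
    define y where "y = (?b / real j) powr (p - 1) / C"
    have y0: "0 \<le> y" using C by (simp add: y_def)
    have "(?b / real j) powr (p - 1) \<le> C powr (p - 1)"
      using up[of j] j J b jn p by (intro powr_mono2) (auto simp: field_simps)
    also have "\<dots> \<le> C powr p" using C by (intro powr_mono) auto
    also have "\<dots> \<le> C powr p * C" using C by simp
    finally have y1: "y \<le> C powr p" using C by (simp add: y_def field_simps)
    have "?b powr p = ?b powr (p - 1) * ?b" using b powr_add[of ?b "p - 1" 1] by simp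
    with sup[of j] j J have "?b powr (p - 1) * ?b \<le> C * real j powr (p - 1) * (A j - ?b)" by simp
    then have "?b * y \<le> A j - ?b"
      using b jn C by (simp add: y_def powr_divide field_simps)
    then have "?b * (1 + y) \<le> A j" by (simp add: algebra_simps)
    then have "A j powr (1 - p) \<le> (?b * (1 + y)) powr (1 - p)"
      using b y0 p by (intro powr_mono2') auto
    also have "\<dots> = ?b powr (1 - p) * (1 + y) powr (1 - p)" using b y0 by (simp add: powr_mult)
    also have "(1 + y) powr (1 - p) \<le> 1 - (p - 1) / (1 + C powr p) powr p * y"
    proof (cases "y = 0")
      case False
      then have y: "0 < y" using y0 by simp
      have "\<exists>z. 1 < z \<and> z < 1 + y \<and> (1 + y) powr (1 - p) - 1 powr (1 - p) = (1 + y - 1) * ((1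
          - p) * z powr (1 - p - 1))"
        by (intro MVT2) (use y in simp, rule has_real_derivative_powr, linarith)
      then obtain z where z: "1 < z" "z < 1 + y" "(1 + y) powr (1 - p) - 1 = y * ((1
          - p) * z powr (- p))" by auto
      have "(1 + C powr p) powr (- p) \<le> z powr (- p)" using z y1 p by (intro powr_mono2') auto
      then have "y * (p - 1) * (1 + C powr p) powr (- p) \<le> y * (p - 1) * z powr (- p)"
        using y p by (intro mult_left_mono) auto
      then show ?thesis using z(3) by (simp add: powr_minus divide_inverse algebra_simps)
    qed simp
    also have "?b powr (1 - p) * (1 - (p - 1) / (1 + C powr p) powr p * y)
        = ?b powr (1 - p) - c * (C * (?b powr (1 - p) * y))"
    proof -
      have cC: "(p - 1) / (1 + C powr p) powr p = c * C" using C by (simp add: c_def)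
      show ?thesis unfolding cC by (simp add: algebra_simps)
    qed
    \<comment> \<open>The powers of \<open>?b\<close> cancel, so the decrement does not depend on
      A.\<close>
    also have "C * (?b powr (1 - p) * y) = real j powr (1 - p)"
    proof -
      have "?b powr (1 - p) * ?b powr (p - 1) = 1" using b by (simp add: powr_add[symmetric])
      moreover have "real j powr (1 - p) = 1 / real j powr (p - 1)"
        using jn powr_minus_divide[of "real j" "p - 1"] by simp
      ultimately show ?thesis using C b jn by (simp add: y_def powr_divide)
    qed
    also have "?b powr (1 - p) - c * real j powr (1 - p) \<le> ?b powr (1 - p) - c * real n powr (1 - p)"
      using c jn p by (intro diff_left_mono mult_left_mono powr_mono2') auto
    finally show ?thesis using b by (simp add: mult_left_mono)
  qed
  have tele: "A j powr (1 - p) \<le> A J powr (1 - p) - real (j - J) * (c * real n powr (1 - p))"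
    if "J \<le> j" "j \<le> n" for j
    using that
  proof (induction j rule: dec_induct)
    case (step j)
    then show ?case using dec[of "Suc j"] by (simp add: Suc_diff_le algebra_simps)
  qed simp
  have "real n / 2 * (c * real n powr (1 - p)) \<le> real (n - J) * (c * real n powr (1 - p))"
    using J c by (intro mult_right_mono) auto
  also have "\<dots> \<le> A J powr (1 - p)" using tele[of n] J powr_ge_zero[of "A n" "1 - p"] by linarith
  also have "\<dots> \<le> (\<delta> / C * (real n / 4)) powr (1 - p)"
  proof (rule powr_mono2')
    have "\<delta> / C * (real n / 4) \<le> \<delta> / C * real (J - m)"
      using J \<delta> C by (intro mult_left_mono) auto
    also have "\<dots> \<le> A J" using lin[of J] J by simp
    finally show "\<delta> / C * (real n / 4) \<le> A J" .
  qed (use p \<delta> C J in auto)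
  also have "\<dots> = \<delta> powr (1 - p) * real n powr (1 - p) * (4 * C) powr (p - 1)"
  proof -
    have "\<delta> / C * (real n / 4) = \<delta> * real n / (4 * C)" by simp
    moreover have "1 / (4 * C) powr (1 - p) = (4 * C) powr (p - 1)"
      using C powr_minus_divide[of "4 * C" "1 - p"] by simp
    moreover have "(\<delta> * real n / (4 * C)) powr (1 - p) = \<delta> powr (1 - p) * real n powr (1
        - p) * (1 / (4 * C) powr (1 - p))"
      by (simp only: powr_divide powr_mult) simp
    ultimately show ?thesis by (simp only:)
  qed
  finally have "real n / 2 * c * real n powr (1 - p) \<le> \<delta> powr (1 - p) * (4 * C) powr (p
      - 1) * real n powr (1 - p)"
    by (simp add: mult_ac)
  then have "real n / 2 * c \<le> \<delta> powr (1 - p) * (4 * C) powr (p - 1)"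
    using False by (subst (asm) mult_le_cancel_right) auto
  then have "real n \<le> 2 / c * (4 * C) powr (p - 1) * \<delta> powr (1 - p)"
    using c by (simp add: field_simps)
  also have "2 / c = 2 * (1 + C powr p) powr p * C / (p - 1)"
    by (simp add: c_def)
  also have "2 * (1 + C powr p) powr p * C / (p - 1) * (4 * C) powr (p - 1) * \<delta> powr (1 - p)
      \<le> ?K * \<delta> powr (1 - p)"
    by (intro mult_right_mono) auto
  finally show ?thesis .
qed

section \<open>The test function method\<close>

text \<open>The form factors as (t + s - |x|)(t + s + |x|). A shift exceeding r by 2 keeps the first
  factor at least 2 on the cone |x| \<le> r + t, hence q > 1 there.\<close>

lemma lorentz_bounds:
  fixes x :: "'a::euclidean_space"
  assumes "0 \<le> t" "norm x \<le> r + t" "0 \<le> r" "r + 2 \<le> s"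
  shows "1 < lorentz s (x, t)" "(t + s) * (t + s - norm x) \<le> lorentz s (x, t)"
    "lorentz s (x, t) \<le> (t + s)\<^sup>2" "2 \<le> t + s - norm x"
proof -
  have e: "lorentz s (x, t) = (t + s - norm x) * (t + s + norm x)"
    by (simp add: lorentz_def power2_eq_square algebra_simps)
  show d: "2 \<le> t + s - norm x" using assms by linarith
  then have "2 * 2 \<le> (t + s - norm x) * (t + s + norm x)"
    using norm_ge_zero[of x] by (intro mult_mono) linarith+
  then show "1 < lorentz s (x, t)" by (simp add: e)
  show "(t + s) * (t + s - norm x) \<le> lorentz s (x, t)"
    unfolding e using d by (subst mult.commute) (intro mult_left_mono, auto)
  show "lorentz s (x, t) \<le> (t + s)\<^sup>2" by (simp add: lorentz_def)
qed

text \<open>The second estimate trades one power of q for (t + s)^2, which brings the terms with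
  second derivatives of the cutoff to the order of those with first derivatives.\<close>

lemma lorentz_powr_le:
  fixes x :: "'a::euclidean_space"
  assumes "0 \<le> t" "norm x \<le> r + t" "0 \<le> r" "r + 2 \<le> s" "0 \<le> m"
  shows "lorentz s (x, t) powr (- m) \<le> (t + s) powr (- m) * (t + s - norm x) powr (- m)"
    "lorentz s (x, t) powr (- m) \<le> (t + s)\<^sup>2 * lorentz s (x, t) powr (- m - 1)"
proof -
  note b = lorentz_bounds[OF assms(1-4)]
  have ts: "0 < t + s" using assms by linarith
  have "lorentz s (x, t) powr (- m) \<le> ((t + s) * (t + s - norm x)) powr (- m)"
    using b ts assms by (intro powr_mono2') auto
  then show "lorentz s (x, t) powr (- m) \<le> (t + s) powr (- m) * (t + s - norm x) powr (- m)"
    by (simp only: powr_mult)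
  have "- m = 1 + (- m - 1)" by simp
  then have "lorentz s (x, t) powr (- m) = lorentz s (x, t) * lorentz s (x, t) powr (- m - 1)"
    using b(1) by (metis less_trans powr_add powr_one zero_less_one less_imp_le)
  also have "\<dots> \<le> (t + s)\<^sup>2 * lorentz s (x, t) powr (- m - 1)"
    using b by (intro mult_right_mono) auto
  finally show "lorentz s (x, t) powr (- m) \<le> (t + s)\<^sup>2 * lorentz s (x, t) powr (- m - 1)" .
qed

text \<open>Where F does not vanish the Lorentz form is positive, so |x| < |t + s|: the truncation
  provides the compact support in space. The radius is stated with s' so that different shifts share
  one cylinder.\<close>

lemma cyl_supp_cone_fun:
  fixes F :: "real \<Rightarrow> real"
  assumes "\<And>t. R \<le> \<bar>t\<bar> \<Longrightarrow> \<zeta> t = 0" "\<And>z. z \<le> 1 / 2 \<Longrightarrow> F z = 0" "0 \<le> s" "s \<le> s'"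
  shows "cyl_supp R (R + s') (cone_fun s \<zeta> F :: 'a::euclidean_space \<times> real \<Rightarrow> real)"
  unfolding cyl_supp_def
proof (intro allI impI)
  fix x :: 'a and t :: real assume nz: "cone_fun s \<zeta> F (x, t) \<noteq> 0"
  then have t: "\<bar>t\<bar> < R" using assms(1)[of t] by (force simp: cone_fun_def)
  have "lorentz s (x, t) > 1 / 2" using nz assms(2)[of "lorentz s (x, t)"] by (force simp: cone_fun_def)
  then have "(norm x)\<^sup>2 < (t + s)\<^sup>2" by (simp add: lorentz_def)
  then have "norm x < \<bar>t + s\<bar>" using power2_less_imp_less[of "norm x" "\<bar>t + s\<bar>"] by simp
  with t assms show "\<bar>t\<bar> \<le> R \<and> norm x \<le> R + s'" by linarith
qed

text \<open>The profile of q^(-m) at time 0, rescaled by s^(2m). On a bounded set and for large s it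
  is (1 - |x|^2/s^2)^(-m), hence close to 1.\<close>

definition shape :: "real \<Rightarrow> real \<Rightarrow> 'a::euclidean_space \<Rightarrow> real" where
  "shape m s x = s powr (2 * m) * spow (- m) (s\<^sup>2 - (norm x)\<^sup>2)"

lemma continuous_shape: "continuous_on UNIV (shape m s :: 'a::euclidean_space \<Rightarrow> real)"
  unfolding shape_def[abs_def]
  by (intro continuous_intros continuous_on_compose2[OF smooth_continuous[OF smooth_spow, of UNIV]]) auto

lemma shape_bounds:
  fixes x :: "'a::euclidean_space"
  assumes x: "norm x \<le> r" and s: "2 * r + 2 \<le> s" and m: "0 \<le> m" and r: "0 \<le> r"
  shows "shape m s x = (1 - (norm x / s)\<^sup>2) powr (- m)" "\<bar>shape m s x\<bar> \<le> 2 powr m"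
proof -
  have s0: "0 < s" using s r by linarith
  have "(norm x)\<^sup>2 \<le> (s / 2)\<^sup>2" using x s by (intro power_mono) auto
  then have q: "s\<^sup>2 / 2 \<le> s\<^sup>2 - (norm x)\<^sup>2"
  proof -
    assume "(norm x)\<^sup>2 \<le> (s / 2)\<^sup>2"
    then have "(norm x)\<^sup>2 \<le> s\<^sup>2 / 4" by (simp add: power_divide)
    then show ?thesis using zero_le_power2[of s] by linarith
  qed
  have "2\<^sup>2 \<le> s\<^sup>2" using s r by (intro power_mono) auto
  then have q1: "1 \<le> s\<^sup>2 - (norm x)\<^sup>2" using q by simp
  have e: "s\<^sup>2 - (norm x)\<^sup>2 = s\<^sup>2 * (1 - (norm x / s)\<^sup>2)"
    using s0 by (simp add: power_divide right_diff_distrib)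
  have "s powr (2 * m) = (s\<^sup>2) powr m"
    using s0 by (simp add: powr_powr powr_realpow[symmetric] flip: powr_numeral)
  then have "s powr (2 * m) * (s\<^sup>2) powr (- m) = 1"
    using s0 by (simp add: powr_minus field_simps)
  then show eq: "shape m s x = (1 - (norm x / s)\<^sup>2) powr (- m)"
    using q1 by (simp add: shape_def spow_eq e powr_mult mult.assoc[symmetric])
  have "s\<^sup>2 * (1 / 2) \<le> s\<^sup>2 * (1 - (norm x / s)\<^sup>2)" using q unfolding e by simp
  then have "1 / 2 \<le> 1 - (norm x / s)\<^sup>2" using s0 by (subst (asm) mult_le_cancel_left_pos) auto
  then have "(1 - (norm x / s)\<^sup>2) powr (- m) \<le> (1 / 2) powr (- m)" using m by (intro powr_mono2') auto
  also have "\<dots> = 2 powr m" by (simp add: powr_divide powr_minus_divide)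
  finally show "\<bar>shape m s x\<bar> \<le> 2 powr m" by (simp add: eq)
qed

lemma shape_tendsto:
  fixes x :: "'a::euclidean_space"
  assumes "0 \<le> m" shows "((\<lambda>s. shape m s x) \<longlongrightarrow> 1) at_top"
proof -
  have "((\<lambda>s. norm x / s) \<longlongrightarrow> 0) at_top" by (rule tendsto_divide_0[OF tendsto_const]) (rule
      filterlim_at_top_imp_at_infinity[OF filterlim_ident])
  then have "((\<lambda>s. (1 - (norm x / s)\<^sup>2) powr (- m)) \<longlongrightarrow> (1 - 0\<^sup>2) powr (- m)) at_top"
    by (intro tendsto_intros) auto
  moreover have "\<forall>\<^sub>F s in at_top. (1 - (norm x / s)\<^sup>2) powr (- m) = shape m s x"
    using eventually_ge_at_top[of "2 * norm x + 2"]
    by eventually_elim (use shape_bounds(1)[of x "norm x"] assms in auto)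
  ultimately show ?thesis using Lim_transform_eventually by fastforce
qed

locale semilinear_wave =
  fixes G :: "real \<Rightarrow> real" and f g :: "'a::euclidean_space \<Rightarrow> real" and p a r0 :: real
  assumes p: "1 < p" and a: "0 < a" and G_0: "G 0 = 0" and G_ge: "\<And>s. a * \<bar>s\<bar> powr p \<le> G s"
    and f_cont: "continuous_on UNIV f" and g_cont: "continuous_on UNIV g"
    and f_supp: "\<And>x. f x \<noteq> 0 \<Longrightarrow> norm x \<le> r0" and g_supp: "\<And>x. g x \<noteq> 0 \<Longrightarrow> norm x \<le> r0"
    and r0: "0 \<le> r0" and g_pos: "0 < (\<integral>x. g x \<partial>lebesgue)"
begin

definition solution :: "real \<Rightarrow> ereal \<Rightarrow> (real \<Rightarrow> 'a \<Rightarrow> real) \<Rightarrow> bool" where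
  "solution \<epsilon> T u \<longleftrightarrow> weak_solution G f g \<epsilon> T u \<and>
    supp_st T u \<subseteq> {(x, t). 0 \<le> t \<and> ereal t \<le> T \<and> norm x \<le> r0 + t}"

definition source :: "(real \<Rightarrow> 'a \<Rightarrow> real) \<Rightarrow> real \<Rightarrow> real" where
  "source u t = (\<integral>x. G (u t x) \<partial>lebesgue)"

text \<open>The window R/2 \<le> t \<le> R contains the times at which derivatives of the cutoff
  act; the weight \<open>cutoff p R t\<close> is what Young's inequality leaves in front of
  |u|^p.\<close>

definition tail :: "(real \<Rightarrow> 'a \<Rightarrow> real) \<Rightarrow> real \<Rightarrow> real" where
  "tail u R = (LINT t:{0<..R}|lebesgue. (indicator {R / 2..} t * cutoff p R t) * source u t)"

definition initial :: "('a \<times> real \<Rightarrow> real) \<Rightarrow> real" where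
  "initial \<Psi> = (\<integral>x. g x * \<Psi> (x, 0) \<partial>lebesgue) - (\<integral>x. f x * partial (0, 1) \<Psi> (x, 0) \<partial>lebesgue)"

section \<open>Weighted source integrals and data terms\<close>

lemma G_nonneg: "0 \<le> G s"
  using G_ge[of s] a by (meson mult_nonneg_nonneg order_trans less_imp_le powr_ge_zero)

lemma source_nonneg: "0 \<le> source u t"
  by (simp add: source_def G_nonneg)

lemma weight_integrable:
  assumes "solution \<epsilon> T u" "ereal R < T"
    and "q \<in> borel_measurable borel" "\<And>t. 0 \<le> q t" "\<And>t. q t \<le> B"
  shows "set_integrable lebesgue {0<..R} (\<lambda>t. q t * source u t)"
  unfolding source_def
  by (rule weighted_source_integrable[where B = B]) (use assms G_nonneg in \<open>auto simp: solution_def\<close>)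

lemma weight_integral_mono:
  assumes "solution \<epsilon> T u" "ereal R < T"
    and "q \<in> borel_measurable borel" "\<And>t. 0 \<le> q t" "\<And>t. q t \<le> B"
    and "q' \<in> borel_measurable borel" "\<And>t. 0 \<le> q' t" "\<And>t. q' t \<le> B'"
    and "\<And>t. 0 < t \<Longrightarrow> t \<le> R \<Longrightarrow> q t \<le> q' t"
  shows "(LINT t:{0<..R}|lebesgue. q t * source u t) \<le> (LINT t:{0<..R}|lebesgue. q' t * source u t)"
  by (intro set_integral_mono weight_integrable[OF assms(1,2)] mult_right_mono source_nonneg)
     (use assms in auto)

lemma cutoff_measurable: "cutoff p R \<in> borel_measurable borel"
  by (intro borel_measurable_continuous_onI smooth_continuous smooth_cutoff)

lemma tail_weight_measurable: "(\<lambda>t. indicator {R / 2..} t * cutoff p R t) \<in> borel_measurable borel"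
  by (intro borel_measurable_times cutoff_measurable borel_measurable_indicator) auto

lemma tail_weight_bounds:
  "0 \<le> indicator {R / 2..} t * cutoff p R t" "indicator {R / 2..} t * cutoff p R t \<le> cutoff p R t"
  "indicator {R / 2..} t * cutoff p R t \<le> 1"
  using cutoff_bounds[of p R t] by (auto simp: indicator_def)

lemma tail_nonneg: "0 \<le> tail u R"
  unfolding tail_def set_lebesgue_integral_def
  by (intro Bochner_Integration.integral_nonneg)
     (use tail_weight_bounds source_nonneg in \<open>auto simp: indicator_def cutoff_bounds\<close>)

lemma data_integrable:
  assumes "continuous_on UNIV h"
  shows "integrable lebesgue (\<lambda>x. f x * h x)" "integrable lebesgue (\<lambda>x. g x * h x)"
proof -
  have *: "integrable lebesgue (\<lambda>x. k x * h x)"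
    if k: "continuous_on UNIV k" "\<And>x. k x \<noteq> 0 \<Longrightarrow> norm x \<le> r0" for k :: "'a \<Rightarrow> real"
  proof -
    have c: "continuous_on UNIV (\<lambda>x. k x * h x)" by (intro continuous_on_mult k assms)
    have "bounded ((\<lambda>x. k x * h x) ` cball 0 r0)"
      by (intro compact_imp_bounded compact_continuous_image continuous_on_subset[OF c]) auto
    then obtain M where M: "\<forall>y \<in> (\<lambda>x. k x * h x) ` cball 0 r0. norm y \<le> M" unfolding bounded_iff by blast
    show ?thesis
    proof (rule bounded_support_integrable[OF c, of "max M 0" r0])
      show "\<bar>k x * h x\<bar> \<le> max M 0" for x
      proof (cases "norm x \<le> r0")
        case True
        then have "norm (k x * h x) \<le> M" using M by (simp del: norm_mult)
        then show ?thesis by simp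
      next
        case False
        then have "k x = 0" using k(2) by blast
        then show ?thesis by simp
      qed
    qed (use k(2) in auto)
  qed
  show "integrable lebesgue (\<lambda>x. f x * h x)" "integrable lebesgue (\<lambda>x. g x * h x)"
    by (intro * f_cont g_cont f_supp g_supp; assumption)+
qed

text \<open>Shifting the light cone far into the past makes the contribution of \<open>f\<close> negligible
  against that of \<open>g\<close>.\<close>

lemma initial_shape_pos:
  assumes m: "0 \<le> m"
  obtains s0 where "\<And>s. s0 \<le> s \<Longrightarrow>
    0 < (\<integral>x. g x * shape m s x \<partial>lebesgue) - (\<integral>x. f x * (c / s * shape m s x + d / s * shape (m
        + 1) s x) \<partial>lebesgue)"
proof -
  let ?B = "\<lambda>s x. c / s * shape m s x + d / s * shape (m + 1) s x"
  let ?h = "\<lambda>s x. g x * shape m s x - f x * ?B s x"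
  have cont: "continuous_on UNIV (?B s)" for s by (intro continuous_intros continuous_shape)
  have "((\<lambda>s. \<integral>x. ?h s x \<partial>lebesgue) \<longlongrightarrow> (\<integral>x. g x \<partial>lebesgue)) at_top"
  proof (rule integral_dominated_convergence_at_top)
    let ?M = "2 powr m + (\<bar>c\<bar> * 2 powr m + \<bar>d\<bar> * 2 powr (m + 1))"
    show "integrable lebesgue (\<lambda>x. (\<bar>g x\<bar> + \<bar>f x\<bar>) * ?M)"
      using data_integrable[of "\<lambda>_. 1"] by simp
    show "g \<in> borel_measurable lebesgue" using data_integrable(2)[of "\<lambda>_. 1"] by simp
    show "(\<lambda>x. ?h s x) \<in> borel_measurable lebesgue" for s
      using data_integrable(2)[OF continuous_shape, of m s] data_integrable(1)[OF cont, of s] by auto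
    show "AE x in lebesgue. ((\<lambda>s. ?h s x) \<longlongrightarrow> g x) at_top"
    proof (rule AE_I2)
      fix x
      have inv: "((\<lambda>s. k / s) \<longlongrightarrow> 0) at_top" for k :: real
        by (rule tendsto_divide_0[OF tendsto_const]) (rule filterlim_at_top_imp_at_infinity[OF
            filterlim_ident])
      have "((\<lambda>s. ?h s x) \<longlongrightarrow> g x * 1 - f x * (0 * 1 + 0 * 1)) at_top"
        using m by (intro tendsto_intros inv shape_tendsto) auto
      then show "((\<lambda>s. ?h s x) \<longlongrightarrow> g x) at_top" by simp
    qed
    show "\<forall>\<^sub>F s in at_top. AE x in lebesgue. norm (?h s x) \<le> (\<bar>g x\<bar> + \<bar>f x\<bar>) * ?M"
      using eventually_ge_at_top[of "2 * r0 + 2"]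
    proof eventually_elim
      case (elim s)
      show ?case
      proof (rule AE_I2)
        fix x
        show "norm (?h s x) \<le> (\<bar>g x\<bar> + \<bar>f x\<bar>) * ?M"
        proof (cases "norm x \<le> r0")
          case True
          have s1: "1 \<le> s" using elim r0 by linarith
          have b: "\<bar>shape m s x\<bar> \<le> 2 powr m" "\<bar>shape (m + 1) s x\<bar> \<le> 2 powr (m + 1)"
            using shape_bounds(2)[OF True elim] m r0 by auto
          have ks: "\<bar>k / s\<bar> \<le> \<bar>k\<bar>" for k
            using s1 by (simp add: divide_le_eq mult_le_cancel_left1 abs_divide)
          have "\<bar>?B s x\<bar> \<le> \<bar>c / s\<bar> * \<bar>shape m s x\<bar> + \<bar>d / s\<bar> * \<bar>shape (m + 1) s x\<bar>"
            using abs_triangle_ineq by (metis abs_mult)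
          also have "\<dots> \<le> \<bar>c\<bar> * 2 powr m + \<bar>d\<bar> * 2 powr (m + 1)"
            by (intro add_mono mult_mono b ks) auto
          finally have B: "\<bar>?B s x\<bar> \<le> \<bar>c\<bar> * 2 powr m + \<bar>d\<bar> * 2 powr (m + 1)" .
          have "norm (?h s x) \<le> \<bar>g x\<bar> * \<bar>shape m s x\<bar> + \<bar>f x\<bar> * \<bar>?B s x\<bar>"
            unfolding real_norm_def using abs_triangle_ineq4 by (metis abs_mult)
          also have "\<dots> \<le> \<bar>g x\<bar> * ?M + \<bar>f x\<bar> * ?M"
            using b B by (intro add_mono mult_left_mono) (auto intro: order_trans)
          finally show ?thesis by (simp add: distrib_right)
        next
          case False
          then have "f x = 0" "g x = 0" using f_supp g_supp by blast+
          then show ?thesis by simp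
        qed
      qed
    qed
  qed
  then have "\<forall>\<^sub>F s in at_top. 0 < (\<integral>x. ?h s x \<partial>lebesgue)" by (rule order_tendstoD(1)) (rule g_pos)
  then obtain s0 where s0: "\<And>s. s0 \<le> s \<Longrightarrow> 0 < (\<integral>x. ?h s x \<partial>lebesgue)" unfolding
      eventually_at_top_linorder by blast
  have "(\<integral>x. ?h s x \<partial>lebesgue) = (\<integral>x. g x * shape m s x \<partial>lebesgue) - (\<integral>x. f x * ?B s x \<partial>lebesgue)" for s
    by (intro Bochner_Integration.integral_diff data_integrable continuous_shape cont)
  with s0 show thesis by (intro that[of s0]) simp
qed

lemma initial_cong:
  assumes "\<And>x. norm x \<le> r0 \<Longrightarrow> \<Psi> (x, 0) = A x" "\<And>x. norm x \<le> r0 \<Longrightarrow> partial (0, 1) \<Psi> (x, 0) = B x"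
  shows "initial \<Psi> = (\<integral>x. g x * A x \<partial>lebesgue) - (\<integral>x. f x * B x \<partial>lebesgue)"
proof -
  have "g x * \<Psi> (x, 0) = g x * A x" "f x * partial (0, 1) \<Psi> (x, 0) = f x * B x" for x
    using assms[of x] f_supp[of x] g_supp[of x] by (cases "norm x \<le> r0"; auto)+
  then show ?thesis unfolding initial_def by (simp only:)
qed

text \<open>Before R/2 the d'Alembertian vanishes on the cone, so Young's inequality yields source
  terms from [R/2, R] alone, and the p-th power of \<open>cutoff p R t powr (1 / p)\<close> is the
  weight in \<open>tail\<close>. Optimising over \<theta> gives a bound of X^p that is linear in the
  tail.\<close>

lemma tail_test:
  assumes sol: "solution \<epsilon> T u"
    and \<Psi>: "smooth \<Psi>" "cyl_supp (3 * R / 4) \<rho> \<Psi>" "\<And>x t. 0 < t \<Longrightarrow> 0 \<le> \<Psi> (x, t)"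
    and R: "0 < R" "ereal R < T"
    and P: "P \<in> borel_measurable borel" "\<And>t. 0 \<le> P t" "\<And>t. P t \<le> B"
      "\<And>x t. 0 < t \<Longrightarrow> t \<le> R \<Longrightarrow> norm x \<le> r0 + t \<Longrightarrow> P t \<le> \<Psi> (x, t)"
    and early: "\<And>x t. 0 < t \<Longrightarrow> t < R / 2 \<Longrightarrow> norm x \<le> r0 + t \<Longrightarrow> dalembertian \<Psi> (x, t) = 0"
    and late: "\<And>x t. R / 2 \<le> t \<Longrightarrow> t \<le> R \<Longrightarrow> norm x \<le> r0 + t \<Longrightarrow>
      \<bar>dalembertian \<Psi> (x, t)\<bar> \<le> cutoff p R t powr (1 / p) * K t x"
    and K: "\<And>t x. norm x \<le> r0 + t \<Longrightarrow> 0 \<le> K t x"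
      "\<And>t. R / 2 \<le> t \<Longrightarrow> t \<le> R \<Longrightarrow>
        integrable lebesgue (\<lambda>x. indicator (cball 0 (r0 + t)) x * K t x powr (p / (p - 1)))"
      "\<And>t. R / 2 \<le> t \<Longrightarrow> t \<le> R \<Longrightarrow>
        (\<integral>x. indicator (cball 0 (r0 + t)) x * K t x powr (p / (p - 1)) \<partial>lebesgue) \<le> b"
    and b: "0 < b"
    and X: "0 < X" "X \<le> \<epsilon> * initial \<Psi> + (LINT t:{0<..R}|lebesgue. P t * source u t)"
  shows "X powr p \<le> 2 powr p * (R * b) powr (p - 1) * (tail u R / a)"
proof (rule young_optimise[OF _ X(1) _ p])
  show "0 < R * b" using R b by simp
  fix \<theta> :: real assume \<theta>: "0 < \<theta>"
  define Q where "Q t = \<theta> powr (1 - p) * (indicator {R / 2..} t * cutoff p R t)" for t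
  define H where "H t x = indicator {R / 2..} t * (\<theta> * (indicator (cball 0 (r0
      + t)) x * K t x powr (p / (p - 1))))" for t x
  have Qb: "0 \<le> Q t" "Q t \<le> \<theta> powr (1 - p)" for t
    unfolding Q_def using tail_weight_bounds[of R t] by (auto intro: mult_left_le)
  have "\<epsilon> * initial \<Psi> + (LINT t:{0<..R}|lebesgue. P t * source u t)
      \<le> (LINT t:{0<..R}|lebesgue. Q t * source u t) / a + R * (\<theta> * b)"
    unfolding initial_def source_def
  proof (rule test_function_inequality[where G = G and u = u and T = T and p = p and H = H
        and B = "max B (\<theta> powr (1 - p))" and ?R0.0 = "3 * R / 4" and \<rho> = \<rho>])
    show "f \<in> borel_measurable lebesgue" using data_integrable(1)[of "\<lambda>_. 1"] by simp
    show "Q \<in> borel_measurable borel"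
      unfolding Q_def by (intro borel_measurable_times tail_weight_measurable) auto
    show "Q t \<le> max B (\<theta> powr (1 - p))" "P t \<le> max B (\<theta> powr (1 - p))" for t
      using Qb(2)[of t] P(3)[of t] by auto
    show "integrable lebesgue (H t)" if "0 < t" "t \<le> R" for t
      using K(2)[of t] that unfolding H_def by (cases "R / 2 \<le> t") auto
    show "0 \<le> H t x" for t x using \<theta> by (simp add: H_def)
    show "(\<integral>x. H t x \<partial>lebesgue) \<le> \<theta> * b" if "0 < t" "t \<le> R" for t
      using K(3)[of t] that \<theta> b unfolding H_def by (cases "R / 2 \<le> t") auto
    show "y * \<bar>dalembertian \<Psi> (x, t)\<bar> \<le> Q t * y powr p + H t x"
      if t: "0 < t" "t \<le> R" "norm x \<le> r0 + t" and y: "0 \<le> y" for x t y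
    proof (cases "R / 2 \<le> t")
      case True
      have "y * \<bar>dalembertian \<Psi> (x, t)\<bar> \<le> y * (cutoff p R t powr (1 / p) * K t x)"
        using late[OF True t(2,3)] y by (rule mult_left_mono)
      also have "\<dots> = (y * cutoff p R t powr (1 / p)) * K t x" by simp
      also have "\<dots> \<le> \<theta> powr (1 - p) * (y * cutoff p R t powr (1 / p)) powr p
          + \<theta> * K t x powr (p / (p - 1))"
        by (rule young_parametric) (use y K(1) t \<theta> p in auto)
      also have "(y * cutoff p R t powr (1 / p)) powr p = cutoff p R t * y powr p"
        using p cutoff_bounds(1)[of p R t] by (simp add: powr_mult powr_powr)
      finally show ?thesis using True t by (simp add: Q_def H_def mult.assoc)
    next
      case False
      then show ?thesis using early[of t x] t by (simp add: Q_def H_def)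
    qed
  qed (use sol \<Psi> R P G_0 G_ge a Qb(1) in \<open>auto simp: solution_def\<close>)
  also have "(LINT t:{0<..R}|lebesgue. Q t * source u t) = \<theta> powr (1 - p) * tail u R"
    by (simp add: Q_def tail_def mult.assoc)
  finally show "X \<le> \<theta> powr (1 - p) * (tail u R / a) + \<theta> * (R * b)"
    using X(2) by (simp add: mult_ac)
qed

lemma cutoff_0: "0 < R \<Longrightarrow> cutoff p R 0 = 1" "0 < R \<Longrightarrow> partial 1 (cutoff p R) 0 = 0"
  by (auto intro: cutoff_eq_1 cutoff_derivatives_0)

text \<open>With m = 0 the test function equals the cutoff on the cone, and the Lorentz form
  supplies compact support in space. The power of R collects R from time, R^N from the ball and R^(-
  2p/(p - 1)) from the second derivative of the cutoff.\<close>

lemma constant_test: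
  obtains C where "0 < C" "\<And>\<epsilon> T u R. solution \<epsilon> T u \<Longrightarrow> 0 < \<epsilon> \<Longrightarrow> 1 \<le> R \<Longrightarrow> ereal R < T \<Longrightarrow>
    \<epsilon> \<le> C * R powr (real DIM('a) + 1 - 2 * p / (p - 1)) \<and>
    (LINT t:{0<..R}|lebesgue. cutoff p R t * source u t) \<le> C * R powr (real DIM('a) + 1
        - 2 * p / (p - 1))"
proof -
  obtain C0 where C0: "0 < C0"
    "\<And>R t. 0 < R \<Longrightarrow> \<bar>partial 1 (partial 1 (cutoff p R)) t\<bar> \<le> C0 / R\<^sup>2 * cutoff p R t powr (1 / p)"
    using cutoff_derivatives_bound[OF p] by metis
  define l where "l = r0 + 2"
  \<comment> \<open>Solves \<open>\<theta> powr (1 - p) = a / 2\<close>, so that after division by a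
    half of the source integral is absorbed on the left.\<close>
  define \<theta> where "\<theta> = (a / 2) powr (1 / (1 - p))"
  define V where "V = unit_ball_vol (real DIM('a))"
  define e where "e = real DIM('a) + 1 - 2 * p / (p - 1)"
  define b where "b R = \<theta> * (C0 / R\<^sup>2) powr (p / (p - 1)) * (V * (r0 + R) ^ DIM('a))" for R
  define C1 where "C1 = \<theta> * C0 powr (p / (p - 1)) * (V * (r0 + 1) ^ DIM('a))"
  have \<theta>: "0 < \<theta>" "\<theta> powr (1 - p) = a / 2" using a p by (auto simp: \<theta>_def powr_powr)
  have V: "0 < V" by (simp add: V_def unit_ball_vol_pos)
  have C1: "0 < C1" using \<theta> C0 V r0 by (simp add: C1_def)
  have Rb: "R * b R \<le> C1 * R powr e" if R: "1 \<le> R" for R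
  proof -
    have "r0 + R \<le> (r0 + 1) * R" using R r0 mult_left_mono[of 1 R r0] by (simp add: distrib_right)
    then have "(r0 + R) ^ DIM('a) \<le> (r0 + 1) ^ DIM('a) * R ^ DIM('a)"
      using r0 R unfolding power_mult_distrib[symmetric] by (intro power_mono) auto
    then have "R * b R \<le> R * (\<theta> * (C0 / R\<^sup>2) powr (p / (p - 1)) * (V * ((r0
        + 1) ^ DIM('a) * R ^ DIM('a))))"
      unfolding b_def using R \<theta> V by (intro mult_left_mono) auto
    also have "(C0 / R\<^sup>2) powr (p / (p - 1)) = C0 powr (p / (p - 1)) * R powr (- 2 * p / (p - 1))"
      using R by (simp add: powr_divide powr_powr powr_minus_divide flip: powr_numeral)
    also have "R * (\<theta> * (C0 powr (p / (p - 1)) * R powr (- 2 * p / (p - 1))) * (V * ((r0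
        + 1) ^ DIM('a) * R ^ DIM('a))))
        = C1 * (R powr 1 * R powr (- 2 * p / (p - 1)) * R powr real DIM('a))"
      using R by (simp add: C1_def powr_realpow)
    also have "R powr 1 * R powr (- 2 * p / (p - 1)) * R powr real DIM('a) = R powr e"
      by (simp only: e_def powr_add[symmetric], rule arg_cong[where f = "(powr) R"], simp)
    finally show ?thesis .
  qed
  show thesis
  \<comment> \<open>The minimum with 1 lets one constant serve both bounds: \<epsilon> comes with
    the integral of g as its factor, the source integral with 1.\<close>
  proof (rule that[of "2 * C1 / min 1 (\<integral>x. g x \<partial>lebesgue)"])
    show "0 < 2 * C1 / min 1 (\<integral>x. g x \<partial>lebesgue)" using C1 g_pos by simp
    fix \<epsilon> T u R assume sol: "solution \<epsilon> T u" and \<epsilon>: "0 < \<epsilon>" and R: "1 \<le> R" "ereal R < T"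
    have R0: "0 < R" using R by simp
    define \<Psi> where "\<Psi> = (cone_fun l (cutoff p R) (spow (- 0)) :: 'a \<times> real \<Rightarrow> real)"
    have q: "1 < lorentz l (x, t)" if "0 \<le> t" "norm x \<le> r0 + t" for x :: 'a and t
      using lorentz_bounds(1)[OF that r0] by (simp add: l_def)
    have \<Psi>1: "\<Psi> (x, t) = cutoff p R t" if "0 \<le> t" "norm x \<le> r0 + t" for x t
      using q[OF that] by (simp add: \<Psi>_def cone_fun_def spow_eq)
    have dal: "dalembertian \<Psi> (x, t) = partial 1 (partial 1 (cutoff p R)) t" if "0 \<le> t" "norm x
        \<le> r0 + t" for x t
      using dalembertian_cone_powr[OF smooth_cutoff[of p R] q[OF that], where m = 0] q[OF that]
          by (simp add: \<Psi>_def)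
    have init: "initial \<Psi> = (\<integral>x. g x \<partial>lebesgue)"
    proof -
      have "initial \<Psi> = (\<integral>x. g x * 1 \<partial>lebesgue) - (\<integral>x. f x * 0 \<partial>lebesgue)"
      proof (rule initial_cong)
        fix x :: 'a assume x: "norm x \<le> r0"
        show "\<Psi> (x, 0) = 1" using \<Psi>1[of 0 x] x R0 by (simp add: cutoff_0)
        show "partial (0, 1) \<Psi> (x, 0) = 0"
          using q[of 0 x] x partial_spow[of "lorentz l (x, 0)" 0]
          by (simp add: \<Psi>_def partial_time_cone_fun smooth_cutoff smooth_spow cone_fun_def cutoff_0 R0)
      qed
      then show ?thesis by simp
    qed
    let ?X = "LINT t:{0<..R}|lebesgue. cutoff p R t * source u t"
    have "\<epsilon> * initial \<Psi> + ?X \<le> (LINT t:{0<..R}|lebesgue. (a / 2 * cutoff p R t) * source u t) / a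
        + R * b R"
      unfolding initial_def source_def
    proof (rule test_function_inequality[where G = G and u = u and T = T and p = p and B = "1
        + a" and ?R0.0 = "3 * R / 4"
          and \<rho> = "3 * R / 4 + l"
          and H = "\<lambda>t x. \<theta> * (C0 / R\<^sup>2) powr (p / (p - 1)) * indicator (cball 0 (r0 + R)) x"])
      show "f \<in> borel_measurable lebesgue" using data_integrable(1)[of "\<lambda>_. 1"] by simp
      show "smooth \<Psi>" by (simp add: \<Psi>_def smooth_cone_fun smooth_cutoff smooth_spow)
      show "cyl_supp (3 * R / 4) (3 * R / 4 + l) \<Psi>"
        unfolding \<Psi>_def by (rule cyl_supp_cone_fun) (use cutoff_eq_0[OF p R0] r0 in \<open>auto simp:
            spow_0 l_def\<close>)
      show "0 \<le> \<Psi> (x, t)" for x t by (simp add: \<Psi>_def cone_fun_def cutoff_bounds spow_nonneg)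
      show "(\<lambda>t. a / 2 * cutoff p R t) \<in> borel_measurable borel"
        by (intro borel_measurable_times cutoff_measurable) auto
      show "a / 2 * cutoff p R t \<le> 1 + a" "cutoff p R t \<le> 1 + a" "0 \<le> a / 2 * cutoff p R t" for t
      proof -
        have "a * cutoff p R t \<le> a" "0 \<le> a * cutoff p R t"
          using cutoff_bounds[of p R t] a by (auto intro: mult_left_le)
        then show "a / 2 * cutoff p R t \<le> 1 + a" "cutoff p R t \<le> 1 + a" "0 \<le> a / 2 * cutoff p R t"
          using cutoff_bounds[of p R t] a by linarith+
      qed
      show "cutoff p R t \<le> \<Psi> (x, t)" if "0 < t" "norm x \<le> r0 + t" for x t using \<Psi>1 that by simp
      show "integrable lebesgue (\<lambda>x::'a. \<theta> * (C0 / R\<^sup>2) powr (p / (p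
          - 1)) * indicator (cball 0 (r0 + R)) x)"
        by (intro integrable_mult_right integrable_real_indicator)
           (use emeasure_lborel_cball_finite[of "0::'a" "r0 + R"] in auto)
      show "(\<integral>x. \<theta> * (C0 / R\<^sup>2) powr (p / (p - 1)) * indicator (cball (0::'a) (r0
          + R)) x \<partial>lebesgue) \<le> b R"
        using r0 R0 by (simp add: b_def V_def content_cball)
      show "0 \<le> \<theta> * (C0 / R\<^sup>2) powr (p / (p - 1)) * indicator (cball 0 (r0 + R)) x" for x :: 'a
        using \<theta> by simp
      fix x :: 'a and t y :: real assume t: "0 < t" "t \<le> R" "norm x \<le> r0 + t" and y: "0 \<le> y"
      have "y * \<bar>dalembertian \<Psi> (x, t)\<bar> \<le> y * (C0 / R\<^sup>2 * cutoff p R t powr (1 / p))"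
        unfolding dal[OF less_imp_le[OF t(1)] t(3)] using C0(2)[OF R0] y by (rule mult_left_mono)
      also have "\<dots> = (y * cutoff p R t powr (1 / p)) * (C0 / R\<^sup>2)" by simp
      also have "\<dots> \<le> \<theta> powr (1 - p) * (y * cutoff p R t powr (1 / p)) powr p
          + \<theta> * (C0 / R\<^sup>2) powr (p / (p - 1))"
        by (rule young_parametric) (use y C0 \<theta> p in auto)
      also have "(y * cutoff p R t powr (1 / p)) powr p = cutoff p R t * y powr p"
        using p cutoff_bounds(1)[of p R t] by (simp add: powr_mult powr_powr)
      finally show "y * \<bar>dalembertian \<Psi> (x, t)\<bar> \<le> a / 2 * cutoff p R t * y powr p
          + \<theta> * (C0 / R\<^sup>2) powr (p / (p - 1)) * indicator (cball 0 (r0 + R)) x"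
        using t \<theta>(2) by (simp add: mult.assoc)
    qed (use sol R R0 G_0 G_ge a cutoff_bounds[of p R] cutoff_measurable in \<open>auto simp: solution_def\<close>)
    also have "(LINT t:{0<..R}|lebesgue. (a / 2 * cutoff p R t) * source u t) / a = ?X / 2"
      using a by (simp add: mult.assoc)
    finally have main: "\<epsilon> * (\<integral>x. g x \<partial>lebesgue) + ?X / 2 \<le> C1 * R powr e"
      using Rb[OF R(1)] init by simp
    have X: "0 \<le> ?X" unfolding set_lebesgue_integral_def
      by (intro Bochner_Integration.integral_nonneg) (auto simp: cutoff_bounds source_nonneg)
    let ?g = "min 1 (\<integral>x. g x \<partial>lebesgue)"
    have g: "0 < ?g" using g_pos by simp
    have "\<epsilon> * ?g \<le> \<epsilon> * (\<integral>x. g x \<partial>lebesgue)" using \<epsilon> by (intro mult_left_mono) auto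
    moreover have "?X * ?g \<le> ?X * 1" using X by (intro mult_left_mono) auto
    moreover have "0 \<le> \<epsilon> * (\<integral>x. g x \<partial>lebesgue)" "0 \<le> C1 * R powr e"
      using \<epsilon> g_pos C1 by auto
    ultimately have "\<epsilon> * ?g \<le> 2 * (C1 * R powr e)" "?X * ?g \<le> 2 * (C1 * R powr e)"
      using main X by linarith+
    then show "\<epsilon> \<le> 2 * C1 / ?g * R powr (real DIM('a) + 1 - 2 * p / (p - 1)) \<and>
      ?X \<le> 2 * C1 / ?g * R powr (real DIM('a) + 1 - 2 * p / (p - 1))"
      using g unfolding e_def times_divide_eq_left by (simp add: pos_le_divide_eq mult.assoc)
  qed
qed

end

lemma cone_weight_integral:
  fixes \<kappa> \<gamma> :: real
  assumes t: "0 \<le> t" and r: "0 \<le> r" "r + 2 \<le> l" and j: "t + l < 2 ^ Suc j" and \<gamma>: "0 \<le> \<gamma>" and \<kappa>: "0 \<le> \<kappa>"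
  defines "h \<equiv> \<lambda>x::'a::euclidean_space. indicator (cball 0 (r + t)) x * (\<kappa> * (t + l
      - norm x) powr (- \<gamma>))"
  shows "integrable lebesgue h"
    "(\<integral>x. h x \<partial>lebesgue) \<le> \<kappa> * ((unit_ball_vol (real DIM('a)) * real DIM('a)) * (t + l) ^ (DIM('a) - 1)
       * (\<Sum>k\<le>j. (2 ^ k) powr (1 - \<gamma>)))"
proof -
  let ?k = "\<lambda>x::'a. indicator (cball 0 (t + l - 1)) x * (t + l - norm x) powr (- \<gamma>)"
  have L: "1 \<le> t + l" using t r by linarith
  note I = integral_dist_cone[OF L j \<gamma>, where 'a = 'a]
  have eq: "h = (\<lambda>x. indicator (cball 0 (r + t)) x * (\<kappa> * ?k x))"
    using r by (auto simp: h_def indicator_def fun_eq_iff)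
  have ik: "integrable lebesgue (\<lambda>x. \<kappa> * ?k x)" using I(1) by simp
  have le: "0 \<le> h x" "h x \<le> \<kappa> * ?k x" for x
    unfolding eq using \<kappa> by (auto simp: indicator_def)
  have "h \<in> borel_measurable lebesgue"
    unfolding eq
    by (intro borel_measurable_times[OF _ borel_measurable_integrable[OF ik]]
        borel_measurable_indicator fmeasurableD[OF lmeasurable_cball])
  then show i: "integrable lebesgue h"
    by (rule Bochner_Integration.integrable_bound[OF ik])
       (use le order_trans[OF le] in \<open>auto intro!: AE_I2\<close>)
  have "(\<integral>x. h x \<partial>lebesgue) \<le> (\<integral>x. \<kappa> * ?k x \<partial>lebesgue)"
    by (rule Bochner_Integration.integral_mono[OF i ik le(2)])
  also have "\<dots> = \<kappa> * (\<integral>x. ?k x \<partial>lebesgue)" by simp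
  also have "\<dots> \<le> \<kappa> * ((unit_ball_vol (real DIM('a)) * real DIM('a)) * (t + l) ^ (DIM('a) - 1)
       * (\<Sum>k\<le>j. (2 ^ k) powr (1 - \<gamma>)))"
    by (rule mult_left_mono[OF I(2) \<kappa>])
  finally show "(\<integral>x. h x \<partial>lebesgue) \<le> \<kappa> * ((unit_ball_vol (real DIM('a)) * real DIM('a)) * (t
      + l) ^ (DIM('a) - 1)
       * (\<Sum>k\<le>j. (2 ^ k) powr (1 - \<gamma>)))" .
qed

context semilinear_wave
begin

lemma initial_cone_fun:
  assumes \<zeta>: "smooth \<zeta>" and s: "r0 + 2 \<le> s"
  shows "initial (cone_fun s \<zeta> (spow (- m))) = s powr (- (2 * m)) *
    ((\<integral>x. g x * (\<zeta> 0 * shape m s x) \<partial>lebesgue)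
      - (\<integral>x. f x * (partial 1 \<zeta> 0 * shape m s x + \<zeta> 0 * (- (2 * m) / s) * shape (m + 1) s x) \<partial>lebesgue))"
proof -
  have s0: "0 < s" using s r0 by linarith
  have sh: "spow (- k) (s\<^sup>2 - (norm x)\<^sup>2) = s powr (- (2 * k)) * shape k s x" for x :: 'a and k
    using s0 by (simp add: shape_def mult.assoc[symmetric] powr_add[symmetric])
  have "initial (cone_fun s \<zeta> (spow (- m))) =
      (\<integral>x. g x * (\<zeta> 0 * (s powr (- (2 * m)) * shape m s x)) \<partial>lebesgue)
      - (\<integral>x. f x * (s powr (- (2 * m)) * (partial 1 \<zeta> 0 * shape m s x
          + \<zeta> 0 * (- (2 * m) / s) * shape (m + 1) s x)) \<partial>lebesgue)"
  proof (rule initial_cong)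
    fix x :: 'a assume x: "norm x \<le> r0"
    have q: "1 < s\<^sup>2 - (norm x)\<^sup>2" using lorentz_bounds(1)[of 0 x r0 s] x r0 s by (simp add: lorentz_def)
    show "cone_fun s \<zeta> (spow (- m)) (x, 0) = \<zeta> 0 * (s powr (- (2 * m)) * shape m s x)"
      by (simp add: cone_fun_def lorentz_def sh)
    have "partial 1 (spow (- m)) (s\<^sup>2 - (norm x)\<^sup>2) = - m * spow (- (m + 1)) (s\<^sup>2 - (norm x)\<^sup>2)"
      using q by (simp add: partial_spow spow_eq)
    also have "\<dots> = - m * (s powr (- (2 * (m + 1))) * shape (m + 1) s x)" by (simp only: sh)
    also have "s powr (- (2 * (m + 1))) = s powr (- (2 * m)) / (s * s)"
    proof -
      have "- (2 * m) = - (2 * (m + 1)) + 2" by simp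
      then have "s powr (- (2 * m)) = s powr (- (2 * (m + 1))) * s powr 2" by (simp only: powr_add)
      then show ?thesis using s0 by (simp add: power2_eq_square)
    qed
    finally have d: "partial 1 (spow (- m)) (s\<^sup>2 - (norm x)\<^sup>2)
        = - m * (s powr (- (2 * m)) / (s * s) * shape (m + 1) s x)" .
    show "partial (0, 1) (cone_fun s \<zeta> (spow (- m))) (x, 0)
        = s powr (- (2 * m)) * (partial 1 \<zeta> 0 * shape m s x + \<zeta> 0 * (- (2 * m) / s) * shape (m + 1) s x)"
      using s0 by (simp add: partial_time_cone_fun[OF \<zeta> smooth_spow] cone_fun_def lorentz_def sh d)
        (simp add: field_simps)
  qed
  also have "\<dots> = s powr (- (2 * m)) *
    ((\<integral>x. g x * (\<zeta> 0 * shape m s x) \<partial>lebesgue)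
      - (\<integral>x. f x * (partial 1 \<zeta> 0 * shape m s x + \<zeta> 0 * (- (2 * m) / s) * shape (m + 1) s x) \<partial>lebesgue))"
    by (simp only: right_diff_distrib Bochner_Integration.integral_mult_right_zero[symmetric]
        mult.left_commute[of _ "s powr _"])
  finally show ?thesis .
qed

lemma initial_sum:
  assumes I: "finite I" and F: "\<And>k. k \<in> I \<Longrightarrow> smooth (F k)"
  shows "initial (\<lambda>z. \<Sum>k\<in>I. c k * F k z) = (\<Sum>k\<in>I. c k * initial (F k))"
proof -
  have cont: "continuous_on UNIV (\<lambda>x. F k (x, 0))" "continuous_on UNIV (\<lambda>x. partial (0, 1) (F k) (x, 0))"
    if "k \<in> I" for k
    using slice_continuous[OF smooth_continuous[OF F[OF that]]]
      slice_continuous[OF smooth_continuous[OF smooth_partial[OF F[OF that] Basis_time]]] by auto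
  have cm: "partial (0, 1) (\<lambda>z. c * h z) z = c * partial (0, 1) h z" if "smooth h" for c z and h
      :: "'a \<times> real \<Rightarrow> real"
    using that by (simp add: partial_mult smooth_differentiable)
  have "initial (\<lambda>z. \<Sum>k\<in>I. c k * F k z) =
      (\<integral>x. (\<Sum>k\<in>I. c k * (g x * F k (x, 0))) \<partial>lebesgue)
      - (\<integral>x. (\<Sum>k\<in>I. c k * (f x * partial (0, 1) (F k) (x, 0))) \<partial>lebesgue)"
    by (simp add: initial_def partial_sum I F smooth_mult cm sum_distrib_left mult.left_commute)
  also have "\<dots> = (\<Sum>k\<in>I. c k * initial (F k))"
    using data_integrable[OF cont(1)] data_integrable[OF cont(2)]
    by (simp add: initial_def Bochner_Integration.integral_sum sum_subtractf right_diff_distrib)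
  finally show ?thesis .
qed

text \<open>The constant of \<open>tail_test\<close> for a conical kernel, with all powers of R
  taken out: \<open>unit_ball_vol N * N\<close> is the area of the unit sphere, and
  \<open>2 ^ (N - 1)\<close> comes from t + l \<le> 2 R.\<close>

definition cone_const :: "real \<Rightarrow> real" where
  "cone_const K0 = 2 powr p * (K0 powr (p / (p - 1)) * (unit_ball_vol (real DIM('a)) * real DIM('a)
    * 2 ^ (DIM('a) - 1))) powr (p - 1) / a"

lemma cone_const_pos: "0 < K0 \<Longrightarrow> 0 < cone_const K0"
proof -
  assume "0 < K0"
  then have "0 < K0 powr (p / (p - 1)) * (unit_ball_vol (real DIM('a)) * real DIM('a) * 2 ^
      (DIM('a) - 1))"
    by (intro mult_pos_pos) (auto simp: unit_ball_vol_pos)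
  then have "0 < (K0 powr (p / (p - 1)) * (unit_ball_vol (real DIM('a)) * real DIM('a) * 2 ^
      (DIM('a) - 1))) powr (p - 1)"
    by (simp only: powr_gt_zero)
  then show ?thesis unfolding cone_const_def using a by (intro divide_pos_pos mult_pos_pos) auto
qed

text \<open>Specialises \<open>tail_test\<close> to kernels R^(- (N + 1)/2) d^(- \<delta>), where d
  is the distance to the shifted light cone within a time slice. The power of R is p - 1 times N -
  (N + 1)/2 * p/(p - 1); the profile in d enters only through the dyadic sum S.\<close>

lemma tail_test_cone:
  assumes sol: "solution \<epsilon> T u"
    and \<Psi>: "smooth \<Psi>" "cyl_supp (3 * R / 4) \<rho> \<Psi>" "\<And>x t. 0 < t \<Longrightarrow> 0 \<le> \<Psi> (x, t)"
    and R: "0 < R" "ereal R < T"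
    and P: "P \<in> borel_measurable borel" "\<And>t. 0 \<le> P t" "\<And>t. P t \<le> B"
      "\<And>x t. 0 < t \<Longrightarrow> t \<le> R \<Longrightarrow> norm x \<le> r0 + t \<Longrightarrow> P t \<le> \<Psi> (x, t)"
    and l: "r0 + 2 \<le> l" "l \<le> R" and j: "2 * R < 2 ^ Suc j"
    and early: "\<And>x t. 0 < t \<Longrightarrow> t < R / 2 \<Longrightarrow> norm x \<le> r0 + t \<Longrightarrow> dalembertian \<Psi> (x, t) = 0"
    and late: "\<And>x t. R / 2 \<le> t \<Longrightarrow> t \<le> R \<Longrightarrow> norm x \<le> r0 + t \<Longrightarrow>
      \<bar>dalembertian \<Psi> (x, t)\<bar> \<le> cutoff p R t powr (1 / p)
        * (K0 * R powr (- ((real DIM('a) + 1) / 2)) * (t + l - norm x) powr (- \<delta>))"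
    and K0: "0 < K0" and \<delta>: "0 \<le> \<delta>" and S: "(\<Sum>k\<le>j. (2 ^ k) powr (1 - \<delta> * (p / (p - 1)))) \<le> S"
    and X: "0 < X" "X \<le> \<epsilon> * initial \<Psi> + (LINT t:{0<..R}|lebesgue. P t * source u t)"
  shows "X powr p \<le> cone_const K0 * S powr (p - 1)
    * R powr (real DIM('a) * (p - 1) - (real DIM('a) + 1) * p / 2) * tail u R"
proof -
  let ?N = "real DIM('a)" and ?q = "p / (p - 1)"
  define V where "V = unit_ball_vol ?N * ?N"
  have V: "0 < V" by (simp add: V_def unit_ball_vol_pos)
  have S0: "0 < S"
  proof -
    have "0 < (\<Sum>k\<le>j. (2 ^ k) powr (1 - \<delta> * ?q))" by (intro sum_pos) auto
    then show ?thesis using S by linarith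
  qed
  define \<kappa> where "\<kappa> = (K0 * R powr (- ((?N + 1) / 2))) powr ?q"
  have \<kappa>: "0 < \<kappa>" using K0 R by (simp add: \<kappa>_def)
  define b where "b = \<kappa> * (V * (2 * R) ^ (DIM('a) - 1) * S)"
  have Kq: "indicator (cball 0 (r0 + t)) x * (K0 * R powr (- ((?N + 1) / 2)) * (t + l
      - norm x) powr (- \<delta>)) powr ?q
      = indicator (cball 0 (r0 + t)) x * (\<kappa> * (t + l - norm x) powr (- (\<delta> * ?q)))" for t and x :: 'a
    by (simp add: \<kappa>_def powr_mult powr_powr)
  have "X powr p \<le> 2 powr p * (R * b) powr (p - 1) * (tail u R / a)"
  proof (rule tail_test[OF sol \<Psi> R P early late _ _ _ _ X])
    show "0 < b" using \<kappa> V R S0 by (simp add: b_def)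
    show "0 \<le> K0 * R powr (- ((?N + 1) / 2)) * (t + l - norm x) powr (- \<delta>)" for t and x :: 'a
      using K0 by simp
    fix t assume t: "R / 2 \<le> t" "t \<le> R"
    have t0: "0 \<le> t" "t + l < 2 ^ Suc j" "t + l \<le> 2 * R" using t R l j by linarith+
    have dq: "0 \<le> \<delta> * ?q" using \<delta> p by simp
    note I = cone_weight_integral[OF t0(1) r0 l(1) t0(2) dq less_imp_le[OF \<kappa>], where 'a = 'a]
    show "integrable lebesgue (\<lambda>x::'a. indicator (cball 0 (r0 + t)) x
        * (K0 * R powr (- ((?N + 1) / 2)) * (t + l - norm x) powr (- \<delta>)) powr ?q)"
      unfolding Kq by (rule I)
    have "(\<integral>x. indicator (cball (0::'a) (r0 + t)) x
        * (K0 * R powr (- ((?N + 1) / 2)) * (t + l - norm x) powr (- \<delta>)) powr ?q \<partial>lebesgue)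
        \<le> \<kappa> * (V * (t + l) ^ (DIM('a) - 1) * (\<Sum>k\<le>j. (2 ^ k) powr (1 - \<delta> * ?q)))"
      unfolding Kq V_def by (rule I)
    also have "\<dots> \<le> b"
      unfolding b_def using t0 \<kappa> V S R l r0
      by (intro mult_left_mono mult_mono power_mono sum_nonneg mult_nonneg_nonneg) auto
    finally show "(\<integral>x. indicator (cball (0::'a) (r0 + t)) x
        * (K0 * R powr (- ((?N + 1) / 2)) * (t + l - norm x) powr (- \<delta>)) powr ?q \<partial>lebesgue) \<le> b" .
  qed
  also have "R * b = (K0 powr ?q * (V * 2 ^ (DIM('a) - 1))) * S * R powr (?N - (?N + 1) / 2 * ?q)"
  proof -
    have "R * R ^ (DIM('a) - 1) = R powr ?N"
      using R by (simp add: powr_realpow power_Suc[symmetric] del: power_Suc)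
    moreover have "R powr (?N - (?N + 1) / 2 * ?q) = R powr ?N * (R powr (- ((?N + 1) / 2))) powr ?q"
      by (simp only: powr_powr powr_add[symmetric]) (simp add: algebra_simps)
    ultimately show ?thesis
      by (simp add: b_def \<kappa>_def powr_mult power_mult_distrib mult_ac)
  qed
  also have "\<dots> powr (p - 1) = (K0 powr ?q * (V * 2 ^ (DIM('a) - 1))) powr (p - 1) * S powr (p - 1)
      * R powr (?N * (p - 1) - (?N + 1) * p / 2)"
  proof -
    have "(?N - (?N + 1) / 2 * ?q) * (p - 1) = ?N * (p - 1) - (?N + 1) * p / 2"
      using p by (simp add: field_simps)
    then show ?thesis by (simp only: powr_mult powr_powr)
  qed
  finally show ?thesis by (simp add: cone_const_def V_def mult_ac)
qed

text \<open>With m = (N + 1)/2 and \<zeta> equal to (t + l) times the cutoff, all terms of the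
  d'Alembertian without a derivative of the cutoff cancel. The source on the left is dropped through
  P = 0, so the data term alone bounds the tail from below. For \<delta> = m + 1 the dyadic sum is
  geometric, and no logarithm appears.\<close>

lemma lower_test:
  obtains C l where "0 < C" "1 \<le> l"
    "\<And>\<epsilon> T u R. solution \<epsilon> T u \<Longrightarrow> 0 < \<epsilon> \<Longrightarrow> l \<le> R \<Longrightarrow> ereal R < T \<Longrightarrow>
      \<epsilon> powr p \<le> C * R powr (real DIM('a) * (p - 1) - (real DIM('a) + 1) * p / 2) * tail u R"
proof -
  let ?N = "real DIM('a)" and ?q = "p / (p - 1)"
  define m where "m = (?N + 1) / 2"
  have m: "1 \<le> m" using DIM_positive[where 'a = 'a] by (simp add: m_def field_simps Suc_le_eq[symmetric])
  obtain C0 where C0: "0 < C0"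
    "\<And>R t. 0 < R \<Longrightarrow> \<bar>partial 1 (cutoff p R) t\<bar> \<le> C0 / R * cutoff p R t powr (1 / p)"
    "\<And>R t. 0 < R \<Longrightarrow> \<bar>partial 1 (partial 1 (cutoff p R)) t\<bar> \<le> C0 / R\<^sup>2 * cutoff p R t powr (1 / p)"
    using cutoff_derivatives_bound[OF p] by metis
  obtain s0 where s0: "\<And>s. s0 \<le> s \<Longrightarrow> 0 < (\<integral>x. g x * shape m s x \<partial>lebesgue)
      - (\<integral>x. f x * (1 / s * shape m s x + (- (2 * m)) / s * shape (m + 1) s x) \<partial>lebesgue)"
    using initial_shape_pos[of m 1 "- (2 * m)"] m by auto
  define l where "l = max s0 (r0 + 2)"
  have l: "s0 \<le> l" "r0 + 2 \<le> l" "1 \<le> l" using r0 by (auto simp: l_def)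
  \<comment> \<open>This is \<open>initial \<Psi>\<close>, the same for all R because the cutoff is
    1 near time 0. The additional factor l in \<open>l powr (1 - 2 * m)\<close> is the value of
    \<zeta> at time 0.\<close>
  define J where "J = l powr (1 - 2 * m) * ((\<integral>x. g x * shape m l x \<partial>lebesgue)
      - (\<integral>x. f x * (1 / l * shape m l x + (- (2 * m)) / l * shape (m + 1) l x) \<partial>lebesgue))"
  have J: "0 < J" using s0[OF l(1)] l by (simp add: J_def)
  \<comment> \<open>The 4 collects the two terms with \<open>lorentz powr (- m)\<close>, the 4 m the
    mixed term, and \<open>2 powr (m - 1)\<close> comes from t + l \<ge> R/2.\<close>
  define K0 where "K0 = (4 + 4 * m) * C0 * 2 powr (m - 1)"
  have K0: "0 < K0" using C0 m by (simp add: K0_def)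
  define \<gamma> where "\<gamma> = (m + 1) * ?q"
  have \<gamma>: "1 < \<gamma>"
  proof -
    have "1 < ?q" using p by simp
    then have "1 * 1 < (m + 1) * ?q" using m by (intro mult_strict_mono) auto
    then show ?thesis by (simp add: \<gamma>_def)
  qed
  define S where "S = 1 / (1 - 2 powr (1 - \<gamma>))"
  have S: "0 < S" using \<gamma> by (simp add: S_def powr_less_one)
  define e where "e = ?N * (p - 1) - (?N + 1) * p / 2"
  have main: "(\<epsilon> * J) powr p \<le> cone_const K0 * S powr (p - 1) * R powr e * tail u R"
    if sol: "solution \<epsilon> T u" and \<epsilon>: "0 < \<epsilon>" and R: "l \<le> R" "ereal R < T" for \<epsilon> T u R
  proof -
    have R0: "0 < R" "1 \<le> 2 * R" using R l by auto
    obtain j where j: "2 * R < 2 ^ Suc j" using dyadic_index[OF R0(2)] by blast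
    define \<zeta> where "\<zeta> t = (1 * (t + l)) * cutoff p R t" for t
    have lin: "smooth (\<lambda>t::real. 1 * (t + l))" by (intro smooth_mult smooth_add smooth_const smooth_id)
    have s\<zeta>: "smooth \<zeta>" unfolding \<zeta>_def[abs_def] by (intro smooth_mult[OF lin smooth_cutoff])
    have d\<zeta>: "partial 1 \<zeta> = (\<lambda>t. (1 * (t + l)) * partial 1 (cutoff p R) t + 1 * cutoff p R t)"
      unfolding \<zeta>_def[abs_def]
      by (rule ext) (simp only: partial_real_mult[OF lin smooth_cutoff] partial_shift)
    have sc1: "smooth (partial 1 (cutoff p R))" by (intro smooth_partial smooth_cutoff) simp
    have dd\<zeta>: "partial 1 (partial 1 \<zeta>) t = (t + l) * partial 1 (partial 1 (cutoff p R)) t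
        + 2 * partial 1 (cutoff p R) t" for t
    proof -
      have "partial 1 (partial 1 \<zeta>) t = partial 1 (\<lambda>t. (1 * (t + l)) * partial 1 (cutoff p R) t) t
          + partial 1 (\<lambda>t. 1 * cutoff p R t) t"
        unfolding d\<zeta> by (intro partial_add smooth_differentiable smooth_mult lin sc1 smooth_cutoff
            smooth_const)
      also have "partial 1 (\<lambda>t. (1 * (t + l)) * partial 1 (cutoff p R) t) t
          = (1 * (t + l)) * partial 1 (partial 1 (cutoff p R)) t + 1 * partial 1 (cutoff p R) t"
        by (simp only: partial_real_mult[OF lin sc1] partial_shift)
      finally show ?thesis by simp
    qed
    define \<Psi> where "\<Psi> = (cone_fun l \<zeta> (spow (- m)) :: 'a \<times> real \<Rightarrow> real)"
    have dal: "dalembertian \<Psi> (x, t) =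
        ((t + l) * partial 1 (partial 1 (cutoff p R)) t
            + 2 * partial 1 (cutoff p R) t) * lorentz l (x, t) powr (- m)
        - 4 * m * ((t + l)\<^sup>2 * partial 1 (cutoff p R) t) * lorentz l (x, t) powr (- m - 1)"
      if "0 \<le> t" "norm x \<le> r0 + t" for x t
    proof -
      have c: "2 * m + 1 - ?N = 2" by (simp add: m_def field_simps)
      have v: "\<zeta> t = (t + l) * cutoff p R t"
        "partial 1 \<zeta> t = (t + l) * partial 1 (cutoff p R) t + cutoff p R t"
        by (simp_all add: \<zeta>_def d\<zeta>)
      show ?thesis
        unfolding \<Psi>_def dalembertian_cone_powr[OF s\<zeta> lorentz_bounds(1)[OF that r0 l(2)]] snd_conv v dd\<zeta> c
        by (simp add: power2_eq_square algebra_simps)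
    qed
    have init: "initial \<Psi> = J"
    proof -
      have z0: "\<zeta> 0 = l" "partial 1 \<zeta> 0 = 1"
        using R0 by (auto simp: \<zeta>_def d\<zeta> cutoff_0)
      have "(\<integral>x. g x * (l * shape m l x) \<partial>lebesgue) - (\<integral>x. f x * (1 * shape m l x
          + l * (- (2 * m) / l) * shape (m + 1) l x) \<partial>lebesgue)
        = l * ((\<integral>x. g x * shape m l x \<partial>lebesgue) - (\<integral>x. f x * (1 / l * shape m l x
            + (- (2 * m)) / l * shape (m + 1) l x) \<partial>lebesgue))"
      proof -
        have "f x * (1 * shape m l x + l * (- (2 * m) / l) * shape (m + 1) l x)
            = l * (f x * (1 / l * shape m l x + (- (2 * m)) / l * shape (m + 1) l x))" for x
          using l by (simp add: field_simps)
        then show ?thesis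
          by (simp only: right_diff_distrib
              Bochner_Integration.integral_mult_right_zero[symmetric] mult.left_commute[of _ l])
      qed
      moreover have "l powr (1 - 2 * m) = l powr (- (2 * m)) * l"
        using l powr_add[of l "- (2 * m)" 1] by simp
      ultimately show ?thesis
        unfolding \<Psi>_def initial_cone_fun[OF s\<zeta> l(2)] z0 J_def by (simp only: mult.assoc)
    qed
    have \<Psi>_pos: "0 \<le> \<Psi> (x, t)" if "0 < t" for x t
      using that l by (simp add: \<Psi>_def cone_fun_def \<zeta>_def cutoff_bounds spow_nonneg)
    have "(\<epsilon> * J) powr p \<le> cone_const K0 * S powr (p - 1)
        * R powr (?N * (p - 1) - (?N + 1) * p / 2) * tail u R"
    proof (rule tail_test_cone[OF sol, where \<Psi> = \<Psi> and \<rho> = "3 * R / 4 + l" and P = "\<lambda>_. 0" and B = 0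
          and l = l and j = j and \<delta> = "m + 1"])
      show "smooth \<Psi>" unfolding \<Psi>_def by (rule smooth_cone_fun[OF s\<zeta> smooth_spow])
      show "cyl_supp (3 * R / 4) (3 * R / 4 + l) \<Psi>"
        unfolding \<Psi>_def
        by (rule cyl_supp_cone_fun) (use cutoff_eq_0[OF p R0(1)] l in \<open>auto simp: spow_0 \<zeta>_def\<close>)
      show "dalembertian \<Psi> (x, t) = 0" if "0 < t" "t < R / 2" "norm x \<le> r0 + t" for x t
        using that dal[of t x] cutoff_derivatives_0[OF R0(1), of t p] by simp
      show "(\<Sum>k\<le>j. (2 ^ k) powr (1 - (m + 1) * (p / (p - 1)))) \<le> S"
        unfolding \<gamma>_def[symmetric] S_def dyadic_powr lessThan_Suc_atMost[symmetric]
        by (rule geometric_sum_le) (use \<gamma> in \<open>auto simp: powr_less_one\<close>)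
      show "\<epsilon> * J \<le> \<epsilon> * initial \<Psi> + (LINT t:{0<..R}|lebesgue. 0 * source u t)" by (simp add: init)
      fix x :: 'a and t assume t: "R / 2 \<le> t" "t \<le> R" "norm x \<le> r0 + t"
      have t0: "0 \<le> t" "0 < t + l" "t + l \<le> 2 * R" "R / 2 \<le> t + l" using t R l R0 by linarith+
      note lb = lorentz_bounds[OF t0(1) t(3) r0 l(2)]
      let ?w = "cutoff p R t powr (1 / p)" and ?Q = "lorentz l (x, t)" and ?d = "t + l - norm x"
      have "\<bar>(t + l) * partial 1 (partial 1 (cutoff p R)) t + 2 * partial 1 (cutoff p R) t\<bar>
          \<le> (t + l) * \<bar>partial 1 (partial 1 (cutoff p R)) t\<bar> + 2 * \<bar>partial 1 (cutoff p R) t\<bar>"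
        using t0 by (intro order_trans[OF abs_triangle_ineq]) (simp add: abs_mult)
      also have "\<dots> \<le> (2 * R) * (C0 / R\<^sup>2 * ?w) + 2 * (C0 / R * ?w)"
        using t0 C0 R0 by (intro add_mono mult_mono C0(2,3)) auto
      also have "\<dots> = 4 * (C0 / R * ?w)" using R0 by (simp add: power2_eq_square field_simps)
      finally have 1: "\<bar>(t + l) * partial 1 (partial 1 (cutoff p R)) t
          + 2 * partial 1 (cutoff p R) t\<bar> \<le> 4 * (C0 / R * ?w)" .
      have Qm: "?Q powr (- m) \<le> (t + l)\<^sup>2 * ?Q powr (- m - 1)"
        using lorentz_powr_le(2)[OF t0(1) t(3) r0 l(2), of m] m by simp
      have w: "0 \<le> C0 / R * ?w" using C0(1) R0 by simp
      let ?X = "(t + l) * partial 1 (partial 1 (cutoff p R)) t + 2 * partial 1 (cutoff p R) t"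
      have "\<bar>?X * ?Q powr (- m)\<bar> = \<bar>?X\<bar> * ?Q powr (- m)"
          by (simp only: abs_mult abs_of_nonneg powr_ge_zero)
      also have "\<dots> \<le> 4 * (C0 / R * ?w) * ((t + l)\<^sup>2 * ?Q powr (- m - 1))"
        by (rule mult_mono[OF 1 Qm]) (use w in auto)
      finally have 2: "\<bar>?X * ?Q powr (- m)\<bar> \<le> 4 * (C0 / R * ?w) * ((t + l)\<^sup>2 * ?Q powr (- m - 1))" .
      have "\<bar>4 * m * ((t + l)\<^sup>2 * partial 1 (cutoff p R) t) * ?Q powr (- m - 1)\<bar>
          = 4 * m * ((t + l)\<^sup>2 * \<bar>partial 1 (cutoff p R) t\<bar>) * ?Q powr (- m - 1)"
        using m by (simp add: abs_mult)
      also have "\<dots> \<le> 4 * m * ((t + l)\<^sup>2 * (C0 / R * ?w)) * ?Q powr (- m - 1)"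
        using m by (intro mult_left_mono mult_right_mono C0(2) R0) auto
      finally have 3: "\<bar>4 * m * ((t + l)\<^sup>2 * partial 1 (cutoff p R) t) * ?Q powr (- m - 1)\<bar>
          \<le> 4 * m * ((t + l)\<^sup>2 * (C0 / R * ?w)) * ?Q powr (- m - 1)" .
      have "\<bar>dalembertian \<Psi> (x, t)\<bar> \<le> 4 * (C0 / R * ?w) * ((t + l)\<^sup>2 * ?Q powr (- m - 1))
          + 4 * m * ((t + l)\<^sup>2 * (C0 / R * ?w)) * ?Q powr (- m - 1)"
        unfolding dal[OF t0(1) t(3)]
        by (rule order_trans[OF abs_triangle_ineq4 add_mono[OF 2 3]])
      also have "\<dots> = (4 + 4 * m) * C0 / R * ?w * ((t + l)\<^sup>2 * ?Q powr (- m - 1))"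
        by (simp add: algebra_simps add_divide_distrib)
      also have "\<dots> \<le> (4 + 4 * m) * C0 / R * ?w * (2 powr (m - 1) * R powr (- (m
          - 1)) * ?d powr (- (m + 1)))"
      proof (rule mult_left_mono)
        have "?Q powr (- m - 1) \<le> (t + l) powr (- (m + 1)) * ?d powr (- (m + 1))"
          using lorentz_powr_le(1)[OF t0(1) t(3) r0 l(2), of "m + 1"] m by (simp add: minus_diff_commute)
        then have "(t + l)\<^sup>2 * ?Q powr (- m - 1) \<le> (t + l)\<^sup>2 * ((t + l) powr (- (m
            + 1)) * ?d powr (- (m + 1)))"
          by (intro mult_left_mono) auto
        also have "\<dots> = (t + l) powr (- (m - 1)) * ?d powr (- (m + 1))"
        proof -
          have "- (m - 1) = 2 + (- (m + 1))" by simp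
          then have "(t + l) powr (- (m - 1)) = (t + l) powr 2 * (t + l) powr (- (m + 1))"
              by (simp only: powr_add)
          then show ?thesis using t0 by simp
        qed
        also have "\<dots> \<le> (R / 2) powr (- (m - 1)) * ?d powr (- (m + 1))"
          using t0 m R0 by (intro mult_right_mono powr_mono2') auto
        also have "(R / 2) powr (- (m - 1)) = 2 powr (m - 1) * R powr (- (m - 1))"
          by (simp only: powr_divide powr_minus_divide[of 2 "m - 1"]) simp
        finally show "(t + l)\<^sup>2 * ?Q powr (- m - 1) \<le> 2 powr (m - 1) * R powr (- (m
            - 1)) * ?d powr (- (m + 1))" .
      qed (use m C0(1) R0 in simp)
      also have "(4 + 4 * m) * C0 / R * ?w * (2 powr (m - 1) * R powr (- (m - 1)) * ?d powr (- (m + 1)))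
          = ?w * (K0 * (R powr (- (m - 1)) / R) * ?d powr (- (m + 1)))"
        by (simp add: K0_def field_simps)
      also have "R powr (- (m - 1)) / R = R powr (- ((?N + 1) / 2))"
      proof -
        have "- (m - 1) = - ((?N + 1) / 2) + 1" unfolding m_def by linarith
        then have "R powr (- (m - 1)) = R powr (- ((?N + 1) / 2)) * R powr 1" by (simp only: powr_add)
        then show ?thesis using R0 by simp
      qed
      finally show "\<bar>dalembertian \<Psi> (x, t)\<bar> \<le> ?w * (K0 * R powr (- ((?N + 1) / 2)) * ?d powr (- (m
          + 1)))" .
    qed (use \<Psi>_pos R R0 l j K0 m \<epsilon> J in auto)
    then show ?thesis by (simp add: e_def)
  qed
  show thesis
  proof (rule that[of "cone_const K0 * S powr (p - 1) / J powr p" l])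
    show "0 < cone_const K0 * S powr (p - 1) / J powr p" using cone_const_pos[OF K0] S J by simp
    fix \<epsilon> T u R assume "solution \<epsilon> T u" "0 < \<epsilon>" "l \<le> R" "ereal R < T"
    from main[OF this] show "\<epsilon> powr p \<le> cone_const K0 * S powr (p - 1) / J powr p
        * R powr (?N * (p - 1) - (?N + 1) * p / 2) * tail u R"
      using J by (simp add: e_def powr_mult field_simps)
  qed (rule l)
qed

text \<open>Each summand with m = (N - 1)/2 solves the wave equation on the cone before the cutoff
  acts. From below, the one shift of size comparable to 1 + t already gives the weight; from above,
  all shifts together give a multiple of \<open>d powr (- B)\<close>.\<close>

lemma critical_test:
  fixes \<beta> :: real
  defines "\<beta> \<equiv> (real DIM('a) - 1) / 2 - 1 / p"
  assumes N: "2 \<le> DIM('a)" and \<beta>: "0 \<le> \<beta>"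
  obtains C l :: real where "0 < C" "1 \<le> l"
    "\<And>\<epsilon> T u j. solution \<epsilon> T u \<Longrightarrow> 0 < \<epsilon> \<Longrightarrow> 1 \<le> j \<Longrightarrow> l \<le> 2 ^ j \<Longrightarrow> ereal (2 ^ j) < T \<Longrightarrow>
      (LINT t:{0<..2 ^ j}|lebesgue. ((1 + \<bar>t\<bar>) powr (- \<beta>) * cutoff p (2 ^ j) t) * source u t) powr p
      \<le> C * real j powr (p - 1) * (2 ^ j) powr (real DIM('a) * (p - 1) - (real DIM('a)
          + 1) * p / 2) * tail u (2 ^ j)"
proof -
  let ?N = "real DIM('a)" and ?q = "p / (p - 1)"
  define m where "m = (?N - 1) / 2"
  have m: "0 < m" using N by (simp add: m_def)
  \<comment> \<open>A and B are determined by A + B = m + 1, the decay of a single summand in its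
    distance to the cone, and B * p/(p - 1) = 1, the borderline of integrability across the
    cone.\<close>
  define A where "A = m + 1 / p"
  define B where "B = 1 - 1 / p"
  have AB: "0 < A" "0 < B" "A + B = m + 1" "A - 2 * m = - \<beta>" "B * ?q = 1"
  proof -
    show "0 < A" using m p unfolding A_def by (intro add_pos_pos) auto
    show "0 < B" "A + B = m + 1" "B * ?q = 1" using p by (auto simp: A_def B_def field_simps)
    show "A - 2 * m = - \<beta>" by (simp add: A_def \<beta>_def m_def field_simps)
  qed
  obtain C0 where C0: "0 < C0"
    "\<And>R t. 0 < R \<Longrightarrow> \<bar>partial 1 (cutoff p R) t\<bar> \<le> C0 / R * cutoff p R t powr (1 / p)"
    "\<And>R t. 0 < R \<Longrightarrow> \<bar>partial 1 (partial 1 (cutoff p R)) t\<bar> \<le> C0 / R\<^sup>2 * cutoff p R t powr (1 / p)"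
    using cutoff_derivatives_bound[OF p] by metis
  obtain s0 where s0: "\<And>s. s0 \<le> s \<Longrightarrow> 0 < (\<integral>x. g x * shape m s x \<partial>lebesgue)
      - (\<integral>x. f x * (0 / s * shape m s x + (- (2 * m)) / s * shape (m + 1) s x) \<partial>lebesgue)"
    using initial_shape_pos[of m 0 "- (2 * m)"] m by auto
  define l where "l = max s0 (r0 + 2)"
  have l: "s0 \<le> l" "r0 + 2 \<le> l" "1 \<le> l" using r0 by (auto simp: l_def)
  define D where "D = 1 / (1 - 2 powr (- A)) + 1 / (1 - 2 powr (- B))"
  have D: "0 < D" using AB by (auto simp: D_def powr_less_one intro!: add_pos_pos)
  define K1 where "K1 = C0 * (1 + l + 4 * m) * 2 powr m"
  have K1: "0 < K1" using C0 m l by (simp add: K1_def)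
  \<comment> \<open>From t + s k \<le> (2 + l) 2^k for the k with 2^k \<le> 1 + t < 2^(k +
    1).\<close>
  define c where "c = (2 + l) powr (- (2 * m))"
  have c: "0 < c" using l by (simp add: c_def)
  define s where "s k = l * 2 ^ k" for k :: nat
  have s: "l \<le> s k" "r0 + 2 \<le> s k" "0 < s k" for k
  proof -
    have "l * 1 \<le> l * 2 ^ k" using l by (intro mult_left_mono) auto
    then show "l \<le> s k" by (simp add: s_def)
    then show "r0 + 2 \<le> s k" "0 < s k" using l by linarith+
  qed
  define e where "e = ?N * (p - 1) - (?N + 1) * p / 2"
  define weight where "weight t = (1 + \<bar>t\<bar>) powr (- \<beta>)" for t :: real
  have weight: "0 \<le> weight t" "weight t \<le> 1" for t
    using powr_mono2'[of "- \<beta>" 1 "1 + \<bar>t\<bar>"] \<beta> by (auto simp: weight_def)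
  have weight_meas: "weight \<in> borel_measurable borel"
    unfolding weight_def by (intro borel_measurable_continuous_onI continuous_intros) auto
  define X where "X u j = (LINT t:{0<..2 ^ j}|lebesgue. (weight t * cutoff p (2 ^ j) t) * source u
      t)" for u and j :: nat
  have main: "(c * X u j) powr p \<le> cone_const (K1 * D) * (3 * real j) powr (p
      - 1) * (2 ^ j) powr e * tail u (2 ^ j)"
    if sol: "solution \<epsilon> T u" and \<epsilon>: "0 < \<epsilon>" and j: "1 \<le> j" and R: "l \<le> 2 ^ j" "ereal (2 ^ j) < T"
      and X: "0 < X u j" for \<epsilon> T u j
  proof -
    define R where "R = (2::real) ^ j"
    have R0: "0 < R" "l \<le> R" "ereal R < T" using R by (simp_all add: R_def)
    define F where "F k = (cone_fun (s k) (cutoff p R) (spow (- m)) :: 'a \<times> real \<Rightarrow> real)" for k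
    have F: "smooth (F k)" for k unfolding F_def by (rule smooth_cone_fun[OF smooth_cutoff smooth_spow])
    define \<Psi> where "\<Psi> z = (\<Sum>k\<le>j. (2 ^ k) powr A * F k z)" for z
    have F_pos: "0 \<le> F k z" for k z by (simp add: F_def cone_fun_def cutoff_bounds spow_nonneg)
    have \<Psi>: "smooth \<Psi>" "cyl_supp (3 * R / 4) (3 * R / 4 + s j) \<Psi>" "\<And>z. 0 \<le> \<Psi> z"
    proof -
      show "smooth \<Psi>" unfolding \<Psi>_def[abs_def] by (intro smooth_sum smooth_mult smooth_const F) simp
      have "s k \<le> s j" if "k \<le> j" for k
        using that l by (simp add: s_def)
      then have "cyl_supp (3 * R / 4) (3 * R / 4 + s j) (F k)" if "k \<le> j" for k
        unfolding F_def
        by (intro cyl_supp_cone_fun) (use cutoff_eq_0[OF p R0(1)] s(3)[of k] that in \<open>auto simp: spow_0\<close>)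
      then show "cyl_supp (3 * R / 4) (3 * R / 4 + s j) \<Psi>"
        unfolding \<Psi>_def[abs_def] by (intro cyl_supp_sum cyl_supp_cmult) auto
      show "0 \<le> \<Psi> z" for z unfolding \<Psi>_def by (intro sum_nonneg mult_nonneg_nonneg F_pos) auto
    qed
    have dal: "dalembertian (F k) (x, t) = partial 1 (partial 1 (cutoff p R)) t * lorentz (s k)
        (x, t) powr (- m)
        - 4 * m * (t + s k) * partial 1 (cutoff p R) t * lorentz (s k) (x, t) powr (- m - 1)"
      if "0 \<le> t" "norm x \<le> r0 + t" for x t k
    proof -
      have "2 * m + 1 - ?N = 0" by (simp add: m_def field_simps)
      then show ?thesis
        unfolding F_def dalembertian_cone_powr[OF smooth_cutoff lorentz_bounds(1)[OF that r0
            s(2)]] by simp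
    qed
    have dal\<Psi>: "dalembertian \<Psi> z = (\<Sum>k\<le>j. (2 ^ k) powr A * dalembertian (F k) z)" for z
      unfolding \<Psi>_def[abs_def] by (intro dalembertian_sum F) simp
    \<comment> \<open>Only the sign of the data term matters here; it is then discarded.\<close>
    have init: "0 \<le> initial \<Psi>"
    proof -
      have "0 \<le> initial (F k)" for k
        unfolding F_def initial_cone_fun[OF smooth_cutoff s(2)]
            using s0[OF order_trans[OF l(1) s(1)], of k] R0
        by (simp add: cutoff_0)
      then show ?thesis
        unfolding \<Psi>_def[abs_def] by (subst initial_sum) (auto intro!: F sum_nonneg mult_nonneg_nonneg)
    qed
    have lower: "c * (weight t * cutoff p R t) \<le> \<Psi> (x, t)"
      if t: "0 < t" "t \<le> R" "norm x \<le> r0 + t" for x t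
    proof -
      have "1 \<le> 1 + t" using t by simp
      then obtain k where k: "2 ^ k \<le> 1 + t" "1 + t < 2 ^ Suc k" using dyadic_index by blast
      have "(2::real) ^ 1 \<le> 2 ^ j" using j by (intro power_increasing) auto
      then have "(2::real) ^ k < 2 ^ Suc j" using k(1) t(2) by (simp add: R_def)
      then have kj: "k \<le> j" by (simp add: power_strict_increasing_iff del: power_Suc)
      note q = lorentz_bounds[OF less_imp_le[OF t(1)] t(3) r0 s(2), of k]
      have "t + s k \<le> (2 + l) * 2 ^ k" using k(2) by (simp add: s_def algebra_simps)
      then have "(t + s k)\<^sup>2 \<le> ((2 + l) * 2 ^ k)\<^sup>2" using t s(3)[of k] by (intro power_mono) auto
      then have "((2 + l) * 2 ^ k)\<^sup>2 powr (- m) \<le> lorentz (s k) (x, t) powr (- m)"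
        using q m by (intro powr_mono2') auto
      also have "((2 + l) * 2 ^ k)\<^sup>2 powr (- m) = c * (2 ^ k) powr (- (2 * m))"
      proof -
        have "((2 + l) * 2 ^ k)\<^sup>2 = ((2 + l) * 2 ^ k) powr 2" using l by simp
        then show ?thesis by (simp only: powr_powr c_def) (simp add: powr_mult)
      qed
      finally have "(2 ^ k) powr A * (c * (2 ^ k) powr (- (2 * m)))
          \<le> (2 ^ k) powr A * lorentz (s k) (x, t) powr (- m)"
        by (intro mult_left_mono) auto
      also have "(2 ^ k) powr A * (c * (2 ^ k) powr (- (2 * m))) = c * (2 ^ k) powr (- \<beta>)"
        unfolding AB(4)[symmetric] by (simp add: powr_add[symmetric] mult.left_commute)
      finally have "c * (2 ^ k) powr (- \<beta>) \<le> (2 ^ k) powr A * lorentz (s k) (x, t) powr (- m)" .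
      moreover have "c * weight t \<le> c * (2 ^ k) powr (- \<beta>)"
        unfolding weight_def using c k(1) t \<beta> by (intro mult_left_mono powr_mono2') auto
      ultimately have "c * weight t * cutoff p R t \<le> (2 ^ k) powr A * lorentz (s k) (x, t) powr (-
          m) * cutoff p R t"
        by (intro mult_right_mono cutoff_bounds) linarith
      also have "\<dots> = (2 ^ k) powr A * F k (x, t)"
        using q by (simp add: F_def cone_fun_def spow_eq)
      also have "\<dots> \<le> \<Psi> (x, t)"
        unfolding \<Psi>_def using kj by (intro member_le_sum) (auto intro!: mult_nonneg_nonneg F_pos)
      finally show ?thesis by (simp add: mult.assoc)
    qed
    have late: "\<bar>dalembertian \<Psi> (x, t)\<bar> \<le> cutoff p R t powr (1 / p)
        * (K1 * D * R powr (- ((?N + 1) / 2)) * (t + l - norm x) powr (- B))"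
      if t: "R / 2 \<le> t" "t \<le> R" "norm x \<le> r0 + t" for x t
    proof -
      have t0: "0 \<le> t" using t R0 by linarith
      let ?w = "cutoff p R t powr (1 / p)" and ?d = "t + l - norm x"
      have d: "1 \<le> ?d" using t l by linarith
      define K2 where "K2 = ?w * K1 * R powr (- ((?N + 1) / 2))"
      have K2: "0 \<le> K2" using K1 by (simp add: K2_def)
      have tb: "\<bar>dalembertian (F k) (x, t)\<bar> \<le> K2 * max ?d (2 ^ k) powr (- (A + B))" if k: "k \<le> j" for k
      proof -
        let ?Q = "lorentz (s k) (x, t)" and ?r = "t + s k"
        have r: "0 < ?r" "R / 2 \<le> ?r" "?r \<le> (1 + l) * R"
        proof -
          show "0 < ?r" "R / 2 \<le> ?r" using t t0 s(3)[of k] by auto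
          have "s k \<le> l * R" using k l by (simp add: s_def R_def)
          then show "?r \<le> (1 + l) * R" using t by (simp add: distrib_right)
        qed
        have w: "0 \<le> C0 / R * ?w" using C0(1) R0 by simp
        have Qm: "?Q powr (- m) \<le> ?r\<^sup>2 * ?Q powr (- m - 1)"
          using lorentz_powr_le(2)[OF t0 t(3) r0 s(2), of m k] m by simp
        have "\<bar>partial 1 (partial 1 (cutoff p R)) t * ?Q powr (- m)\<bar>
            = \<bar>partial 1 (partial 1 (cutoff p R)) t\<bar> * ?Q powr (- m)"
          by (simp only: abs_mult abs_of_nonneg powr_ge_zero)
        also have "\<dots> \<le> (C0 / R\<^sup>2 * ?w) * (?r\<^sup>2 * ?Q powr (- m - 1))"
          by (rule mult_mono[OF C0(3)[OF R0(1)] Qm]) (use C0(1) in auto)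
        also have "\<dots> = (C0 / R * ?w) * (?r / R * (?r * ?Q powr (- m - 1)))"
          by (simp add: power2_eq_square)
        also have "\<dots> \<le> (C0 / R * ?w) * ((1 + l) * (?r * ?Q powr (- m - 1)))"
          using w r R0 by (intro mult_left_mono mult_right_mono) (auto simp: pos_divide_le_eq)
        finally have 1: "\<bar>partial 1 (partial 1 (cutoff p R)) t * ?Q powr (- m)\<bar>
            \<le> (C0 / R * ?w) * ((1 + l) * (?r * ?Q powr (- m - 1)))" .
        have "\<bar>4 * m * ?r * partial 1 (cutoff p R) t * ?Q powr (- m - 1)\<bar>
            = 4 * m * ?r * \<bar>partial 1 (cutoff p R) t\<bar> * ?Q powr (- m - 1)"
          using m r by (simp add: abs_mult)
        also have "\<dots> \<le> 4 * m * ?r * (C0 / R * ?w) * ?Q powr (- m - 1)"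
          using m r by (intro mult_left_mono mult_right_mono C0(2) R0) auto
        finally have 2: "\<bar>4 * m * ?r * partial 1 (cutoff p R) t * ?Q powr (- m - 1)\<bar>
            \<le> 4 * m * ?r * (C0 / R * ?w) * ?Q powr (- m - 1)" .
        have "\<bar>dalembertian (F k) (x, t)\<bar> \<le> (C0 / R * ?w) * ((1 + l) * (?r * ?Q powr (- m - 1)))
            + 4 * m * ?r * (C0 / R * ?w) * ?Q powr (- m - 1)"
          unfolding dal[OF t0 t(3)] by (rule order_trans[OF abs_triangle_ineq4 add_mono[OF 1 2]])
        also have "\<dots> = C0 / R * ?w * (1 + l + 4 * m) * (?r * ?Q powr (- m - 1))"
          by (simp add: algebra_simps add_divide_distrib)
        also have "\<dots> \<le> C0 / R * ?w * (1 + l + 4 * m) * (2 powr m * R powr (- m) * max ?d (2 ^ k)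
            powr (- (m + 1)))"
        proof (rule mult_left_mono)
          \<comment> \<open>Passing from the shift l to s k adds s k - l \<ge> 2^k - 1 to the
            distance, and both \<open>?d\<close> and 2^k are at least 1.\<close>
          have dk: "max ?d (2 ^ k) \<le> ?r - norm x"
          proof -
            have "1 * (2 ^ k - 1) \<le> l * (2 ^ k - 1)" using l by (intro mult_right_mono) auto
            then have "2 ^ k - 1 \<le> s k - l" by (simp add: s_def algebra_simps)
            then show ?thesis using d s(1)[of k] by auto
          qed
          have "?Q powr (- m - 1) \<le> ?r powr (- (m + 1)) * (?r - norm x) powr (- (m + 1))"
            using lorentz_powr_le(1)[OF t0 t(3) r0 s(2), of "m + 1" k] m
                by (simp add: minus_diff_commute)
          also have "\<dots> \<le> ?r powr (- (m + 1)) * max ?d (2 ^ k) powr (- (m + 1))"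
            using dk m d by (intro mult_left_mono powr_mono2') (auto simp: less_max_iff_disj)
          finally have "?r * ?Q powr (- m - 1) \<le> ?r * (?r powr (- (m
              + 1)) * max ?d (2 ^ k) powr (- (m + 1)))"
            using r by (intro mult_left_mono) auto
          also have "\<dots> = ?r powr (- m) * max ?d (2 ^ k) powr (- (m + 1))"
          proof -
            have "- m = 1 + (- (m + 1))" by simp
            then have "?r powr (- m) = ?r powr 1 * ?r powr (- (m + 1))" by (simp only: powr_add)
            then show ?thesis using r by simp
          qed
          also have "\<dots> \<le> (R / 2) powr (- m) * max ?d (2 ^ k) powr (- (m + 1))"
            using r m R0 by (intro mult_right_mono powr_mono2') auto
          also have "(R / 2) powr (- m) = 2 powr m * R powr (- m)"
            by (simp only: powr_divide powr_minus_divide[of 2 m]) simp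
          finally show "?r * ?Q powr (- m - 1) \<le> 2 powr m * R powr (- m) * max ?d (2 ^ k) powr (-
              (m + 1))" .
        qed (rule mult_nonneg_nonneg[OF w], use m l in simp)
        also have "C0 / R * ?w * (1 + l + 4 * m) * (2 powr m * R powr (- m) * max ?d (2 ^ k) powr
            (- (m + 1)))
            = ?w * K1 * (R powr (- m) / R) * max ?d (2 ^ k) powr (- (m + 1))"
          by (simp add: K1_def)
        also have "R powr (- m) / R = R powr (- ((?N + 1) / 2))"
        proof -
          have "- m = - ((?N + 1) / 2) + 1" by (simp add: m_def field_simps)
          then have "R powr (- m) = R powr (- ((?N + 1) / 2)) * R powr 1" by (simp only: powr_add)
          then show ?thesis using R0 by simp
        qed
        finally show ?thesis by (simp add: K2_def AB(3))
      qed
      have "\<bar>dalembertian \<Psi> (x, t)\<bar> \<le> (\<Sum>k\<le>j. (2 ^ k) powr A * \<bar>dalembertian (F k) (x, t)\<bar>)"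
        unfolding dal\<Psi> by (rule order_trans[OF sum_abs]) (simp add: abs_mult)
      also have "\<dots> \<le> (\<Sum>k\<le>j. (2 ^ k) powr A * (K2 * max ?d (2 ^ k) powr (- (A + B))))"
        by (intro sum_mono mult_left_mono tb) auto
      also have "\<dots> = K2 * (\<Sum>k\<le>j. (2 ^ k) powr A * max ?d (2 ^ k) powr (- (A + B)))"
        by (simp add: sum_distrib_left mult.left_commute)
      also have "\<dots> \<le> K2 * (D * ?d powr (- B))"
        unfolding D_def by (intro mult_left_mono dyadic_sum_max d AB K2)
      finally show ?thesis by (simp add: K2_def mult_ac)
    qed
    have "(c * X u j) powr p \<le> cone_const (K1 * D) * (3 * real j) powr (p - 1)
        * R powr (?N * (p - 1) - (?N + 1) * p / 2) * tail u R"
    proof (rule tail_test_cone[OF sol \<Psi>(1,2,3) R0(1,3), where P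
        = "\<lambda>t. c * (weight t * cutoff p R t)" and B = c
          and l = l and j = "Suc j" and \<delta> = B])
      show "(\<lambda>t. c * (weight t * cutoff p R t)) \<in> borel_measurable borel"
        by (intro borel_measurable_times weight_meas cutoff_measurable borel_measurable_const)
      show "0 \<le> c * (weight t * cutoff p R t)" "c * (weight t * cutoff p R t) \<le> c" for t
      proof -
        have "0 \<le> weight t * cutoff p R t" "weight t * cutoff p R t \<le> 1"
          using weight[of t] cutoff_bounds[of p R t] by (auto intro: mult_le_one)
        then show "0 \<le> c * (weight t * cutoff p R t)" "c * (weight t * cutoff p R t) \<le> c"
          using c by (auto intro: mult_left_le)
      qed
      show "2 * R < 2 ^ Suc (Suc j)" by (simp add: R_def)
      show "dalembertian \<Psi> (x, t) = 0" if "0 < t" "t < R / 2" "norm x \<le> r0 + t" for x t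
        using that cutoff_derivatives_0[OF R0(1), of t p] by (simp add: dal\<Psi> dal)
      \<comment> \<open>As B * ?q = 1, every term is 1, and the sum is the logarithm of R. The range
        ends at Suc j because 2 R = 2^(j + 1) has to lie strictly below the next power of 2.\<close>
      have "(\<Sum>k\<le>Suc j. (2 ^ k) powr (1 - B * ?q)) = real (Suc (Suc j))" unfolding AB(5) by simp
      then show "(\<Sum>k\<le>Suc j. (2 ^ k) powr (1 - B * ?q)) \<le> 3 * real j" using j by simp
      have "(LINT t:{0<..R}|lebesgue. c * (weight t * cutoff p R t) * source u t) = c * X u j"
        by (simp add: X_def R_def mult.assoc)
      then show "c * X u j \<le> \<epsilon> * initial \<Psi> + (LINT t:{0<..R}|lebesgue. c * (weight t * cutoff p R
          t) * source u t)"
        using \<epsilon> init by simp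
    qed (use lower late l R0 K1 D AB c X in auto)
    then show ?thesis by (simp add: e_def R_def)
  qed
  have X0: "0 \<le> X u j" for u j
    unfolding X_def set_lebesgue_integral_def
    by (intro Bochner_Integration.integral_nonneg) (auto simp: cutoff_bounds source_nonneg weight)
  let ?C = "cone_const (K1 * D) * 3 powr (p - 1) / c powr p"
  have C: "0 < ?C" using cone_const_pos[of "K1 * D"] K1 D c by simp
  show thesis
  proof (rule that[OF C l(3)])
    fix \<epsilon> T u j
    assume sol: "solution \<epsilon> T u" and \<epsilon>: "0 < \<epsilon>" and j: "1 \<le> j" and R: "l \<le> 2 ^ j" "ereal (2 ^ j) < T"
    have "X u j powr p \<le> ?C * real j powr (p - 1) * (2 ^ j) powr e * tail u (2 ^ j)"
    \<comment> \<open>The optimisation in \<theta> behind \<open>main\<close> requires a positive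
      X.\<close>
    proof (cases "X u j = 0")
      case True
      have "0 \<le> ?C * real j powr (p - 1) * (2 ^ j) powr e * tail u (2 ^ j)"
        using C tail_nonneg[of u "2 ^ j"] by (intro mult_nonneg_nonneg) auto
      then show ?thesis using True by simp
    next
      case False
      then have "0 < X u j" using X0[of u j] by simp
      from main[OF sol \<epsilon> j R this] show ?thesis
        using c by (simp add: powr_mult field_simps)
    qed
    then show "(LINT t:{0<..2 ^ j}|lebesgue. ((1 + \<bar>t\<bar>) powr (- \<beta>) * cutoff p (2 ^ j) t) * source
        u t) powr p
      \<le> ?C * real j powr (p - 1) * (2 ^ j) powr (?N * (p - 1) - (?N + 1) * p / 2) * tail u (2 ^ j)"
      by (simp add: X_def weight_def e_def)
  qed
qed

end

section \<open>Lifespan estimates\<close>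

lemma Gamma_S_strict_decreasing:
  assumes "1 < p" "p < q" shows "Gamma_S N q < Gamma_S N p"
proof -
  have "(1 + 1 / q) * inverse (q - 1) < (1 + 1 / p) * inverse (p - 1)"
    using assms by (intro mult_strict_mono less_imp_inverse_less add_strict_left_mono
        divide_strict_left_mono)
       (auto intro!: add_pos_pos)
  then show ?thesis by (simp add: Gamma_S_def)
qed

lemma Gamma_S_pos:
  assumes "1 < p" "1 \<le> N" "ereal p < p_S N" shows "0 < Gamma_S N p"
proof -
  obtain q where q: "ereal p < ereal q" "ereal q < p_S N" using ereal_dense2[OF assms(3)] by blast
  then have "0 \<le> Gamma_S N q" using assms by (subst Gamma_S_nonneg_iff) auto
  also have "\<dots> < Gamma_S N p" using assms q by (intro Gamma_S_strict_decreasing) auto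
  finally show ?thesis .
qed

text \<open>By continuity a positive value at p would persist at some q > p, and then q \<le> p_S N
  contradicts p = p_S N.\<close>

lemma Gamma_S_eq_0:
  assumes "1 < p" "1 \<le> N" "ereal p = p_S N" shows "Gamma_S N p = 0"
proof (rule ccontr)
  assume nz: "Gamma_S N p \<noteq> 0"
  have "0 \<le> Gamma_S N p" using assms by (simp add: Gamma_S_nonneg_iff)
  with nz have pos: "0 < Gamma_S N p" by simp
  have "isCont (Gamma_S N) p"
    unfolding Gamma_S_def using assms by (intro continuous_intros) auto
  then have "(Gamma_S N \<longlongrightarrow> Gamma_S N p) (at_right p)"
    unfolding isCont_def by (rule tendsto_within_subset) simp
  then have "\<forall>\<^sub>F q in at_right p. 0 < Gamma_S N q" using pos by (rule order_tendstoD)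
  then have "\<forall>\<^sub>F q in at_right p. 0 < Gamma_S N q \<and> p < q"
    by (auto simp: eventually_at_filter elim: eventually_mono)
  then obtain q where q: "0 < Gamma_S N q" "p < q"
    by (metis (no_types, lifting) eventually_happens trivial_limit_at_right_real)
  then have "ereal q \<le> p_S N" using assms by (subst Gamma_S_nonneg_iff[symmetric]) auto
  with q assms(3) show False by (metis ereal_less_eq(3) not_le)
qed

context semilinear_wave
begin

lemma tail_le_cutoff:
  assumes "solution \<epsilon> T u" "ereal R < T"
  shows "tail u R \<le> (LINT t:{0<..R}|lebesgue. cutoff p R t * source u t)"
  unfolding tail_def
  by (rule weight_integral_mono[OF assms tail_weight_measurable tail_weight_bounds(1,3)
        cutoff_measurable cutoff_bounds tail_weight_bounds(2)])

text \<open>Rests on the constant test function alone. For N = 1 its exponent 2p/(p - 1) - N - 1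
  exceeds \<open>Gamma_S N p\<close>; for N = 2 the difference is (2 - p)/(2p), which explains the
  change of regime at p = 2.\<close>

lemma lifespan_constant:
  assumes "real DIM('a) + 1 < 2 * p / (p - 1)"
  shows "\<exists>C>0. \<forall>\<epsilon> T u. 0 < \<epsilon> \<and> \<epsilon> \<le> 1 \<and> 0 < T \<and> solution \<epsilon> T u \<longrightarrow>
    T \<le> ereal (C * \<epsilon> powr (- (1 / (2 * p / (p - 1) - real DIM('a) - 1))))"
proof -
  let ?e = "2 * p / (p - 1) - real DIM('a) - 1"
  obtain C where C: "0 < C" "\<And>\<epsilon> T u R. solution \<epsilon> T u \<Longrightarrow> 0 < \<epsilon> \<Longrightarrow> 1 \<le> R \<Longrightarrow> ereal R < T \<Longrightarrow>
      \<epsilon> \<le> C * R powr (real DIM('a) + 1 - 2 * p / (p - 1))"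
    using constant_test by metis
  have e: "real DIM('a) + 1 - 2 * p / (p - 1) = - ?e" by simp
  have "T \<le> ereal ((C powr (1 / ?e) + 1) * \<epsilon> powr (- (1 / ?e)))"
    if "0 < \<epsilon>" "\<epsilon> \<le> 1" "0 < T" "solution \<epsilon> T u" for \<epsilon> T u
    by (rule lifespan_from_powr_bound) (use that C(1) C(2)[OF that(4,1), unfolded e] assms in auto)
  then show ?thesis by (intro exI[of _ "C powr (1 / ?e) + 1"]) (auto intro: add_nonneg_pos)
qed

text \<open>The lower bound of the tail from \<open>lower_test\<close> meets the upper bound from
  \<open>constant_test\<close>; the two exponents of R add up to -p times \<open>Gamma_S\<close>,
  and a p-th root gives the rate.\<close>

lemma lifespan_subcritical:
  assumes \<Gamma>: "0 < Gamma_S DIM('a) p"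
  shows "\<exists>C>0. \<forall>\<epsilon> T u. 0 < \<epsilon> \<and> \<epsilon> \<le> 1 \<and> 0 < T \<and> solution \<epsilon> T u \<longrightarrow>
    T \<le> ereal (C * \<epsilon> powr (- (1 / Gamma_S DIM('a) p)))"
proof -
  let ?\<Gamma> = "Gamma_S DIM('a) p" and ?N = "real DIM('a)"
  define E where "E = ?N * (p - 1) - (?N + 1) * p / 2"
  define E' where "E' = ?N + 1 - 2 * p / (p - 1)"
  obtain C1 l where C1: "0 < C1" "1 \<le> l" "\<And>\<epsilon> T u R. solution \<epsilon> T u \<Longrightarrow> 0 < \<epsilon> \<Longrightarrow> l \<le> R \<Longrightarrow> ereal R < T \<Longrightarrow>
      \<epsilon> powr p \<le> C1 * R powr E * tail u R"
    by (rule lower_test[folded E_def]) (rule that)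
  obtain C2 where C2: "0 < C2" "\<And>\<epsilon> T u R. solution \<epsilon> T u \<Longrightarrow> 0 < \<epsilon> \<Longrightarrow> 1 \<le> R \<Longrightarrow> ereal R < T \<Longrightarrow>
      (LINT t:{0<..R}|lebesgue. cutoff p R t * source u t) \<le> C2 * R powr E'"
    by (rule constant_test[folded E'_def]) (rule that, assumption, blast)
  have EE: "E + E' = - (?\<Gamma> * p)"
    using p by (simp add: E_def E'_def Gamma_S_def field_simps)
  define C where "C = (C1 * C2) powr (1 / p)"
  have C: "0 < C" using C1 C2 by (simp add: C_def)
  have bound: "\<epsilon> \<le> C * R powr (- ?\<Gamma>)"
    if sol: "solution \<epsilon> T u" and \<epsilon>: "0 < \<epsilon>" and R: "l \<le> R" "ereal R < T" for \<epsilon> T u R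
  proof -
    have "\<epsilon> powr p \<le> C1 * R powr E * tail u R" by (rule C1(3)[OF sol \<epsilon> R])
    also have "\<dots> \<le> C1 * R powr E * (C2 * R powr E')"
      using C1(1,2) R tail_le_cutoff[OF sol R(2)] C2(2)[OF sol \<epsilon> _ R(2)]
      by (intro mult_left_mono) auto
    also have "\<dots> = C1 * C2 * R powr (- (?\<Gamma> * p))"
      by (simp add: EE[symmetric] powr_add)
    finally have "(\<epsilon> powr p) powr (1 / p) \<le> (C1 * C2 * R powr (- (?\<Gamma> * p))) powr (1 / p)"
      using p by (intro powr_mono2) auto
    also have "(C1 * C2 * R powr (- (?\<Gamma> * p))) powr (1 / p) = C * R powr (- ?\<Gamma>)"
      using p by (simp only: powr_mult[of "C1 * C2"] powr_powr C_def) simp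
    finally show ?thesis using p \<epsilon> by (simp add: powr_powr)
  qed
  have "T \<le> ereal ((C powr (1 / ?\<Gamma>) + l) * \<epsilon> powr (- (1 / ?\<Gamma>)))"
    if "0 < \<epsilon>" "\<epsilon> \<le> 1" "0 < T" "solution \<epsilon> T u" for \<epsilon> T u
    by (rule lifespan_from_powr_bound) (use that C C1(2) bound[OF that(4,1)] \<Gamma> in auto)
  then show ?thesis using C1(2) by (intro exI[of _ "C powr (1 / ?\<Gamma>) + l"]) (auto intro: add_nonneg_pos)
qed

lemma lifespan_critical:
  assumes N: "2 \<le> DIM('a)" and \<Gamma>: "Gamma_S DIM('a) p = 0"
  shows "\<exists>C>0. \<forall>\<epsilon> T u. 0 < \<epsilon> \<and> \<epsilon> \<le> 1 \<and> 0 < T \<and> solution \<epsilon> T u \<longrightarrow>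
    T \<le> ereal (exp (C * \<epsilon> powr (- (p * (p - 1)))))"
proof -
  let ?N = "real DIM('a)"
  define \<beta> where "\<beta> = (?N - 1) / 2 - 1 / p"
  define E where "E = ?N * (p - 1) - (?N + 1) * p / 2"
  \<comment> \<open>\<open>Gamma_S = 0\<close> reads N = 1 + 2 z, which eliminates the dimension and
    turns the relations for \<beta> and E into identities in p.\<close>
  define z where "z = (1 + 1 / p) * inverse (p - 1)"
  have "z - (?N - 1) / 2 = 0" using \<Gamma> unfolding Gamma_S_def z_def .
  then have N_eq: "?N = 1 + 2 * z" by simp
  have z: "z * (p - 1) = 1 + 1 / p" using p by (simp add: z_def)
  have \<beta>_eq: "\<beta> = 2 / (p * (p - 1))"
    unfolding \<beta>_def N_eq using p by (simp add: z_def divide_inverse[symmetric]) (simp add: field_simps)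
  then have \<beta>: "0 < \<beta>" using p by simp
  have "E + \<beta> = z * (p - 1) - (1 + 1 / p)"
    unfolding E_def \<beta>_def N_eq by (simp add: algebra_simps)
  \<comment> \<open>Criticality: the weight cancels the power of R in both test inequalities, and
    only powers of j remain.\<close>
  then have E\<beta>: "E + \<beta> = 0" using z by simp
  obtain C1 l1 where C1: "0 < C1" "1 \<le> l1" "\<And>\<epsilon> T u R. solution \<epsilon> T u \<Longrightarrow> 0 < \<epsilon> \<Longrightarrow> l1 \<le> R \<Longrightarrow> ereal R < T \<Longrightarrow>
      \<epsilon> powr p \<le> C1 * R powr E * tail u R"
    by (rule lower_test[folded E_def]) (rule that)
  define weight where "weight t = (1 + \<bar>t\<bar>) powr (- \<beta>)" for t :: real
  define X where "X u j = (LINT t:{0<..2 ^ j}|lebesgue. (weight t * cutoff p (2 ^ j) t) * source u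
      t)" for u and j :: nat
  obtain C2 l2 :: real where C2: "0 < C2" "1 \<le> l2"
    "\<And>\<epsilon> T u j. solution \<epsilon> T u \<Longrightarrow> 0 < \<epsilon> \<Longrightarrow> 1 \<le> j \<Longrightarrow> l2 \<le> 2 ^ j \<Longrightarrow> ereal (2 ^ j) < T \<Longrightarrow>
      X u j powr p \<le> C2 * real j powr (p - 1) * (2 ^ j) powr E * tail u (2 ^ j)"
    by (rule critical_test[OF N, folded \<beta>_def E_def weight_def, folded X_def, OF less_imp_le[OF
        \<beta>]]) (rule that)
  have weight: "0 \<le> weight t" "weight t \<le> 1" for t
    using powr_mono2'[of "- \<beta>" 1 "1 + \<bar>t\<bar>"] \<beta> by (auto simp: weight_def)
  have weight_meas: "weight \<in> borel_measurable borel"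
    unfolding weight_def by (intro borel_measurable_continuous_onI continuous_intros) auto
  \<comment> \<open>The sharp cutoff makes \<open>A u j - A u (j - 1)\<close> an integral over the
    dyadic block [2^(j - 1), 2^j).\<close>
  define A where "A u j = (LINT t:{0<..2 ^ j}|lebesgue. (indicator {..<2 ^ j} t * weight t) *
      source u t)" for u and j :: nat
  have iw: "(\<lambda>t. indicator {..<r} t * weight t) \<in> borel_measurable borel"
    "0 \<le> indicator {..<r} t * weight t" "indicator {..<r} t * weight t \<le> 1" for r t
    using weight[of t] by (auto intro!: borel_measurable_times weight_meas simp: indicator_def)
  have cw: "(\<lambda>t. weight t * cutoff p r t) \<in> borel_measurable borel"
    "0 \<le> weight t * cutoff p r t" "weight t * cutoff p r t \<le> 1" for r t
    using weight[of t] cutoff_bounds[of p r t]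
    by (auto intro!: borel_measurable_times weight_meas cutoff_measurable mult_le_one)
  \<comment> \<open>Comparison of sharp and smooth cutoffs: the smooth one at scale 2^j is 1 up to
    2^(j - 1) and 0 well before 2^j. The tail is bounded once by X, for the linear upper bound, and
    once by the increment of A, for the recursion.\<close>
  have steps: "A u (j - 1) \<le> X u j" "(2 ^ j) powr (- \<beta>) * tail u (2 ^ j) \<le> 2 powr \<beta> * X u j"
    "(2 ^ j) powr (- \<beta>) * tail u (2 ^ j) \<le> 2 powr \<beta> * (A u j - A u (j - 1))"
    if sol: "solution \<epsilon> T u" and j: "1 \<le> j" and T: "ereal (2 ^ j) < T" for \<epsilon> T u j
  proof -
    define R where "R = (2::real) ^ j"
    have "(2::real) ^ 1 \<le> 2 ^ j" using j by (intro power_increasing) auto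
    then have R: "2 \<le> R" "ereal R < T" "2 ^ (j - 1) = R / 2"
      using T j by (auto simp: R_def power_diff)
    note mono = weight_integral_mono[OF sol R(2)]
    have A': "A u (j - 1) = (LINT t:{0<..R}|lebesgue. (indicator {..<R / 2} t * weight t) * source u t)"
      unfolding A_def set_lebesgue_integral_def R(3) using R(1)
      by (intro Bochner_Integration.integral_cong) (auto simp: indicator_def)
    show "A u (j - 1) \<le> X u j"
      unfolding A' X_def R_def[symmetric]
    proof (rule mono[OF iw cw])
      fix t assume "0 < t" "t \<le> R"
      then show "indicator {..<R / 2} t * weight t \<le> weight t * cutoff p R t"
        using cutoff_eq_1[of R t p] R(1) cw(2)[of t R] by (auto simp: indicator_def)
    qed
    \<comment> \<open>From 1 + t \<le> 2 R.\<close>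
    have w2: "R powr (- \<beta>) \<le> 2 powr \<beta> * weight t" if "0 < t" "t \<le> R" for t
    proof -
      have "(2 * R) powr (- \<beta>) \<le> weight t"
        unfolding weight_def using that R(1) \<beta> by (intro powr_mono2') auto
      then have "2 powr \<beta> * (2 * R) powr (- \<beta>) \<le> 2 powr \<beta> * weight t" by (intro mult_left_mono) auto
      moreover have "2 powr \<beta> * (2 * R) powr (- \<beta>) = R powr (- \<beta>)"
        by (simp only: powr_mult mult.assoc[symmetric] powr_add[symmetric]) simp
      ultimately show ?thesis by simp
    qed
    let ?t = "\<lambda>t. R powr (- \<beta>) * (indicator {R / 2..} t * cutoff p R t)"
    have tm: "?t \<in> borel_measurable borel" "0 \<le> ?t t" "?t t \<le> R powr (- \<beta>)" for t
    proof -
      show "?t \<in> borel_measurable borel"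
        by (rule borel_measurable_times[OF borel_measurable_const tail_weight_measurable])
      show "0 \<le> ?t t" by (rule mult_nonneg_nonneg[OF powr_ge_zero tail_weight_bounds(1)])
      show "?t t \<le> R powr (- \<beta>)" by (rule mult_left_le[OF tail_weight_bounds(3) powr_ge_zero])
    qed
    have tail_eq: "R powr (- \<beta>) * tail u R = (LINT t:{0<..R}|lebesgue. ?t t * source u t)"
      by (simp add: tail_def mult.assoc)
    show "(2 ^ j) powr (- \<beta>) * tail u (2 ^ j) \<le> 2 powr \<beta> * X u j"
    proof -
      have "(LINT t:{0<..R}|lebesgue. ?t t * source u t)
          \<le> (LINT t:{0<..R}|lebesgue. (2 powr \<beta> * (weight t * cutoff p R t)) * source u t)"
      proof (rule mono[OF tm])
        show "(\<lambda>t. 2 powr \<beta> * (weight t * cutoff p R t)) \<in> borel_measurable borel"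
          by (intro borel_measurable_times cw(1)) auto
        show "0 \<le> 2 powr \<beta> * (weight t * cutoff p R t)" "2 powr \<beta> * (weight t * cutoff p R t)
            \<le> 2 powr \<beta>" for t
          using cw(2,3)[of t R] by (auto intro: mult_left_le)
        fix t assume t: "0 < t" "t \<le> R"
        have "?t t \<le> R powr (- \<beta>) * cutoff p R t"
          using tail_weight_bounds(2)[of R t] by (intro mult_left_mono) auto
        also have "\<dots> \<le> (2 powr \<beta> * weight t) * cutoff p R t"
          using w2[OF t] by (intro mult_right_mono cutoff_bounds)
        finally show "?t t \<le> 2 powr \<beta> * (weight t * cutoff p R t)" by (simp add: mult.assoc)
      qed
      also have "\<dots> = 2 powr \<beta> * X u j" by (simp add: X_def R_def mult.assoc)
      finally show ?thesis using tail_eq by (simp add: R_def)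
    qed
    show "(2 ^ j) powr (- \<beta>) * tail u (2 ^ j) \<le> 2 powr \<beta> * (A u j - A u (j - 1))"
    proof -
      let ?d = "\<lambda>t. indicator {..<R} t * weight t - indicator {..<R / 2} t * weight t"
      have d0: "0 \<le> ?d t" "?d t \<le> 1" for t
        using weight[of t] R(1) by (auto simp: indicator_def)
      have "(LINT t:{0<..R}|lebesgue. ?t t * source u t)
          \<le> (LINT t:{0<..R}|lebesgue. (2 powr \<beta> * ?d t) * source u t)"
      proof (rule mono[OF tm])
        show "(\<lambda>t. 2 powr \<beta> * ?d t) \<in> borel_measurable borel"
          by (intro borel_measurable_times borel_measurable_diff iw(1)) auto
        show "0 \<le> 2 powr \<beta> * ?d t" "2 powr \<beta> * ?d t \<le> 2 powr \<beta>" for t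
          using d0[of t] by (auto intro: mult_left_le)
        fix t assume t: "0 < t" "t \<le> R"
        show "?t t \<le> 2 powr \<beta> * ?d t"
        proof (cases "R / 2 \<le> t \<and> t < R")
          case True
          then have d: "?d t = weight t" by (auto simp: indicator_def)
          show ?thesis unfolding d using tm(3)[of t] w2[OF t] by (rule order_trans)
        next
          case False
          then have "?t t = 0" using t R(1) cutoff_eq_0[OF p, of R t] by (auto simp: indicator_def)
          also have "0 \<le> 2 powr \<beta> * ?d t" by (rule mult_nonneg_nonneg[OF powr_ge_zero d0(1)])
          finally show ?thesis .
        qed
      qed
      also have "\<dots> = 2 powr \<beta> * (A u j - A u (j - 1))"
      proof -
        have "(LINT t:{0<..R}|lebesgue. (2 powr \<beta> * ?d t) * source u t)
            = 2 powr \<beta> * (LINT t:{0<..R}|lebesgue. (indicator {..<R} t * weight t) * source u t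
                - (indicator {..<R / 2} t * weight t) * source u t)"
          by (simp only: mult.assoc left_diff_distrib set_integral_mult_right)
        also have "(LINT t:{0<..R}|lebesgue. (indicator {..<R} t * weight t) * source u t
                - (indicator {..<R / 2} t * weight t) * source u t) = A u j - A u (j - 1)"
          unfolding A' unfolding A_def R_def[symmetric]
          by (intro set_integral_diff(2) weight_integrable[OF sol R(2) iw])
        finally show ?thesis .
      qed
      finally show ?thesis using tail_eq by (simp add: R_def)
    qed
  qed
  define C3 where "C3 = C2 * 2 powr \<beta>"
  have C3: "0 < C3" using C2 by (simp add: C3_def)
  \<comment> \<open>One constant for all hypotheses of \<open>discrete_blow_up\<close>: the 1
    ensures C \<ge> 1, and \<open>C3 powr (1 / (p - 1))\<close> belongs to the linear upper
    bound.\<close>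
  define C where "C = 1 + C1 * 2 powr \<beta> + C3 + C3 powr (1 / (p - 1))"
  have C: "1 \<le> C" "C1 * 2 powr \<beta> \<le> C" "C3 \<le> C" "C3 powr (1 / (p - 1)) \<le> C" "0 < C"
    using C1(1) C3 by (auto simp: C_def add_nonneg_nonneg intro!: add_pos_nonneg)
  obtain m0 :: nat where m0: "max l1 l2 < 2 ^ m0" using real_arch_pow[of 2 "max l1 l2"] by auto
  define m where "m = Suc m0"
  define K where "K = 4 * real m + 4 + 2 * (1 + C powr p) powr p * C / (p - 1) * (4 * C) powr (p - 1)"
  have "0 \<le> 2 * (1 + C powr p) powr p * C / (p - 1) * (4 * C) powr (p - 1)" using C p by auto
  moreover have "0 < 4 * real m + 4" by linarith
  ultimately have K: "0 < K" unfolding K_def by linarith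
  have main: "real n \<le> K * \<epsilon> powr (- (p * (p - 1)))"
    if \<epsilon>: "0 < \<epsilon>" "\<epsilon> \<le> 1" and sol: "solution \<epsilon> T u" and n: "ereal (2 ^ n) < T" for \<epsilon> T u n
  proof -
    have jT: "1 \<le> j" "ereal (2 ^ j) < T" "l1 \<le> 2 ^ j" "l2 \<le> 2 ^ j" if "m < j" "j \<le> n" for j
    proof -
      show "1 \<le> j" using that by (simp add: m_def)
      have "(2::real) ^ j \<le> 2 ^ n" using that by (intro power_increasing) auto
      then show "ereal (2 ^ j) < T" using n by (metis ereal_less_eq(3) le_less_trans)
      have "(2::real) ^ m0 \<le> 2 ^ j" using that by (intro power_increasing) (auto simp: m_def)
      moreover have "l1 < 2 ^ m0" "l2 < 2 ^ m0" using m0 by simp_all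
      ultimately show "l1 \<le> 2 ^ j" "l2 \<le> 2 ^ j" by linarith+
    qed
    have RE: "(2 ^ j) powr E = (2 ^ j) powr (- \<beta>)" for j :: nat
    proof -
      have "E = - \<beta>" using E\<beta> by simp
      then show ?thesis by (simp only:)
    qed
    have A0: "0 \<le> A u j" for j
      unfolding A_def set_lebesgue_integral_def
      by (intro Bochner_Integration.integral_nonneg) (auto simp: source_nonneg weight)
    have X1: "X u j powr p \<le> C3 * real j powr (p - 1) * Y"
      if j: "m < j" "j \<le> n" and Y: "(2 ^ j) powr (- \<beta>) * tail u (2 ^ j) \<le> 2 powr \<beta> * Y" for j Y
    proof -
      note J = jT[OF j]
      have "X u j powr p \<le> C2 * real j powr (p - 1) * ((2 ^ j) powr (- \<beta>) * tail u (2 ^ j))"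
        using C2(3)[OF sol \<epsilon>(1) J(1,4,2)] by (simp add: RE mult.assoc)
      also have "\<dots> \<le> C2 * real j powr (p - 1) * (2 powr \<beta> * Y)"
        using C2(1) Y by (intro mult_left_mono) auto
      finally show ?thesis by (simp add: C3_def mult_ac)
    qed
    have "real n \<le> K * (\<epsilon> powr p) powr (1 - p)"
      unfolding K_def
    proof (rule discrete_blow_up[where A = "A u"])
      show "\<epsilon> powr p \<le> 1" using \<epsilon> p powr_mono2[of p \<epsilon> 1] by simp
      fix j assume j: "m < j" "j \<le> n"
      note J = jT[OF j] and S = steps[OF sol jT(1,2)[OF j]]
      have inc0: "0 \<le> A u j - A u (j - 1)"
      proof -
        have "0 \<le> (2 ^ j) powr (- \<beta>) * tail u (2 ^ j)" using tail_nonneg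
            by (intro mult_nonneg_nonneg) auto
        then have "0 \<le> 2 powr \<beta> * (A u j - A u (j - 1))" using S(3) by linarith
        then show ?thesis by (simp add: zero_le_mult_iff)
      qed
      show "A u (j - 1) + \<epsilon> powr p / C \<le> A u j"
      proof -
        have "\<epsilon> powr p \<le> C1 * ((2 ^ j) powr (- \<beta>) * tail u (2 ^ j))"
          using C1(3)[OF sol \<epsilon>(1) J(3,2)] by (simp add: RE mult.assoc)
        also have "\<dots> \<le> C1 * (2 powr \<beta> * (A u j - A u (j - 1)))"
          using C1(1) S(3) by (intro mult_left_mono) auto
        also have "\<dots> = (C1 * 2 powr \<beta>) * (A u j - A u (j - 1))" by simp
        also have "\<dots> \<le> C * (A u j - A u (j - 1))" using C(2) inc0 by (rule mult_right_mono)
        finally have "\<epsilon> powr p / C \<le> A u j - A u (j - 1)" using C(5)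
            by (simp add: pos_divide_le_eq mult.commute)
        then show ?thesis by simp
      qed
      show "A u (j - 1) powr p \<le> C * real j powr (p - 1) * (A u j - A u (j - 1))"
      proof -
        have "A u (j - 1) powr p \<le> X u j powr p" using S(1) A0 p by (intro powr_mono2) auto
        also have "\<dots> \<le> C3 * real j powr (p - 1) * (A u j - A u (j - 1))" by (rule X1[OF j S(3)])
        also have "\<dots> \<le> C * real j powr (p - 1) * (A u j - A u (j - 1))"
          using C(3) inc0 by (intro mult_right_mono) auto
        finally show ?thesis .
      qed
      \<comment> \<open>The weighted tail is at most a multiple of X, so X^p \<le> C3 j^(p - 1) X;
        dividing by X bounds X linearly in j.\<close>
      show "A u (j - 1) \<le> C * real j"
      proof (cases "X u j > 0")
        case True
        have "X u j powr p = X u j powr (p - 1) * X u j" using True powr_add[of "X u j" "p - 1" 1]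
            by simp
        then have "X u j powr (p - 1) * X u j \<le> C3 * real j powr (p - 1) * X u j"
            using X1[OF j S(2)] by simp
        then have "X u j powr (p - 1) \<le> C3 * real j powr (p - 1)" using True by simp
        then have "(X u j powr (p - 1)) powr (1 / (p - 1)) \<le> (C3 * real j powr (p
            - 1)) powr (1 / (p - 1))"
          using p by (intro powr_mono2) auto
        then have "X u j \<le> C3 powr (1 / (p - 1)) * real j"
          using True p by (simp add: powr_mult powr_powr)
        also have "\<dots> \<le> C * real j" using C(4) by (intro mult_right_mono) auto
        finally show ?thesis using S(1) by linarith
      next
        case False
        then have "A u (j - 1) \<le> 0" using S(1) by linarith
        also have "0 \<le> C * real j" using C(5) by simp
        finally show ?thesis .
      qed
    qed (use p C \<epsilon> A0 in \<open>auto simp: m_def\<close>)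
    also have "(\<epsilon> powr p) powr (1 - p) = \<epsilon> powr (- (p * (p - 1)))"
      by (simp add: powr_powr algebra_simps)
    finally show ?thesis .
  qed
  let ?C = "(K + 1) * ln 2"
  have "T \<le> ereal (exp (?C * \<epsilon> powr (- (p * (p - 1)))))"
    if \<epsilon>: "0 < \<epsilon>" "\<epsilon> \<le> 1" and sol: "solution \<epsilon> T u" for \<epsilon> T u
  proof (rule ccontr)
    let ?y = "\<epsilon> powr (- (p * (p - 1)))"
    assume "\<not> ?thesis"
    then have T: "ereal (exp (?C * ?y)) < T" by simp
    have "- (p * (p - 1)) \<le> 0" using p by simp
    then have y: "1 \<le> ?y" using \<epsilon> powr_mono2'[of "- (p * (p - 1))" \<epsilon> 1] by simp
    \<comment> \<open>The least integer above K ?y contradicts \<open>main\<close>. Rounding costs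
      at most 1 \<le> ?y, whence K + 1 in \<open>?C\<close>.\<close>
    define n where "n = nat \<lfloor>K * ?y\<rfloor> + 1"
    have Ky: "0 \<le> K * ?y" using K y by simp
    have n: "K * ?y < real n" "real n \<le> K * ?y + 1" using Ky unfolding n_def by linarith+
    have "real n \<le> (K + 1) * ?y" using n(2) y by (simp add: distrib_right)
    then have "real n * ln 2 \<le> (K + 1) * ?y * ln 2" by (intro mult_right_mono) auto
    then have "exp (real n * ln 2) \<le> exp (?C * ?y)" by (simp add: mult_ac)
    moreover have "exp (real n * ln 2) = 2 ^ n" by (simp add: exp_of_nat_mult)
    ultimately have "ereal (2 ^ n) < T" using T by (metis ereal_less_eq(3) le_less_trans)
    from main[OF \<epsilon> sol this] n(1) show False by simp
  qed
  then show ?thesis using K by (intro exI[of _ ?C]) auto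
qed

end

theorem proposition4p1:
  fixes G :: "real \<Rightarrow> real" and f g :: "real ^ 'n \<Rightarrow> real" and p a r0 :: real and N :: nat
  assumes "N = CARD('n)" and "1 < p" and "0 < a"
    and "G C1_differentiable_on UNIV" and "G 0 = 0"
    and "\<And>s. a * \<bar>s\<bar> powr p \<le> G s"
    and "Cc_smooth f" and "Cc_smooth g"
    and "0 < (\<integral>x. g x \<partial>lebesgue)"
    and "r0 = (SUP x \<in> supp f \<union> supp g. norm x)"
    and "0 \<le> Gamma_S N p"
  shows "\<exists>\<epsilon>0>0. \<exists>C>0. \<forall>\<epsilon>. 0 < \<epsilon> \<and> \<epsilon> \<le> \<epsilon>0 \<longrightarrow>
    (\<forall>T u. 0 < T \<and> weak_solution G f g \<epsilon> T u \<and>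
        supp_st T u \<subseteq> {(x, t). 0 \<le> t \<and> ereal t \<le> T \<and> norm x \<le> r0 + t} \<longrightarrow>
      (N = 1 \<longrightarrow> T \<le> ereal (C * \<epsilon> powr (- ((p - 1) / 2)))) \<and>
      (N = 2 \<and> p \<le> 2 \<longrightarrow> T \<le> ereal (C * \<epsilon> powr (- ((p - 1) / (3 - p))))) \<and>
      (N = 2 \<and> 2 < p \<and> ereal p < p_S 2 \<longrightarrow>
         T \<le> ereal (C * \<epsilon> powr (- inverse (Gamma_S 2 p)))) \<and>
      (3 \<le> N \<and> ereal p < p_S N \<longrightarrow>
         T \<le> ereal (C * \<epsilon> powr (- inverse (Gamma_S N p)))) \<and>
      (2 \<le> N \<and> ereal p = p_S N \<longrightarrow>
         T \<le> ereal (exp (C * \<epsilon> powr (- (p * (p - 1)))))))"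
proof -
  have p: "1 < p" by fact
  have N: "DIM(real ^ 'n) = N" "1 \<le> N" using assms(1) by (simp_all add: Suc_le_eq)
  have supp: "x \<in> supp h" if "h x \<noteq> 0" for h :: "real ^ 'n \<Rightarrow> real" and x
    unfolding supp_def using that by (intro subsetD[OF closure_subset]) simp
  have "compact (supp f \<union> supp g)" using assms(7,8) by (simp add: Cc_smooth_def compact_Un)
  then have "bdd_above (norm ` (supp f \<union> supp g))"
    by (intro bounded_imp_bdd_above compact_imp_bounded compact_continuous_image) (auto intro:
        continuous_intros)
  then have r0: "norm x \<le> r0" if "x \<in> supp f \<union> supp g" for x
    unfolding assms(10) using that by (intro cSUP_upper)
  \<comment> \<open>r0 is a supremum of norms; the positive integral of g supplies a point of the
    support, which gives r0 \<ge> 0.\<close>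
  have "\<exists>x. g x \<noteq> 0"
  proof (rule ccontr)
    assume "\<not> ?thesis"
    then show False using assms(9) by simp
  qed
  then obtain x where "g x \<noteq> 0" by blast
  then have "0 \<le> r0" using r0 supp by (metis UnI2 norm_ge_zero order_trans)
  interpret semilinear_wave G f g p a r0
    by unfold_locales
       (use assms(2,3,5,6,7,8,9) \<open>0 \<le> r0\<close> r0 supp in \<open>auto simp: Cc_smooth_def intro: smooth_continuous\<close>)
  \<comment> \<open>The case condition Q sits inside the quantifiers, so a positive constant exists
    in every case, vacuously when Q fails, and the five constants can be added.\<close>
  define holds where "holds Q B \<longleftrightarrow> (\<exists>C>0. \<forall>\<epsilon> T u. 0 < \<epsilon> \<and> \<epsilon> \<le> 1 \<and> 0 < T \<and> solution \<epsilon> T u \<and> Q \<longrightarrow> T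
      \<le> ereal (B C \<epsilon>))"
    for Q and B :: "real \<Rightarrow> real \<Rightarrow> real"
  have holds: "holds Q B" if "Q \<Longrightarrow> \<exists>C>0. \<forall>\<epsilon> T u. 0 < \<epsilon> \<and> \<epsilon> \<le> 1 \<and> 0 < T \<and> solution \<epsilon> T u \<longrightarrow> T
      \<le> ereal (B C \<epsilon>)" for Q B
  proof (cases Q)
    case False
    then show ?thesis unfolding holds_def by (intro exI[of _ 1]) auto
  qed (use that in \<open>auto simp: holds_def\<close>)
  have 1: "holds (N = 1) (\<lambda>C \<epsilon>. C * \<epsilon> powr (- ((p - 1) / 2)))"
  proof (rule holds)
    assume N1: "N = 1"
    have "2 * p / (p - 1) - real DIM(real ^ 'n) - 1 = 2 / (p - 1)"
      using p unfolding N(1) N1 by (simp add: field_simps)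
    moreover from this have "real DIM(real ^ 'n) + 1 < 2 * p / (p - 1)"
      using p divide_pos_pos[of 2 "p - 1"] by linarith
    ultimately show "\<exists>C>0. \<forall>\<epsilon> T u. 0 < \<epsilon> \<and> \<epsilon> \<le> 1 \<and> 0 < T \<and> solution \<epsilon> T u \<longrightarrow>
        T \<le> ereal (C * \<epsilon> powr (- ((p - 1) / 2)))"
      using lifespan_constant by simp
  qed
  have 2: "holds (N = 2 \<and> p \<le> 2) (\<lambda>C \<epsilon>. C * \<epsilon> powr (- ((p - 1) / (3 - p))))"
  proof (rule holds)
    assume N2: "N = 2 \<and> p \<le> 2"
    then have "2 * p / (p - 1) - real DIM(real ^ 'n) - 1 = (3 - p) / (p - 1)"
      using p unfolding N(1) by (simp add: field_simps)
    moreover from this have "real DIM(real ^ 'n) + 1 < 2 * p / (p - 1)"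
      using p N2 divide_pos_pos[of "3 - p" "p - 1"] by linarith
    ultimately show "\<exists>C>0. \<forall>\<epsilon> T u. 0 < \<epsilon> \<and> \<epsilon> \<le> 1 \<and> 0 < T \<and> solution \<epsilon> T u \<longrightarrow>
        T \<le> ereal (C * \<epsilon> powr (- ((p - 1) / (3 - p))))"
      using lifespan_constant by simp
  qed
  have sub: "\<exists>C>0. \<forall>\<epsilon> T u. 0 < \<epsilon> \<and> \<epsilon> \<le> 1 \<and> 0 < T \<and> solution \<epsilon> T u \<longrightarrow>
      T \<le> ereal (C * \<epsilon> powr (- inverse (Gamma_S N p)))" if "ereal p < p_S N"
    using lifespan_subcritical Gamma_S_pos[OF p N(2) that] unfolding N(1)
        by (simp add: inverse_eq_divide)
  have 3: "holds (N = 2 \<and> 2 < p \<and> ereal p < p_S 2) (\<lambda>C \<epsilon>. C * \<epsilon> powr (- inverse (Gamma_S 2 p)))"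
    by (rule holds) (use sub in auto)
  have 4: "holds (3 \<le> N \<and> ereal p < p_S N) (\<lambda>C \<epsilon>. C * \<epsilon> powr (- inverse (Gamma_S N p)))"
    by (rule holds) (use sub in auto)
  have 5: "holds (2 \<le> N \<and> ereal p = p_S N) (\<lambda>C \<epsilon>. exp (C * \<epsilon> powr (- (p * (p - 1)))))"
    by (rule holds) (use lifespan_critical Gamma_S_eq_0[OF p N(2)] N(1) in auto)
  obtain C1 where C1: "0 < C1" "\<And>\<epsilon> T u. 0 < \<epsilon> \<and> \<epsilon> \<le> 1 \<and> 0 < T \<and> solution \<epsilon> T u \<and> (N = 1) \<Longrightarrow>
      T \<le> ereal (C1 * \<epsilon> powr (- ((p - 1) / 2)))"
    using 1 unfolding holds_def by blast
  obtain C2 where C2: "0 < C2" "\<And>\<epsilon> T u. 0 < \<epsilon> \<and> \<epsilon> \<le> 1 \<and> 0 < T \<and> solution \<epsilon> T u \<and> (N = 2 \<and> p \<le> 2) \<Longrightarrow>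
      T \<le> ereal (C2 * \<epsilon> powr (- ((p - 1) / (3 - p))))"
    using 2 unfolding holds_def by blast
  obtain C3 where C3: "0 < C3" "\<And>\<epsilon> T u. 0 < \<epsilon> \<and> \<epsilon> \<le> 1 \<and> 0 < T \<and> solution \<epsilon> T u \<and> (N = 2 \<and> 2 < p
      \<and> ereal p < p_S 2) \<Longrightarrow>
      T \<le> ereal (C3 * \<epsilon> powr (- inverse (Gamma_S 2 p)))"
    using 3 unfolding holds_def by blast
  obtain C4 where C4: "0 < C4" "\<And>\<epsilon> T u. 0 < \<epsilon> \<and> \<epsilon> \<le> 1 \<and> 0 < T \<and> solution \<epsilon> T u \<and> (3 \<le> N
      \<and> ereal p < p_S N) \<Longrightarrow>
      T \<le> ereal (C4 * \<epsilon> powr (- inverse (Gamma_S N p)))"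
    using 4 unfolding holds_def by blast
  obtain C5 where C5: "0 < C5" "\<And>\<epsilon> T u. 0 < \<epsilon> \<and> \<epsilon> \<le> 1 \<and> 0 < T \<and> solution \<epsilon> T u \<and> (2 \<le> N \<and> ereal p
      = p_S N) \<Longrightarrow>
      T \<le> ereal (exp (C5 * \<epsilon> powr (- (p * (p - 1)))))"
    using 5 unfolding holds_def by blast
  define C where "C = C1 + C2 + C3 + C4 + C5"
  have le: "C1 \<le> C" "C2 \<le> C" "C3 \<le> C" "C4 \<le> C" "C5 \<le> C" "0 < C"
    using C1(1) C2(1) C3(1) C4(1) C5(1) by (auto simp: C_def)
  have mono: "T \<le> ereal (C' * y) \<Longrightarrow> T \<le> ereal (C * y)" "T \<le> ereal (exp (C' * y)) \<Longrightarrow> T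
      \<le> ereal (exp (C * y))"
    if "C' \<le> C" "0 \<le> y" for C' y T
    using mult_right_mono[OF that] by (auto elim!: order_trans)
  show ?thesis
  \<comment> \<open>\<epsilon>0 = 1, since smallness of \<epsilon> enters the estimates only by
    making its negative powers at least 1.\<close>
  proof (rule exI[of _ 1], rule conjI[OF zero_less_one], rule exI[of _ C], intro conjI allI impI)
    fix \<epsilon> T u
    assume \<epsilon>: "0 < \<epsilon> \<and> \<epsilon> \<le> 1" and "0 < T \<and> weak_solution G f g \<epsilon> T u \<and>
        supp_st T u \<subseteq> {(x, t). 0 \<le> t \<and> ereal t \<le> T \<and> norm x \<le> r0 + t}"
    then have b: "0 < \<epsilon>" "\<epsilon> \<le> 1" "0 < T" "solution \<epsilon> T u" by (auto simp: solution_def)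
    show "T \<le> ereal (C * \<epsilon> powr (- ((p - 1) / 2)))" if "N = 1"
      by (rule mono(1)[OF le(1) powr_ge_zero C1(2)]) (use b that in auto)
    show "T \<le> ereal (C * \<epsilon> powr (- ((p - 1) / (3 - p))))" if "N = 2 \<and> p \<le> 2"
      by (rule mono(1)[OF le(2) powr_ge_zero C2(2)]) (use b that in auto)
    show "T \<le> ereal (C * \<epsilon> powr (- inverse (Gamma_S 2 p)))" if "N = 2 \<and> 2 < p \<and> ereal p < p_S 2"
      by (rule mono(1)[OF le(3) powr_ge_zero C3(2)]) (use b that in auto)
    show "T \<le> ereal (C * \<epsilon> powr (- inverse (Gamma_S N p)))" if "3 \<le> N \<and> ereal p < p_S N"
      by (rule mono(1)[OF le(4) powr_ge_zero C4(2)]) (use b that in auto)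
    show "T \<le> ereal (exp (C * \<epsilon> powr (- (p * (p - 1)))))" if "2 \<le> N \<and> ereal p = p_S N"
      by (rule mono(2)[OF le(5) powr_ge_zero C5(2)]) (use b that in auto)
  qed (use le in auto)
qed

end
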